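(* Let $\varepsilon > 0$. There exists $N_0 = N_0(\varepsilon)$ such that for every integer $N \ge N_0$ the following holds. For any set $A$ of integers in $[1,N]$ satisfying \[\sum_{n\in A}\frac1n \ge (\log N)^{4/5+\varepsilon},\] there is a subset $B\subseteq A$ with \[\sum_{n\in B}\frac1n = 1.\]
   Context: $\log$ denotes the natural logarithm. $[1,N]$ denotes the set of integers $\{1,\dots,N\}$. *)

theory Defs
  imports Complex_Main
begin

end

theory Submission
  imports Defs "HOL-Number_Theory.Prime_Powers" "HOL-Real_Asymp.Real_Asymp"
begin

text \<open>
  Write \<open>R(A)\<close> for the sum of \<open>1/n\<close> over \<open>n \<in> A\<close> and \<open>L = ln N\<close>.  The proof is by the circle
  method, in the form given to it by Croot and refined by Bloom and by Liu and Sawhney.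

  \<^bold>\<open>Detecting a sum equal to 1.\<close>  Let \<open>Q = Lcm A\<close>.  Averaging \<open>cos (2 \<pi> h R(S))\<close> over \<open>h\<close> modulo \<open>Q\<close>
  gives 1 if \<open>R(S)\<close> is an integer and 0 otherwise.  If \<open>R(A) < 2\<close>, the only subsets with integral
  \<open>R(S)\<close> are the empty one and those with \<open>R(S) = 1\<close>, so it suffices that the total over all
  \<open>S \<subseteq> A\<close> exceeds 1.  The sum over \<open>S\<close> factorises into
  \<open>2 ^ |A| cos (\<pi> h R(A)) \<Prod> cos (\<pi> h / n)\<close>.  When all \<open>n\<close> are at least \<open>M\<close> and \<open>R(A)\<close> is within \<open>1/M\<close>
  below 2, every \<open>h\<close> within \<open>M/2\<close> of a multiple of \<open>Q\<close> contributes a nonnegative amount, and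
  \<open>h = 0\<close> contributes \<open>2 ^ |A|\<close>.  The other \<open>h\<close> have to be shown to contribute little.

  \<^bold>\<open>Alignment.\<close>  If no multiple of \<open>n\<close> lies within \<open>K\<close> of \<open>h\<close>, the factor \<open>cos (\<pi> h / n)\<close> is at most
  \<open>exp (-(K/n)\<^sup>2)\<close> in absolute value; call such an \<open>n\<close> unaligned with \<open>h\<close>.  For a prime power \<open>q\<close>
  consider the \<open>n \<in> A\<close> which \<open>q\<close> divides exactly.  Either many of them are unaligned, which makes the
  product tiny, or nearly all are aligned.  In the second case there is a point \<open>x\<close> within \<open>K\<close> of \<open>h\<close>
  which is divisible by \<open>q\<close> and by many small primes (\<open>aligned_sum_le\<close>).  Two different points that
  close together cannot both be divisible by so many primes, as they would share too many of
  them (\<open>aligned_points_eq\<close>); hence one and the same \<open>x\<close> serves all aligned \<open>q\<close>.  Thus \<open>h\<close> lies within \<open>K\<close>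
  of a multiple of all the aligned prime powers, so there are at most about
  \<open>K\<close> times the product of the remaining prime powers such \<open>h\<close>, and each of the remaining
  prime powers contributes a saving far below \<open>1/N\<close>.  If no prime power remains, \<open>h\<close> is near a
  multiple of \<open>Q\<close>.  This is \<open>minor_arcs_imp_unit_sum\<close>.

  \<^bold>\<open>Many small primes.\<close>  Let \<open>z = exp (L powr (1/2))\<close> and write an \<open>n\<close> exactly divisible by \<open>q\<close> as
  \<open>q c b\<close> with \<open>b\<close> composed of primes up to \<open>z\<close> and \<open>c\<close> of primes beyond \<open>z\<close>.  Unless \<open>b\<close> is
  exceptionally large, \<open>q c > 2 K\<close>.  Then two aligned \<open>n\<close> with the same \<open>c\<close> have the common
  divisor \<open>q c\<close>, hence the same multiple \<open>x\<close> near \<open>h\<close>, and all their parts \<open>b\<close> divide \<open>x\<close>.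
  If \<open>x\<close> had few small primes, the reciprocal sum of these \<open>b\<close>
  would be small, and so would be that of the aligned \<open>n\<close>.  The reciprocal sums over
  smooth and rough numbers in short windows which this needs all come from the identity
  \<open>ln m = \<Sum> \<Lambda>(d)\<close> over the divisors \<open>d\<close> of \<open>m\<close> and the estimates of Chebyshev and Mertens (\<open>sum_ln_over_le\<close>).

  \<^bold>\<open>Where the exponent enters.\<close>  The argument needs every exact prime power \<open>q\<close> of \<open>n \<in> A\<close> to be at most
  \<open>n / exp (L powr (4/5))\<close>; the \<open>n \<le> N\<close> violating this have reciprocal sum at most of
  order \<open>L powr (4/5) ln L\<close>.  It also needs \<open>A\<close> to lie in a window \<open>[M, M exp (L powr (1/5))]\<close>.  There are about
  \<open>L powr (4/5)\<close> such windows up to \<open>N\<close>, so some window contains a part of \<open>A\<close> with reciprocal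
  sum at least 4.  That part is thinned to a set with \<open>R\<close> just below 2 in which every
  exact prime power still occurs with substantial weight (\<open>exists_balanced_subset\<close> and
  \<open>exists_balanced_subset_near_two\<close>).
\<close>

section \<open>The estimates of Chebyshev and Mertens\<close>

text \<open>
  Sum \<open>ln k = \<Sum> \<Lambda>(d)\<close> over \<open>k \<le> n\<close>: the divisor \<open>d\<close> occurs for \<open>n div d\<close> values of \<open>k\<close>.
\<close>

lemma ln_fact_eq_sum_mangoldt:
  "ln (fact n :: real) = (\<Sum>d=1..n. mangoldt d * real (n div d))"
proof (induction n)
  case 0
  then show ?case by simp
next
  case (Suc n)
  have "(\<Sum>d=1..Suc n. mangoldt d * real (Suc n div d))
      = (\<Sum>d=1..Suc n. mangoldt d * real (n div d) + (if d dvd Suc n then mangoldt d else 0))"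
  proof (intro sum.cong refl)
    fix d assume "d \<in> {1..Suc n}"
    show "mangoldt d * real (Suc n div d) = mangoldt d * real (n div d) + (if d dvd Suc n then mangoldt d else 0)"
    proof (cases "d dvd Suc n")
      case True
      hence "Suc n div d = Suc (n div d)" by (simp add: div_Suc mod_eq_0_iff_dvd)
      thus ?thesis using True by (simp add: distrib_left)
    next
      case False
      hence "Suc n div d = n div d" by (simp add: div_Suc mod_eq_0_iff_dvd)
      thus ?thesis using False by simp
    qed
  qed
  also have "\<dots> = (\<Sum>d=1..Suc n. mangoldt d * real (n div d))
      + (\<Sum>d=1..Suc n. if d dvd Suc n then mangoldt d else (0::real))"
    by (rule sum.distrib)
  also have "(\<Sum>d=1..Suc n. if d dvd Suc n then mangoldt d else (0::real))
      = (\<Sum>d | d dvd Suc n. mangoldt d)"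
  proof (rule sum.mono_neutral_cong_right)
    show "{d. d dvd Suc n} \<subseteq> {1..Suc n}"
      by (auto dest: dvd_imp_le simp: Suc_le_eq intro!: Nat.gr0I)
  qed auto
  also have "\<dots> = ln (real (Suc n))"
    using mangoldt_sum[of "Suc n", where 'a = real] by simp
  also have "(\<Sum>d=1..Suc n. mangoldt d * real (n div d)) = ln (fact n)"
    using Suc by simp
  also have "ln (fact n) + ln (real (Suc n)) = ln (fact (Suc n) :: real)"
    by (simp only: fact_Suc ln_mult_pos of_nat_0_less_iff fact_gt_zero zero_less_Suc add.commute)
  finally show ?case by (simp only:)
qed

text \<open>
  Chebyshev's argument.  In the logarithm of the central binomial coefficient the number \<open>\<Lambda>(d)\<close> has
  the coefficient \<open>2 m div d - 2 (m div d)\<close>, which is never negative and equals 1 for \<open>m < d \<le> 2 m\<close>.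
\<close>

lemma sum_mangoldt_dyadic_le: "(\<Sum>d\<in>{m<..2*m}. mangoldt d) \<le> real m * ln 4"
proof -
  have "(\<Sum>d\<in>{m<..2*m}. mangoldt d :: real)
      \<le> (\<Sum>d=1..2*m. mangoldt d * (real (2*m div d) - 2 * real (m div d)))"
  proof (rule sum_le_included[where i = id])
    show "\<forall>d\<in>{1..2*m}. 0 \<le> mangoldt d * (real (2*m div d) - 2 * real (m div d))"
    proof
      fix d :: nat
      have "2 * (m div d) \<le> 2 * m div d"
      proof (cases "d = 0")
        case False
        have "2 * (m div d) * d \<le> 2 * m" by simp
        thus ?thesis using False by (simp add: less_eq_div_iff_mult_less_eq)
      qed auto
      thus "0 \<le> mangoldt d * (real (2*m div d) - 2 * real (m div d))"
        by (intro mult_nonneg_nonneg mangoldt_nonneg) linarith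
    qed
    show "\<forall>d\<in>{m<..2*m}. \<exists>y\<in>{1..2*m}. id y = d \<and>
        (mangoldt d :: real) \<le> mangoldt y * (real (2*m div y) - 2 * real (m div y))"
    proof
      fix d assume d: "d \<in> {m<..2*m}"
      have "2*m div d = 1" using d by (intro div_nat_eqI) auto
      moreover have "m div d = 0" using d by simp
      ultimately show "\<exists>y\<in>{1..2*m}. id y = d \<and>
        (mangoldt d :: real) \<le> mangoldt y * (real (2*m div y) - 2 * real (m div y))"
        using d by (intro bexI[of _ d]) auto
    qed
  qed auto
  also have "\<dots> = ln (fact (2*m)) - 2 * (\<Sum>d=1..2*m. mangoldt d * real (m div d))"
    unfolding ln_fact_eq_sum_mangoldt sum_distrib_left sum_subtractf [symmetric]
    by (intro sum.cong refl) (simp only: right_diff_distrib mult.left_commute)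
  also have "(\<Sum>d=1..2*m. mangoldt d * real (m div d)) = (\<Sum>d=1..m. mangoldt d * real (m div d))"
    by (rule sum.mono_neutral_right) auto
  also have "\<dots> = ln (fact m)" by (rule ln_fact_eq_sum_mangoldt [symmetric])
  also have "ln (fact (2*m) :: real) - 2 * ln (fact m) = ln (real ((2*m) choose m))"
  proof -
    have "real ((2*m) choose m) = fact (2*m) / (fact m * fact m)"
      by (subst binomial_fact) (auto simp: mult_2)
    also have "ln \<dots> = ln (fact (2*m)) - (ln (fact m) + ln (fact m))"
      by (subst ln_div) (auto simp: ln_mult_pos)
    finally show ?thesis by simp
  qed
  also have "\<dots> \<le> ln (4 ^ m)"
  proof (subst ln_le_cancel_iff)
    have "real ((2*m) choose m) \<le> real (2 ^ (2 * m))"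
      using binomial_le_pow2[of "2*m" m] by (simp only: of_nat_le_iff)
    also have "\<dots> = 4 ^ m" by (simp add: power_mult)
    finally show "real ((2*m) choose m) \<le> 4 ^ m" .
  qed (auto simp: zero_less_binomial_iff)
  also have "\<dots> = real m * ln 4" by (simp add: ln_realpow)
  finally show ?thesis .
qed

lemma ln4_le: "ln 4 \<le> (2 :: real)"
proof -
  have "ln (4::real) = ln (2 * 2)" by simp
  also have "\<dots> = 2 * ln 2" by (subst ln_mult) auto
  finally show ?thesis using ln_2_less_1 by simp
qed

text \<open>
  The dyadic bound is applied to \<open>n\<close>, \<open>n/2\<close>, \<open>n/4\<close> and so on.  The constant 4 is what rounding up in the
  halving permits: \<open>m \<le> 2 n / 3\<close> for the rounded half \<open>m\<close>, and \<open>(2/3) (4 + 2) = 4\<close>.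
\<close>

lemma sum_mangoldt_le: "(\<Sum>d=1..n. mangoldt d) \<le> 4 * real n"
proof (induction n rule: less_induct)
  case (less n)
  show ?case
  proof (cases "n < 2")
    case True
    hence "n = 0 \<or> n = 1" by auto
    thus ?thesis by auto
  next
    case False
    define m where "m = (n + 1) div 2"
    have m: "m < n" "n \<le> 2 * m" "3 * m \<le> 2 * n"
      using False by (auto simp: m_def)
    have "(\<Sum>d=1..n. mangoldt d :: real) \<le> (\<Sum>d\<in>{1..m} \<union> {m<..2*m}. mangoldt d)"
      using m by (intro sum_mono2) (auto simp: mangoldt_nonneg)
    also have "\<dots> = (\<Sum>d=1..m. mangoldt d) + (\<Sum>d\<in>{m<..2*m}. mangoldt d)"
      by (rule sum.union_disjoint) auto
    also have "\<dots> \<le> 4 * real m + real m * ln 4"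
      using less[OF m(1)] sum_mangoldt_dyadic_le[of m] by linarith
    also have "\<dots> \<le> 4 * real m + real m * 2"
      using ln4_le by (intro add_left_mono mult_left_mono) auto
    also have "\<dots> \<le> 4 * real n" using m(3) by linarith
    finally show ?thesis .
  qed
qed

lemma ln_fact_ge: "ln (fact n :: real) \<ge> real n * ln (real n) - real n"
proof (induction n)
  case (Suc n)
  show ?case
  proof (cases "n = 0")
    case False
    have "real n * (ln (real (Suc n)) - ln (real n)) = real n * ln (1 + 1 / real n)"
    proof -
      have "ln (real (Suc n)) - ln (real n) = ln (real (Suc n) / real n)"
        using False by (subst ln_div) auto
      also have "real (Suc n) / real n = 1 + 1 / real n" using False by (simp add: field_simps)
      finally show ?thesis by simp
    qed
    also have "\<dots> \<le> real n * (1 / real n)"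
      using False by (intro mult_left_mono ln_add_one_self_le_self) auto
    also have "\<dots> = 1" using False by simp
    finally have "real n * ln (real (Suc n)) \<le> real n * ln (real n) + 1"
      by (simp add: algebra_simps)
    moreover have "ln (fact (Suc n) :: real) = ln (real (Suc n)) + ln (fact n)"
      by (simp only: fact_Suc ln_mult_pos of_nat_0_less_iff fact_gt_zero zero_less_Suc)
    moreover have "real (Suc n) * ln (real (Suc n)) = real n * ln (real (Suc n)) + ln (real (Suc n))"
      by (simp add: algebra_simps)
    ultimately show ?thesis using Suc by simp
  qed auto
qed auto

lemma ln_fact_le: "ln (fact n :: real) \<le> real n * ln (real n)"
proof (cases "n = 0")
  case False
  have "ln (fact n :: real) \<le> ln (real n ^ n)"
    using fact_le_power[of n, where 'a = real] False by (subst ln_le_cancel_iff) auto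
  also have "\<dots> = real n * ln (real n)" using False by (simp add: ln_realpow)
  finally show ?thesis .
qed auto

text \<open>
  This and the next lemma are Mertens' first theorem.  In the formula for \<open>ln (fact n)\<close>, replacing
  \<open>n div d\<close> by \<open>n / d\<close> costs at most the sum of all \<open>\<Lambda>(d)\<close>, which is of order \<open>n\<close>.
\<close>

lemma sum_mangoldt_over_upper:
  assumes "n > 0" shows "(\<Sum>d=1..n. mangoldt d / real d) \<le> ln (real n) + 4"
proof -
  have "real n * (\<Sum>d=1..n. mangoldt d / real d) = (\<Sum>d=1..n. mangoldt d * (real n / real d))"
    by (simp add: sum_distrib_left mult_ac)
  also have "\<dots> \<le> (\<Sum>d=1..n. mangoldt d * (real (n div d) + 1))"
  proof (intro sum_mono mult_left_mono mangoldt_nonneg)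
    fix d assume "d \<in> {1..n}"
    hence "n < (n div d + 1) * d" using dividend_less_div_times[of d n] by (simp add: algebra_simps)
    hence "real n < real ((n div d + 1) * d)" by (simp only: of_nat_less_iff)
    thus "real n / real d \<le> real (n div d) + 1" using \<open>d \<in> {1..n}\<close>
      by (simp add: field_simps)
  qed
  also have "\<dots> = ln (fact n) + (\<Sum>d=1..n. mangoldt d)"
    unfolding ln_fact_eq_sum_mangoldt by (simp add: algebra_simps sum.distrib)
  also have "\<dots> \<le> real n * ln (real n) + 4 * real n"
    using ln_fact_le[of n] sum_mangoldt_le[of n] by linarith
  also have "\<dots> = real n * (ln (real n) + 4)" by (simp add: algebra_simps)
  finally show ?thesis using assms by (simp add: mult_le_cancel_left_pos)
qed

lemma sum_mangoldt_over_lower: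
  assumes "n > 0" shows "(\<Sum>d=1..n. mangoldt d / real d) \<ge> ln (real n) - 1"
proof -
  have "real n * (ln (real n) - 1) \<le> ln (fact n)"
    using ln_fact_ge[of n] by (simp add: algebra_simps)
  also have "\<dots> \<le> (\<Sum>d=1..n. mangoldt d * (real n / real d))"
    unfolding ln_fact_eq_sum_mangoldt
    by (intro sum_mono mult_left_mono mangoldt_nonneg of_nat_div_le_of_nat)
  also have "\<dots> = real n * (\<Sum>d=1..n. mangoldt d / real d)"
    by (simp add: sum_distrib_left mult_ac)
  finally show ?thesis using assms by (simp add: mult_le_cancel_left_pos)
qed

lemma finite_nat_real_le [simp]: "finite {n::nat. real n \<le> x \<and> P n}"
  by (rule finite_subset[of _ "{..nat \<lfloor>x\<rfloor>}"]) (auto simp: le_nat_iff le_floor_iff)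

text \<open>
  The two halves of Mertens' theorem, subtracted.  The bound depends on the ratio \<open>V\<close> of the
  window and not on its position; this uniformity, down to \<open>u < 1\<close>, is what the later sums over
  windows \<open>u = y / k\<close> use.
\<close>

lemma sum_mangoldt_over_window:
  assumes "u > 0" "V \<ge> 1"
  shows "(\<Sum>d | real d \<le> u * V \<and> u \<le> real d. mangoldt d / real d) \<le> ln V + 6"
proof (cases "u * V < 1")
  case True
  have "{d. real d \<le> u * V \<and> u \<le> real d} = {}"
  proof (intro equalityI subsetI)
    fix d assume "d \<in> {d. real d \<le> u * V \<and> u \<le> real d}"
    hence "real d < 1" "real d > 0" using True assms by auto
    thus "d \<in> {}" by simp
  qed auto
  hence "(\<Sum>d | real d \<le> u * V \<and> u \<le> real d. mangoldt d / real d) = (0::real)"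
    by (simp only: sum.empty)
  thus ?thesis using assms by simp
next
  case False
  define v where "v = nat \<lfloor>u * V\<rfloor>"
  have v: "v \<ge> 1" "real v \<le> u * V" using False by (auto simp: v_def le_nat_iff)
  have vle: "d \<le> v" if "real d \<le> u * V" for d using that by (auto simp: v_def le_nat_iff le_floor_iff)
  have up: "(\<Sum>d=1..v. mangoldt d / real d) \<le> ln u + ln V + 4"
  proof -
    have "(\<Sum>d=1..v. mangoldt d / real d) \<le> ln (real v) + 4"
      using v by (intro sum_mangoldt_over_upper) auto
    also have "ln (real v) \<le> ln (u * V)" using v by (subst ln_le_cancel_iff) auto
    also have "\<dots> = ln u + ln V" using assms by (simp add: ln_mult)
    finally show ?thesis by simp
  qed
  show ?thesis
  proof (cases "u \<le> 2")
    case True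
    have "(\<Sum>d | real d \<le> u * V \<and> u \<le> real d. mangoldt d / real d) \<le> (\<Sum>d=1..v. mangoldt d / real d)"
    proof (rule sum_mono2)
      show "{d. real d \<le> u * V \<and> u \<le> real d} \<subseteq> {1..v}"
      proof
        fix d assume d: "d \<in> {d. real d \<le> u * V \<and> u \<le> real d}"
        hence "real d > 0" using assms by auto
        thus "d \<in> {1..v}" using vle[of d] d by auto
      qed
    qed (auto simp: mangoldt_nonneg)
    moreover have "ln u \<le> ln 2" using True assms by (subst ln_le_cancel_iff) auto
    ultimately show ?thesis using up ln_2_less_1 by linarith
  next
    case False
    define n where "n = nat \<lceil>u\<rceil> - 1"
    have n: "n \<ge> 1" "real n < u" "real n \<ge> u - 1"
      using False by (auto simp: n_def) linarith+
    have "(\<Sum>d=1..n. mangoldt d / real d) + (\<Sum>d | real d \<le> u * V \<and> u \<le> real d. mangoldt d / real d)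
        = (\<Sum>d\<in>{1..n} \<union> {d. real d \<le> u * V \<and> u \<le> real d}. mangoldt d / real d)"
      using n by (intro sum.union_disjoint [symmetric]) auto
    also have "\<dots> \<le> (\<Sum>d=1..v. mangoldt d / real d)"
    proof (rule sum_mono2)
      have "d \<le> v" if "d \<le> n" for d
      proof (rule vle)
        have "real d \<le> u" using that n by linarith
        also have "u * 1 \<le> u * V" using assms by (intro mult_left_mono) auto
        finally show "real d \<le> u * V" by simp
      qed
      thus "{1..n} \<union> {d. real d \<le> u * V \<and> u \<le> real d} \<subseteq> {1..v}"
        using vle False by (auto simp: Suc_le_eq intro!: Nat.gr0I)
    qed (auto simp: mangoldt_nonneg)
    finally have "(\<Sum>d | real d \<le> u * V \<and> u \<le> real d. mangoldt d / real d)
       \<le> ln u + ln V + 4 - (ln (real n) - 1)"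
      using up sum_mangoldt_over_lower[of n] n by linarith
    moreover have "ln u - ln 2 \<le> ln (real n)"
    proof -
      have "ln u - ln 2 = ln (u / 2)" using assms by (simp add: ln_div)
      also have "\<dots> \<le> ln (real n)" using n False by (subst ln_le_cancel_iff) auto
      finally show ?thesis .
    qed
    ultimately show ?thesis using ln_2_less_1 by linarith
  qed
qed

text \<open>
  One step of the partial summation below, with \<open>t\<close> standing for the sum of \<open>\<Lambda>(d) / d\<close>.
\<close>

lemma ln_ln_step:
  assumes "n \<ge> 2" "(t::real) - 4 \<le> ln (real n)"
  shows "(t - 4) * (1 / ln (real n) - 1 / ln (real (Suc n))) \<le> ln (ln (real (Suc n))) - ln (ln (real n))"
proof -
  define a b where "a = ln (real n)" and "b = ln (real (Suc n))"
  have a: "a > 0" using assms by (simp add: a_def)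
  have ab: "a < b" using assms unfolding a_def b_def by (subst ln_less_cancel_iff) auto
  have "(t - 4) * (1 / a - 1 / b) \<le> a * (1 / a - 1 / b)"
    using assms(2) a ab by (intro mult_right_mono) (auto simp: a_def field_simps)
  also have "\<dots> = 1 - a / b" using a by (simp add: field_simps)
  also have "\<dots> \<le> - ln (a / b)" using ln_le_minus_one[of "a / b"] a ab by simp
  also have "\<dots> = ln b - ln a" using a ab by (simp add: ln_div)
  finally show ?thesis by (simp add: a_def b_def)
qed

text \<open>
  Partial summation from \<open>\<Lambda>(d) / d\<close> to \<open>\<Lambda>(d) / (d ln d)\<close>, which is \<open>1 / p\<close> at a prime \<open>p\<close>.  The boundary
  terms at \<open>n\<close> are kept so that the induction closes.
\<close>

lemma sum_mangoldt_over_ln_le: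
  assumes "n \<ge> 2"
  shows "(\<Sum>d=2..n. mangoldt d / (real d * ln (real d)))
     \<le> (\<Sum>d=1..n. mangoldt d / real d) / ln (real n) + ln (ln (real n)) - ln (ln 2) + 4 / ln 2 - 4 / ln (real n)"
  using assms
proof (induction n rule: dec_induct)
  case base
  have "{2..2} = {2::nat}" "{1..2} = {1::nat, 2}" by auto
  thus ?case by simp
next
  case (step n)
  let ?T = "\<lambda>n. (\<Sum>d=1..n. mangoldt d / real d) :: real"
  have n: "n \<ge> 2" using step by simp
  have l: "ln (real n) > 0" "ln (real (Suc n)) > 0" using n by auto
  have "?T n - 4 \<le> ln (real n)" using sum_mangoldt_over_upper[of n] n by simp
  from ln_ln_step[OF n this]
  have st: "(?T n - 4) * (1 / ln (real n) - 1 / ln (real (Suc n))) \<le> ln (ln (real (Suc n))) - ln (ln (real n))" .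
  have T: "?T (Suc n) = ?T n + mangoldt (Suc n) / real (Suc n)" by simp
  have "(\<Sum>d=2..Suc n. mangoldt d / (real d * ln (real d)))
     = (\<Sum>d=2..n. mangoldt d / (real d * ln (real d))) + mangoldt (Suc n) / real (Suc n) / ln (real (Suc n))"
    using n by (simp only: sum.nat_ivl_Suc' le_SucI divide_divide_eq_left add.commute)
  also have "\<dots> = (\<Sum>d=2..n. mangoldt d / (real d * ln (real d))) + (?T (Suc n) - ?T n) / ln (real (Suc n))"
    by (simp only: T add_diff_cancel_left' divide_divide_eq_left)
  also have "\<dots> \<le> ?T n / ln (real n) + ln (ln (real n)) - ln (ln 2) + 4 / ln 2 - 4 / ln (real n)
      + (?T (Suc n) - ?T n) / ln (real (Suc n))"
    using step.IH by simp
  also have "\<dots> = (?T n - 4) * (1 / ln (real n) - 1 / ln (real (Suc n))) + ?T (Suc n) / ln (real (Suc n))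
      + ln (ln (real n)) - ln (ln 2) + 4 / ln 2 - 4 / ln (real (Suc n))"
    by (simp add: algebra_simps diff_divide_distrib del: of_nat_Suc sum.cl_ivl_Suc)
  also have "\<dots> \<le> ?T (Suc n) / ln (real (Suc n)) + ln (ln (real (Suc n))) - ln (ln 2) + 4 / ln 2 - 4 / ln (real (Suc n))"
    using st by linarith
  finally show ?case .
qed

lemma sum_inverse_primes_le:
  assumes "n \<ge> 2"
  shows "(\<Sum>p | p \<le> n \<and> prime p. 1 / real p) \<le> ln (ln (real n)) + 10"
proof -
  have "(\<Sum>p | p \<le> n \<and> prime p. 1 / real p) = (\<Sum>p | p \<le> n \<and> prime p. mangoldt p / (real p * ln (real p)))"
    by (rule sum.cong) (auto dest: prime_gt_1_nat)
  also have "\<dots> \<le> (\<Sum>d=2..n. mangoldt d / (real d * ln (real d)))"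
    by (rule sum_mono2) (auto simp: mangoldt_nonneg prime_ge_2_nat)
  also have "\<dots> \<le> (\<Sum>d=1..n. mangoldt d / real d) / ln (real n) + ln (ln (real n)) - ln (ln 2) + 4 / ln 2 - 4 / ln (real n)"
    by (rule sum_mangoldt_over_ln_le) fact
  also have "(\<Sum>d=1..n. mangoldt d / real d) / ln (real n) \<le> (ln (real n) + 4) / ln (real n)"
    using assms by (intro divide_right_mono sum_mangoldt_over_upper) auto
  also have "\<dots> = 1 + 4 / ln (real n)" using assms by (simp add: field_simps)
  finally have "(\<Sum>p | p \<le> n \<and> prime p. 1 / real p) \<le> ln (ln (real n)) + 1 - ln (ln 2) + 4 / ln 2"
    by simp
  moreover have ln2: "ln 2 \<ge> (1/2::real)" using ln_le_minus_one[of "1/2::real"] by (simp add: ln_div)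
  have "4 / ln 2 \<le> (8::real)"
    using ln2 by (simp add: field_simps)
  moreover have "- ln (ln 2 :: real) \<le> 1"
  proof -
    have "- ln (ln 2 :: real) = ln (1 / ln 2)" by (simp add: ln_div)
    also have "\<dots> \<le> 1 / ln 2 - 1" by (rule ln_le_minus_one) simp
    also have "\<dots> \<le> 1" using ln2 by (simp add: field_simps)
    finally show ?thesis .
  qed
  ultimately show ?thesis by linarith
qed

lemma sum_telescope_le: "(\<Sum>k=2..n. 1 / (real k * (real k - 1))) \<le> 1"
proof -
  have "(\<Sum>k=2..n. 1 / (real k * (real k - 1))) \<le> 1 - 1 / real n" if "n \<ge> 1"
    using that
  proof (induction n rule: dec_induct)
    case (step n)
    have "(\<Sum>k=2..Suc n. 1 / (real k * (real k - 1))) = (\<Sum>k=2..n. 1 / (real k * (real k - 1))) + 1 / (real (Suc n) * real n)"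
      using step by simp
    also have "\<dots> \<le> 1 - 1 / real n + 1 / (real (Suc n) * real n)" using step by simp
    also have "\<dots> = 1 - 1 / real (Suc n)" using step by (simp add: divide_simps) (simp add: algebra_simps)
    finally show ?case .
  qed auto
  thus ?thesis by (cases "n \<ge> 1") (auto intro: order.trans)
qed

text \<open>
  The quantity \<open>1 / (p - 1)\<close> is the sum of the reciprocals of all powers of \<open>p\<close> and also bounds the
  logarithm of the Euler factor at \<open>p\<close>.  It differs from \<open>1 / p\<close> by a telescoping amount.
\<close>

lemma sum_inverse_primes_pred_le:
  assumes "n \<ge> 2"
  shows "(\<Sum>p | p \<le> n \<and> prime p. 1 / (real p - 1)) \<le> ln (ln (real n)) + 11"
proof -
  have "(\<Sum>p | p \<le> n \<and> prime p. 1 / (real p - 1))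
     = (\<Sum>p | p \<le> n \<and> prime p. 1 / real p + 1 / (real p * (real p - 1)))"
  proof (rule sum.cong)
    fix p assume "p \<in> {p. p \<le> n \<and> prime p}"
    hence "p > 1" using prime_gt_1_nat[of p] by simp
    thus "1 / (real p - 1) = 1 / real p + 1 / (real p * (real p - 1))"
      by (simp add: divide_simps)
  qed auto
  also have "\<dots> = (\<Sum>p | p \<le> n \<and> prime p. 1 / real p) + (\<Sum>p | p \<le> n \<and> prime p. 1 / (real p * (real p - 1)))"
    by (rule sum.distrib)
  also have "(\<Sum>p | p \<le> n \<and> prime p. 1 / (real p * (real p - 1))) \<le> (\<Sum>k=2..n. 1 / (real k * (real k - 1)))"
    by (rule sum_mono2) (auto simp: prime_ge_2_nat)
  finally show ?thesis using sum_inverse_primes_le[OF assms] sum_telescope_le[of n] by linarith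
qed

lemma sum_power_inverse_le:
  assumes "p \<ge> 2" shows "(\<Sum>a=1..n. 1 / real p ^ a) \<le> 1 / (real p - 1)"
proof -
  have "(\<Sum>a=1..n. 1 / real p ^ a) \<le> (1 - 1 / real p ^ n) / (real p - 1)"
  proof (induction n)
    case (Suc n)
    have "(\<Sum>a=1..Suc n. 1 / real p ^ a) \<le> (1 - 1 / real p ^ n) / (real p - 1) + 1 / real p ^ Suc n"
      using Suc by simp
    also have "\<dots> = (1 - 1 / real p ^ Suc n) / (real p - 1)"
      using assms by (simp add: divide_simps) (simp add: algebra_simps)
    finally show ?case .
  qed auto
  also have "\<dots> \<le> 1 / (real p - 1)" using assms by (intro divide_right_mono) auto
  finally show ?thesis .
qed

lemma sum_inverse_primepow_le:
  assumes "n \<ge> 2"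
  shows "(\<Sum>q | q \<le> n \<and> primepow q. 1 / real q) \<le> ln (ln (real n)) + 11"
proof -
  let ?D = "{p. p \<le> n \<and> prime p} \<times> {1..n}"
  have "{q. q \<le> n \<and> primepow q} \<subseteq> (\<lambda>(p,a). p ^ a) ` ?D"
  proof
    fix q assume "q \<in> {q. q \<le> n \<and> primepow q}"
    then obtain p a where pa: "prime p" "a > 0" "q = p ^ a" "q \<le> n" by (auto simp: primepow_def)
    have "p \<le> p ^ a" using pa by (intro self_le_power) (auto dest: prime_gt_0_nat)
    moreover have "a < p ^ a" using pa by (intro power_gt_expt) (auto dest: prime_gt_1_nat)
    ultimately have "(p, a) \<in> ?D" using pa by auto
    thus "q \<in> (\<lambda>(p,a). p ^ a) ` ?D" using pa by force
  qed
  hence "(\<Sum>q | q \<le> n \<and> primepow q. 1 / real q) \<le> (\<Sum>q\<in>(\<lambda>(p,a). p ^ a) ` ?D. 1 / real q)"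
    by (intro sum_mono2) auto
  also have "\<dots> \<le> (\<Sum>(p,a)\<in>?D. 1 / real p ^ a)"
    using sum_image_le[of ?D "\<lambda>q. 1 / real q" "\<lambda>(p,a). p ^ a"] by (simp add: case_prod_unfold o_def)
  also have "\<dots> = (\<Sum>p | p \<le> n \<and> prime p. \<Sum>a=1..n. 1 / real p ^ a)"
    by (simp add: sum.cartesian_product)
  also have "\<dots> \<le> (\<Sum>p | p \<le> n \<and> prime p. 1 / (real p - 1))"
    by (intro sum_mono sum_power_inverse_le) (auto simp: prime_ge_2_nat)
  finally show ?thesis using sum_inverse_primes_pred_le[OF assms] by linarith
qed

section \<open>Reciprocal sums over divisor-closed sets\<close>

text \<open>
  The source of all reciprocal sums below.  Expand \<open>ln m\<close> as the sum of \<open>\<Lambda>(d)\<close> over \<open>d dvd m\<close>, write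
  \<open>m = k d\<close> and sum over \<open>d\<close> first: since \<open>F\<close> is closed under divisors, the cofactor \<open>k\<close> runs through
  \<open>F\<close> again.  The weight \<open>ln m\<close> is then divided out, being nearly constant on a window.
\<close>

lemma sum_ln_over_le:
  fixes F X :: "nat set"
  assumes closed: "\<And>m d. m \<in> F \<Longrightarrow> d dvd m \<Longrightarrow> d \<in> F" and F0: "0 \<notin> F"
    and X: "finite X" "X \<subseteq> F" "\<And>m. m \<in> X \<Longrightarrow> real m \<le> T"
    and B: "\<And>k. k \<in> F \<Longrightarrow> (\<Sum>d | k * d \<in> X. mangoldt d / real d) \<le> B"
  shows "(\<Sum>m\<in>X. ln (real m) / real m) \<le> B * (\<Sum>k | real k \<le> T \<and> k \<in> F. 1 / real k)"
proof -
  define K where "K = {k. real k \<le> T \<and> k \<in> F}"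
  have finK: "finite K" unfolding K_def by simp
  have X0: "m > 0" if "m \<in> X" for m using that X F0 by (cases m) auto
  have finD: "finite {d. k * d \<in> X}" if "k \<in> K" for k
  proof (rule finite_subset)
    have "k > 0" using that F0 by (cases k) (auto simp: K_def)
    thus "{d. k * d \<in> X} \<subseteq> (\<lambda>m. m div k) ` X" by force
  qed (use X in auto)
  have "(\<Sum>m\<in>X. ln (real m) / real m) = (\<Sum>m\<in>X. \<Sum>d | d dvd m. mangoldt d / real m)"
  proof (rule sum.cong)
    fix m assume "m \<in> X"
    hence "m \<noteq> 0" using X0 by auto
    thus "ln (real m) / real m = (\<Sum>d | d dvd m. mangoldt d / real m)"
      using mangoldt_sum[of m, where 'a = real] by (simp add: sum_divide_distrib [symmetric])
  qed auto
  also have "\<dots> = (\<Sum>(m,d)\<in>Sigma X (\<lambda>m. {d. d dvd m}). mangoldt d / real m)"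
    using X X0 by (intro sum.Sigma) (auto intro!: finite_divisors_nat)
  also have "\<dots> = (\<Sum>(k,d)\<in>Sigma K (\<lambda>k. {d. k * d \<in> X}). mangoldt d / (real k * real d))"
  proof (rule sum.reindex_bij_witness[where i = "\<lambda>(k,d). (k * d, d)" and j = "\<lambda>(m,d). (m div d, d)"])
    fix p assume "p \<in> Sigma X (\<lambda>m. {d. d dvd m})"
    then obtain m d where p: "p = (m, d)" "m \<in> X" "d dvd m" by auto
    have "d > 0" using p X0[of m] by (auto intro!: Nat.gr0I)
    show "(\<lambda>(k,d). (k * d, d)) ((\<lambda>(m,d). (m div d, d)) p) = p" using p by auto
    have "m div d dvd m" using p(3) by (metis dvd_mult_div_cancel dvd_triv_right)
    hence "m div d \<in> F" using closed p X by blast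
    moreover have "real (m div d) \<le> T" using X(3)[OF p(2)]
      by (meson div_le_dividend of_nat_mono order_trans)
    ultimately show "(\<lambda>(m,d). (m div d, d)) p \<in> Sigma K (\<lambda>k. {d. k * d \<in> X})"
      using p by (auto simp: K_def)
    have "real m = real (m div d) * real d" using p by (simp flip: of_nat_mult)
    thus "(case (case p of (m, d) \<Rightarrow> (m div d, d)) of (k, d) \<Rightarrow> mangoldt d / (real k * real d))
        = (case p of (m, d) \<Rightarrow> mangoldt d / real m)" using p by simp
  next
    fix p assume "p \<in> Sigma K (\<lambda>k. {d. k * d \<in> X})"
    then obtain k d where p: "p = (k, d)" "k \<in> K" "k * d \<in> X" by auto
    have "d > 0" using X0[OF p(3)] by simp
    thus "(\<lambda>(m,d). (m div d, d)) ((\<lambda>(k,d). (k * d, d)) p) = p" using p by auto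
    show "(\<lambda>(k,d). (k * d, d)) p \<in> Sigma X (\<lambda>m. {d. d dvd m})" using p by auto
  qed
  also have "\<dots> = (\<Sum>k\<in>K. \<Sum>d | k * d \<in> X. mangoldt d / (real k * real d))"
    using finK finD by (intro sum.Sigma [symmetric]) auto
  also have "\<dots> = (\<Sum>k\<in>K. (1 / real k) * (\<Sum>d | k * d \<in> X. mangoldt d / real d))"
    by (simp add: sum_distrib_left)
  also have "\<dots> \<le> (\<Sum>k\<in>K. (1 / real k) * B)"
    using B by (intro sum_mono mult_left_mono) (auto simp: K_def)
  also have "\<dots> = B * (\<Sum>k\<in>K. 1 / real k)" by (simp add: sum_distrib_left mult.commute)
  finally show ?thesis unfolding K_def .
qed

lemma sum_inverse_le_if_ln_ge:
  assumes "finite X" "y > 1" "\<And>m. m \<in> X \<Longrightarrow> y \<le> real m"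
  shows "(\<Sum>m\<in>X. 1 / real m) \<le> (\<Sum>m\<in>X. ln (real m) / real m) / ln y"
proof -
  have "ln y * (\<Sum>m\<in>X. 1 / real m) = (\<Sum>m\<in>X. ln y / real m)" by (simp add: sum_distrib_left)
  also have "\<dots> \<le> (\<Sum>m\<in>X. ln (real m) / real m)"
  proof (intro sum_mono divide_right_mono)
    fix m assume "m \<in> X"
    thus "ln y \<le> ln (real m)" using assms by (subst ln_le_cancel_iff) force+
  qed auto
  finally show ?thesis using assms by (simp add: field_simps)
qed

text \<open>
  A window of ratio \<open>V\<close> at height \<open>y\<close> carries at most about the proportion \<open>ln V / ln y\<close> of the
  reciprocal sum of \<open>F\<close>.  This takes the place of an upper bound sieve.
\<close>

lemma sum_inverse_window_le:
  fixes F X :: "nat set"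
  assumes closed: "\<And>m d. m \<in> F \<Longrightarrow> d dvd m \<Longrightarrow> d \<in> F" and F0: "0 \<notin> F"
    and X: "finite X" "X \<subseteq> F" "\<And>m. m \<in> X \<Longrightarrow> y \<le> real m \<and> real m \<le> y * V"
    and y: "y > 1" and V: "V \<ge> 1"
  shows "(\<Sum>m\<in>X. 1 / real m) \<le> (ln V + 6) * (\<Sum>k | real k \<le> y * V \<and> k \<in> F. 1 / real k) / ln y"
proof -
  have "(\<Sum>m\<in>X. ln (real m) / real m) \<le> (ln V + 6) * (\<Sum>k | real k \<le> y * V \<and> k \<in> F. 1 / real k)"
  proof (rule sum_ln_over_le)
    fix k assume "k \<in> F"
    hence k: "real k > 0" using F0 by (cases k) auto
    have "(\<Sum>d | k * d \<in> X. mangoldt d / real d)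
        \<le> (\<Sum>d | real d \<le> (y / real k) * V \<and> y / real k \<le> real d. mangoldt d / real d :: real)"
    proof (rule sum_mono2)
      show "{d. k * d \<in> X} \<subseteq> {d. real d \<le> (y / real k) * V \<and> y / real k \<le> real d}"
        using X(3) k by (fastforce simp: field_simps)
    qed (auto simp: mangoldt_nonneg)
    also have "\<dots> \<le> ln V + 6" using k y V by (intro sum_mangoldt_over_window) auto
    finally show "(\<Sum>d | k * d \<in> X. mangoldt d / real d) \<le> ln V + 6" .
  qed (use assms in auto)
  hence "(\<Sum>m\<in>X. ln (real m) / real m) / ln y \<le> (ln V + 6) * (\<Sum>k | real k \<le> y * V \<and> k \<in> F. 1 / real k) / ln y"
    using y by (intro divide_right_mono) auto
  moreover have "(\<Sum>m\<in>X. 1 / real m) \<le> (\<Sum>m\<in>X. ln (real m) / real m) / ln y"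
    using X y by (intro sum_inverse_le_if_ln_ge) auto
  ultimately show ?thesis by linarith
qed

section \<open>Smooth and rough numbers\<close>

definition smooth_over :: "nat set \<Rightarrow> nat set" where
  "smooth_over P = {b. b > 0 \<and> (\<forall>p. prime p \<longrightarrow> p dvd b \<longrightarrow> p \<in> P)}"

definition rough :: "real \<Rightarrow> nat set" where
  "rough z = {c. c > 0 \<and> (\<forall>p. prime p \<longrightarrow> p dvd c \<longrightarrow> z < real p)}"

definition primes_upto :: "real \<Rightarrow> nat set" where
  "primes_upto z = {p. real p \<le> z \<and> prime p}"

text \<open>
  Up to a bounded amount this is the logarithm of the Euler product of \<open>1 / (1 - 1/p)\<close>.  With
  \<open>1 / (p - 1)\<close> in place of \<open>1 / p\<close>, its exponential bounds that product without a further constant.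
\<close>

definition prime_weight :: "nat set \<Rightarrow> real" where
  "prime_weight P = (\<Sum>p\<in>P. 1 / (real p - 1))"

lemma finite_primes_upto [simp]: "finite (primes_upto z)"
  by (simp add: primes_upto_def)

lemma smooth_over_dvd: "m \<in> smooth_over P \<Longrightarrow> d dvd m \<Longrightarrow> d \<in> smooth_over P"
  by (auto simp: smooth_over_def intro: dvd_trans Nat.gr0I)

lemma rough_dvd: "m \<in> rough z \<Longrightarrow> d dvd m \<Longrightarrow> d \<in> rough z"
  by (auto simp: rough_def intro: dvd_trans Nat.gr0I)

lemma zero_notin_smooth_over [simp]: "0 \<notin> smooth_over P"
  by (simp add: smooth_over_def)

lemma zero_notin_rough [simp]: "0 \<notin> rough z"
  by (simp add: rough_def)

text \<open>
  The Euler product, built up one prime \<open>p\<close> at a time by splitting off the power of \<open>p\<close> in each \<open>b\<close>.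
\<close>

lemma sum_inverse_smooth_over_le:
  assumes "finite P" "\<And>p. p \<in> P \<Longrightarrow> prime p" "finite X" "X \<subseteq> smooth_over P"
  shows "(\<Sum>b\<in>X. 1 / real b) \<le> exp (prime_weight P)"
  using assms
proof (induction P arbitrary: X rule: finite_induct)
  case empty
  have "X \<subseteq> {1}"
  proof
    fix b assume b: "b \<in> X"
    show "b \<in> {1}"
    proof (rule ccontr)
      assume "b \<notin> {1}"
      then obtain p where "prime p" "p dvd b" using prime_factor_nat[of b] by auto
      thus False using b empty by (auto simp: smooth_over_def)
    qed
  qed
  hence "X = {} \<or> X = {1}" by auto
  thus ?case by (auto simp: prime_weight_def)
next
  case (insert p P)
  have p: "prime p" using insert by auto
  have p2: "p \<ge> 2" using p by (rule prime_ge_2_nat)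
  define v where "v b = multiplicity p b" for b :: nat
  define f where "f b = (b div p ^ v b, v b)" for b
  define n where "n = Max (insert 0 (v ` X))"
  define Y where "Y = fst ` f ` X"
  have X0: "b > 0" if "b \<in> X" for b using that insert.prems by (auto simp: smooth_over_def)
  have dec: "b = p ^ v b * (b div p ^ v b)" for b
    unfolding v_def using multiplicity_dvd[of p b] by (rule dvd_mult_div_cancel [symmetric])
  have Y: "Y \<subseteq> smooth_over P"
  proof
    fix y assume "y \<in> Y"
    then obtain b where b: "b \<in> X" "y = b div p ^ v b" by (auto simp: Y_def f_def)
    have y0: "y > 0"
    proof (rule Nat.gr0I)
      assume "y = 0"
      hence "b = 0" using dec[of b] b(2) by (simp only: mult_0_right)
      thus False using X0[OF b(1)] by simp
    qed
    have "\<not> is_unit p" using p not_prime_unit by blast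
    hence "\<not> p dvd y"
      using multiplicity_decompose[of b p] X0[OF b(1)] unfolding b(2) v_def by simp
    moreover have "y dvd b" using dec[of b] b(2) by (metis dvd_triv_right)
    ultimately show "y \<in> smooth_over P"
      using b insert.prems y0
      unfolding smooth_over_def by (blast intro: dvd_trans)
  qed
  have "(\<Sum>b\<in>X. 1 / real b) = (\<Sum>b\<in>X. (1 / real (fst (f b))) * (1 / real p ^ snd (f b)))"
  proof (rule sum.cong)
    fix b assume "b \<in> X"
    have "real b = real p ^ v b * real (b div p ^ v b)"
      using dec[of b] by (metis of_nat_mult of_nat_power)
    thus "1 / real b = (1 / real (fst (f b))) * (1 / real p ^ snd (f b))"
      by (simp add: f_def)
  qed auto
  also have "\<dots> = (\<Sum>(y,a)\<in>f ` X. (1 / real y) * (1 / real p ^ a))"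
  proof -
    have "inj_on f X"
      by (rule inj_on_inverseI[where g = "\<lambda>(y,a). p ^ a * y"]) (simp add: f_def dec [symmetric])
    thus ?thesis by (subst sum.reindex) (auto simp: case_prod_unfold)
  qed
  also have "\<dots> \<le> (\<Sum>(y,a)\<in>Y \<times> {0..n}. (1 / real y) * (1 / real p ^ a))"
  proof (rule sum_mono2)
    show "f ` X \<subseteq> Y \<times> {0..n}"
    proof
      fix q assume "q \<in> f ` X"
      then obtain b where b: "b \<in> X" "q = f b" by auto
      have "v b \<le> n" unfolding n_def using b insert.prems by (intro Max_ge) auto
      moreover have "fst (f b) \<in> Y" unfolding Y_def using b by (intro imageI)
      ultimately show "q \<in> Y \<times> {0..n}" using b by (simp add: f_def)
    qed
  qed (use insert.prems in \<open>auto simp: Y_def\<close>)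
  also have "\<dots> = (\<Sum>y\<in>Y. 1 / real y) * (\<Sum>a=0..n. 1 / real p ^ a)"
    by (simp add: sum_product sum.cartesian_product)
  also have "\<dots> \<le> exp (prime_weight P) * exp (1 / (real p - 1))"
  proof (rule mult_mono)
    show "(\<Sum>y\<in>Y. 1 / real y) \<le> exp (prime_weight P)"
      using insert.prems Y by (intro insert.IH) (auto simp: Y_def)
    have "(\<Sum>a=0..n. 1 / real p ^ a) = 1 + (\<Sum>a=1..n. 1 / real p ^ a)"
      by (simp add: sum.atLeast_Suc_atMost)
    also have "\<dots> \<le> 1 + 1 / (real p - 1)" using sum_power_inverse_le[OF p2] by simp
    also have "\<dots> \<le> exp (1 / (real p - 1))" by (rule exp_ge_add_one_self)
    finally show "(\<Sum>a=0..n. 1 / real p ^ a) \<le> exp (1 / (real p - 1))" .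
  qed (auto intro!: sum_nonneg)
  also have "\<dots> = exp (prime_weight (insert p P))"
    using insert by (simp add: prime_weight_def exp_add mult.commute)
  finally show ?case .
qed

lemma sum_inverse_smooth_window_le:
  assumes "finite P" "\<And>p. p \<in> P \<Longrightarrow> prime p" "finite X" "X \<subseteq> smooth_over P"
    and "\<And>m. m \<in> X \<Longrightarrow> y \<le> real m \<and> real m \<le> y * V" "y > 1" "V \<ge> 1"
  shows "(\<Sum>m\<in>X. 1 / real m) \<le> (ln V + 6) * exp (prime_weight P) / ln y"
proof -
  have "(\<Sum>m\<in>X. 1 / real m) \<le> (ln V + 6) * (\<Sum>k | real k \<le> y * V \<and> k \<in> smooth_over P. 1 / real k) / ln y"
    by (rule sum_inverse_window_le[OF smooth_over_dvd]) (use assms in auto)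
  also have "\<dots> \<le> (ln V + 6) * exp (prime_weight P) / ln y"
    using assms by (intro divide_right_mono mult_left_mono sum_inverse_smooth_over_le) auto
  finally show ?thesis .
qed

lemma prime_weight_primes_upto_le:
  assumes "z \<ge> 2" shows "prime_weight (primes_upto z) \<le> ln (ln z) + 11"
proof -
  define n where "n = nat \<lfloor>z\<rfloor>"
  have n: "n \<ge> 2" "real n \<le> z" using assms by (auto simp: n_def le_nat_floor of_nat_floor)
  have "primes_upto z = {p. p \<le> n \<and> prime p}"
  proof -
    have "p \<le> n \<longleftrightarrow> real p \<le> z" for p
    proof
      assume "p \<le> n"
      hence "real p \<le> real n" by simp
      thus "real p \<le> z" using n by linarith
    next
      assume "real p \<le> z"
      thus "p \<le> n" unfolding n_def by (rule le_nat_floor)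
    qed
    thus ?thesis by (auto simp: primes_upto_def)
  qed
  hence "prime_weight (primes_upto z) \<le> ln (ln (real n)) + 11"
    unfolding prime_weight_def using sum_inverse_primes_pred_le[OF n(1)] by simp
  also have "ln (ln (real n)) \<le> ln (ln z)" using n by (subst ln_le_cancel_iff) auto
  finally show ?thesis by simp
qed

text \<open>
  Only powers of primes up to \<open>z\<close> contribute, and the powers of \<open>p\<close> together contribute
  \<open>ln p / (p - 1)\<close>.  The bound holds without an upper limit on \<open>d\<close>, which gives the tail bound below.
\<close>

lemma sum_mangoldt_smooth_le:
  assumes "z \<ge> 1" "finite D" "D \<subseteq> smooth_over (primes_upto z)"
  shows "(\<Sum>d\<in>D. mangoldt d / real d) \<le> 2 * (ln z + 4)"
proof -
  define n where "n = nat \<lfloor>z\<rfloor>"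
  have n: "n \<ge> 1" "real n \<le> z" using assms by (auto simp: n_def le_nat_floor of_nat_floor)
  have nle: "p \<le> n" if "real p \<le> z" for p using that by (simp add: n_def le_nat_floor)
  let ?M = "Max (insert 0 D)"
  let ?I = "primes_upto z \<times> {1..?M}"
  have "(\<Sum>d\<in>D. mangoldt d / real d) = (\<Sum>d\<in>{d\<in>D. primepow d}. mangoldt d / real d :: real)"
    using assms by (intro sum.mono_neutral_right) (auto simp: mangoldt_def)
  also have "\<dots> \<le> (\<Sum>d\<in>(\<lambda>(p,a). p ^ a) ` ?I. mangoldt d / real d)"
  proof (rule sum_mono2)
    show "{d\<in>D. primepow d} \<subseteq> (\<lambda>(p,a). p ^ a) ` ?I"
    proof
      fix q assume q: "q \<in> {d\<in>D. primepow d}"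
      then obtain p a where pa: "prime p" "a > 0" "q = p ^ a" by (auto simp: primepow_def)
      have "p dvd q" using pa by simp
      hence "p \<in> primes_upto z" using q assms pa by (auto simp: smooth_over_def)
      moreover have "a < p ^ a" using pa by (intro power_gt_expt) (auto dest: prime_gt_1_nat)
      moreover have "q \<le> ?M" using q assms by (intro Max_ge) auto
      ultimately have "(p, a) \<in> ?I" using pa by auto
      thus "q \<in> (\<lambda>(p,a). p ^ a) ` ?I" using pa by force
    qed
  qed (auto simp: mangoldt_nonneg)
  also have "\<dots> \<le> (\<Sum>(p,a)\<in>?I. mangoldt (p ^ a) / real (p ^ a))"
    using sum_image_le[of ?I "\<lambda>d. mangoldt d / real d :: real" "\<lambda>(p,a). p ^ a"]
    by (simp add: case_prod_unfold o_def mangoldt_nonneg)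
  also have "\<dots> = (\<Sum>p\<in>primes_upto z. \<Sum>a=1..?M. mangoldt (p ^ a) / real (p ^ a))"
    by (simp add: sum.cartesian_product)
  also have "\<dots> = (\<Sum>p\<in>primes_upto z. ln (real p) * (\<Sum>a=1..?M. 1 / real p ^ a))"
    unfolding sum_distrib_left by (intro sum.cong) (auto simp: primes_upto_def mangoldt_primepow)
  also have "\<dots> \<le> (\<Sum>p\<in>primes_upto z. ln (real p) * (2 / real p))"
  proof (intro sum_mono mult_left_mono)
    fix p assume "p \<in> primes_upto z"
    hence p: "p \<ge> 2" by (auto simp: primes_upto_def prime_ge_2_nat)
    have "(\<Sum>a=1..?M. 1 / real p ^ a) \<le> 1 / (real p - 1)" by (rule sum_power_inverse_le) fact
    also have "\<dots> \<le> 2 / real p" using p by (simp add: field_simps)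
    finally show "(\<Sum>a=1..?M. 1 / real p ^ a) \<le> 2 / real p" .
    show "ln (real p) \<ge> 0" using p by simp
  qed
  also have "\<dots> = 2 * (\<Sum>p\<in>primes_upto z. mangoldt p / real p)"
    unfolding sum_distrib_left by (intro sum.cong) (auto simp: primes_upto_def)
  also have "(\<Sum>p\<in>primes_upto z. mangoldt p / real p) \<le> (\<Sum>d=1..n. mangoldt d / real d :: real)"
    by (rule sum_mono2) (auto simp: mangoldt_nonneg primes_upto_def nle Suc_le_eq prime_gt_0_nat)
  also have "\<dots> \<le> ln (real n) + 4" using n by (intro sum_mangoldt_over_upper) auto
  also have "ln (real n) \<le> ln z" using n by (subst ln_le_cancel_iff) auto
  finally show ?thesis by simp
qed

text \<open>
  Smooth numbers beyond \<open>y\<close> are rare once \<open>ln y\<close> is large compared with \<open>ln z\<close>.  The range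
  of \<open>m\<close> may be unbounded because the total weight of the prime powers of small primes is only of
  order \<open>ln z\<close>, whereas a window bound would grow with the ratio of the window.
\<close>

lemma sum_inverse_smooth_tail_le:
  assumes "z \<ge> 1" "finite X" "X \<subseteq> smooth_over (primes_upto z)"
    and "\<And>m. m \<in> X \<Longrightarrow> y \<le> real m" "y > 1"
  shows "(\<Sum>m\<in>X. 1 / real m) \<le> 2 * (ln z + 4) * exp (prime_weight (primes_upto z)) / ln y"
proof -
  let ?F = "smooth_over (primes_upto z)"
  define T where "T = real (Max (insert 0 X))"
  have "(\<Sum>m\<in>X. ln (real m) / real m) \<le> 2 * (ln z + 4) * (\<Sum>k | real k \<le> T \<and> k \<in> ?F. 1 / real k)"
  proof (rule sum_ln_over_le)
    fix k assume k: "k \<in> ?F"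
    hence k0: "k > 0" by (simp add: smooth_over_def)
    show "(\<Sum>d | k * d \<in> X. mangoldt d / real d) \<le> 2 * (ln z + 4)"
    proof (rule sum_mangoldt_smooth_le)
      show "finite {d. k * d \<in> X}"
      proof (rule finite_subset)
        show "{d. k * d \<in> X} \<subseteq> (\<lambda>m. m div k) ` X"
        proof
          fix d assume "d \<in> {d. k * d \<in> X}"
          hence "k * d \<in> X" "d = (k * d) div k" using k0 by auto
          thus "d \<in> (\<lambda>m. m div k) ` X" by (rule rev_image_eqI)
        qed
      qed (use assms in auto)
      show "{d. k * d \<in> X} \<subseteq> ?F"
      proof
        fix d assume "d \<in> {d. k * d \<in> X}"
        hence "k * d \<in> ?F" using assms by auto
        thus "d \<in> ?F" by (rule smooth_over_dvd) simp
      qed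
    qed fact
  qed (use assms in \<open>auto simp: T_def smooth_over_dvd\<close>)
  also have "\<dots> \<le> 2 * (ln z + 4) * exp (prime_weight (primes_upto z))"
    using assms by (intro mult_left_mono sum_inverse_smooth_over_le) (auto simp: primes_upto_def)
  finally have "(\<Sum>m\<in>X. ln (real m) / real m) / ln y \<le> 2 * (ln z + 4) * exp (prime_weight (primes_upto z)) / ln y"
    using assms by (intro divide_right_mono) auto
  moreover have "(\<Sum>m\<in>X. 1 / real m) \<le> (\<Sum>m\<in>X. ln (real m) / real m) / ln y"
    using assms by (intro sum_inverse_le_if_ln_ge) auto
  ultimately show ?thesis by linarith
qed

lemma harmonic_lower: "ln (real n + 1) \<le> (\<Sum>k=1..n. 1 / real k)"
proof (induction n)
  case (Suc n)
  have "ln (real (Suc n) + 1) - ln (real n + 1) = ln ((real (Suc n) + 1) / (real n + 1))"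
    by (subst ln_div) auto
  also have "(real (Suc n) + 1) / (real n + 1) = 1 + 1 / real (Suc n)"
    by (simp add: field_simps)
  also have "ln \<dots> \<le> 1 / real (Suc n)" by (intro ln_add_one_self_le_self) auto
  finally show ?case using Suc by simp
qed auto

lemma harmonic_upper: "n > 0 \<Longrightarrow> (\<Sum>k=1..n. 1 / real k) \<le> ln (real n) + 1"
proof (induction n rule: nat_induct_non_zero)
  case (Suc n)
  have "ln (real n) - ln (real (Suc n)) = ln (real n / real (Suc n))"
    using Suc by (subst ln_div) auto
  also have "\<dots> \<le> real n / real (Suc n) - 1" using Suc by (intro ln_le_minus_one) auto
  also have "\<dots> = - (1 / real (Suc n))" by (simp add: field_simps)
  finally show ?case using Suc by simp
qed auto

text \<open>
  The products \<open>c b\<close> of a rough number \<open>c\<close> and a number \<open>b \<le> z\<close> are distinct, so the sum over \<open>c\<close>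
  times the harmonic sum up to \<open>z\<close> is at most the harmonic sum up to \<open>T z\<close>.
\<close>

lemma sum_inverse_rough_le:
  assumes "T \<ge> 1" "z \<ge> 1"
  shows "(\<Sum>c | real c \<le> T \<and> c \<in> rough z. 1 / real c) * ln z \<le> ln T + ln z + 1"
proof -
  define C where "C = {c. real c \<le> T \<and> c \<in> rough z}"
  define n where "n = nat \<lfloor>z\<rfloor>"
  define N where "N = nat \<lfloor>T * z\<rfloor>"
  have n: "n \<ge> 1" "real n \<le> z" "z < real n + 1" using assms by (auto simp: n_def le_nat_floor of_nat_floor)
  have Tz: "T * z \<ge> 1" using assms mult_mono[of 1 T 1 z] by simp
  have N: "N \<ge> 1" "real N \<le> T * z" using Tz by (auto simp: N_def le_nat_floor of_nat_floor)
  have "finite C" by (simp add: C_def)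
  have inj: "inj_on (\<lambda>(c,b). c * b) (C \<times> {1..n})"
  proof (rule inj_onI, clarify)
    fix c b c' b' assume h: "c \<in> C" "b \<in> {1..n}" "c' \<in> C" "b' \<in> {1..n}" "c * b = c' * b'"
    have cop: "coprime x y" if "x \<in> C" "y \<in> {1..n}" for x y
    proof (rule ccontr)
      assume "\<not> coprime x y"
      then obtain p where p: "prime p" "p dvd x" "p dvd y"
        using that by (metis coprime_iff_gcd_eq_1 gcd_dvd1 gcd_dvd2 dvd_trans prime_factor_nat)
      hence "z < real p" using that by (auto simp: C_def rough_def)
      moreover have "p \<le> n" using p that by (auto dest: dvd_imp_le)
      ultimately show False using n by linarith
    qed
    have "c dvd c' * b'" "c' dvd c * b" using h(5) by (metis dvd_triv_left)+
    hence "c dvd c'" "c' dvd c"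
      using cop h coprime_dvd_mult_left_iff by blast+
    hence "c = c'" by (rule dvd_antisym)
    moreover have "c > 0" using h by (auto simp: C_def rough_def)
    ultimately show "c = c' \<and> b = b'" using h by auto
  qed
  have "(\<Sum>c\<in>C. 1 / real c) * ln z \<le> (\<Sum>c\<in>C. 1 / real c) * (\<Sum>b=1..n. 1 / real b)"
  proof (intro mult_left_mono sum_nonneg)
    have "ln z \<le> ln (real n + 1)" using n assms by (subst ln_le_cancel_iff) auto
    also have "\<dots> \<le> (\<Sum>b=1..n. 1 / real b)" by (rule harmonic_lower)
    finally show "ln z \<le> (\<Sum>b=1..n. 1 / real b)" .
  qed auto
  also have "\<dots> = (\<Sum>(c,b)\<in>C \<times> {1..n}. 1 / real (c * b))"
    by (simp add: sum_product sum.cartesian_product)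
  also have "\<dots> = (\<Sum>m\<in>(\<lambda>(c,b). c * b) ` (C \<times> {1..n}). 1 / real m)"
    by (subst sum.reindex[OF inj]) (simp add: case_prod_unfold o_def)
  also have "\<dots> \<le> (\<Sum>m=1..N. 1 / real m)"
  proof (rule sum_mono2)
    show "(\<lambda>(c,b). c * b) ` (C \<times> {1..n}) \<subseteq> {1..N}"
    proof clarify
      fix c b assume h: "c \<in> C" "b \<in> {1..n}"
      have "real (c * b) \<le> T * z" using h n assms unfolding of_nat_mult
        by (intro mult_mono) (auto simp: C_def)
      hence "c * b \<le> N" unfolding N_def by (rule le_nat_floor)
      moreover have "c > 0" "b > 0" using h by (auto simp: C_def rough_def)
      ultimately show "c * b \<in> {1..N}" by (simp add: Suc_le_eq)
    qed
  qed auto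
  also have "\<dots> \<le> ln (real N) + 1" using N by (intro harmonic_upper) auto
  also have "ln (real N) \<le> ln (T * z)" using N Tz by (subst ln_le_cancel_iff) auto
  also have "\<dots> = ln T + ln z" using assms by (subst ln_mult) auto
  finally show ?thesis by (simp add: C_def)
qed

text \<open>
  Rough numbers have density about \<open>1 / ln z\<close> even in windows much shorter than \<open>z\<close>.  The number 1 is
  rough and has to be left out, as it alone would have reciprocal 1.
\<close>

lemma sum_inverse_rough_window_le:
  assumes z: "ln z \<ge> 1" "z > 0" and V: "1 \<le> V" "V \<le> z"
    and X: "finite X" "X \<subseteq> rough z" "1 \<notin> X" "\<And>c. c \<in> X \<Longrightarrow> U \<le> real c \<and> real c \<le> U * V"
  shows "(\<Sum>c\<in>X. 1 / real c) \<le> 4 * (ln V + 6) / ln z"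
proof -
  \<comment> \<open>Every rough number other than 1 exceeds z, so a window starting below z may be raised to z.\<close>
  define y where "y = max U z"
  have z1: "z > 1" using z by (metis ln_le_zero_iff not_less not_one_le_zero order.trans)
  have y: "y > 1" "y \<ge> z" using z1 by (auto simp: y_def)
  have Xy: "y \<le> real c \<and> real c \<le> y * V" if "c \<in> X" for c
  proof -
    have "c \<noteq> 1" "c > 0" using that X by (auto simp: rough_def)
    then obtain p where p: "prime p" "p dvd c" using prime_factor_nat[of c] by auto
    have "z < real p" using p that X by (auto simp: rough_def)
    also have "p \<le> c" using p \<open>c > 0\<close> by (auto dest: dvd_imp_le)
    finally have "z \<le> real c" by simp
    moreover have "U * V \<le> y * V" using V by (intro mult_right_mono) (auto simp: y_def)
    ultimately show ?thesis using X(4)[OF that] by (auto simp: y_def)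
  qed
  have lz: "ln z \<le> ln y" using y z by (subst ln_le_cancel_iff) auto
  have lV: "ln V \<le> ln z" "ln V \<ge> 0" using V z by auto
  define S where "S = (\<Sum>k | real k \<le> y * V \<and> k \<in> rough z. 1 / real k)"
  have "S * ln z \<le> ln (y * V) + ln z + 1"
    unfolding S_def using y V z1 mult_mono[of 1 y 1 V] by (intro sum_inverse_rough_le) auto
  also have "ln (y * V) = ln y + ln V" using y V by (subst ln_mult) auto
  finally have "S * ln z \<le> 4 * ln y" using z lz lV by linarith
  hence S: "S \<le> 4 * ln y / ln z" using z by (subst pos_le_divide_eq) linarith+
  have "(\<Sum>c\<in>X. 1 / real c) \<le> (ln V + 6) * S / ln y"
    unfolding S_def by (rule sum_inverse_window_le) (use X Xy y V in \<open>auto intro: rough_dvd\<close>)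
  also have "\<dots> \<le> (ln V + 6) * (4 * ln y / ln z) / ln y"
    using S lV y by (intro divide_right_mono mult_left_mono) auto
  also have "\<dots> = 4 * (ln V + 6) / ln z"
  proof -
    have "ln y \<noteq> 0" using y by simp
    thus ?thesis by simp
  qed
  finally show ?thesis .
qed

lemma smooth_rough_decomposition:
  assumes "m > 0"
  shows "\<exists>c b. m = c * b \<and> c \<in> rough z \<and> b \<in> smooth_over (primes_upto z)"
  using assms
proof (induction m rule: less_induct)
  case (less m)
  show ?case
  proof (cases "m \<in> rough z")
    case True
    thus ?thesis by (intro exI[of _ m] exI[of _ 1]) (auto simp: smooth_over_def)
  next
    case False
    then obtain p where p: "prime p" "p dvd m" "real p \<le> z" using less.prems by (auto simp: rough_def)
    then obtain k where k: "m = p * k" by auto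
    have "k > 0" "k < m" using k less.prems p prime_gt_1_nat[of p] by auto
    then obtain c b where cb: "k = c * b" "c \<in> rough z" "b \<in> smooth_over (primes_upto z)"
      using less.IH by blast
    have "p * b \<in> smooth_over (primes_upto z)"
      using cb p by (auto simp: smooth_over_def primes_upto_def prime_gt_0_nat prime_dvd_mult_iff dest: primes_dvd_imp_eq)
    thus ?thesis using k cb by (intro exI[of _ c] exI[of _ "p * b"]) auto
  qed
qed

section \<open>Numbers with a multiple near a given point\<close>

text \<open>
  Used to sum over factorisations \<open>m = c b\<close> either by \<open>c\<close> or by \<open>b\<close>, whichever factor is to be controlled last.
\<close>

lemma sum_inverse_fibre_le:
  fixes f g :: "nat \<Rightarrow> nat"
  assumes X: "finite X" "\<And>m. m \<in> X \<Longrightarrow> m = f m * g m"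
    and \<beta>: "\<And>c. c \<in> f ` X \<Longrightarrow> (\<Sum>b\<in>g ` {m\<in>X. f m = c}. 1 / real b) \<le> \<beta> c"
  shows "(\<Sum>m\<in>X. 1 / real m) \<le> (\<Sum>c\<in>f ` X. \<beta> c / real c)"
proof -
  have "(\<Sum>m\<in>X. 1 / real m) = (\<Sum>c\<in>f ` X. \<Sum>m\<in>{m\<in>X. f m = c}. 1 / real m)"
    using X(1) by (rule sum.image_gen)
  also have "\<dots> \<le> (\<Sum>c\<in>f ` X. \<beta> c / real c)"
  proof (rule sum_mono)
    fix c assume c: "c \<in> f ` X"
    have inj: "inj_on g {m\<in>X. f m = c}"
      by (rule inj_on_inverseI[where g = "\<lambda>b. c * b"]) (use X(2) in auto)
    have "(\<Sum>m\<in>{m\<in>X. f m = c}. 1 / real m) = (\<Sum>m\<in>{m\<in>X. f m = c}. (1 / real (g m)) / real c)"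
    proof (rule sum.cong)
      fix m assume "m \<in> {m\<in>X. f m = c}"
      hence "m = c * g m" using X(2) by auto
      hence "real m = real c * real (g m)" by (metis of_nat_mult)
      thus "1 / real m = (1 / real (g m)) / real c" by (simp add: mult.commute)
    qed auto
    also have "\<dots> = (\<Sum>b\<in>g ` {m\<in>X. f m = c}. 1 / real b) / real c"
      by (subst sum.reindex[OF inj]) (simp add: sum_divide_distrib)
    also have "\<dots> \<le> \<beta> c / real c" using \<beta>[OF c] by (intro divide_right_mono) auto
    finally show "(\<Sum>m\<in>{m\<in>X. f m = c}. 1 / real m) \<le> \<beta> c / real c" .
  qed
  finally show ?thesis .
qed

text \<open>
  The numbers \<open>c\<close> are sorted by the integer part \<open>i\<close> of \<open>ln (Y / c)\<close>.  Each layer is a window of ratio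
  \<open>exp 1\<close> and has reciprocal sum of order \<open>1 / ln z\<close>, so that only a harmonic sum over \<open>i\<close> is lost.
\<close>

lemma sum_inverse_rough_ln_le:
  assumes z: "ln z \<ge> 1" "z > 0" and Y: "Y > 0" "ln Y < real H"
    and X: "finite X" "X \<subseteq> rough z" "1 \<notin> X" "\<And>c. c \<in> X \<Longrightarrow> ln (Y / real c) \<ge> 1"
  shows "(\<Sum>c\<in>X. (1 / ln (Y / real c)) / real c) \<le> 28 / ln z * (\<Sum>i=1..H. 1 / real i)"
proof -
  define l where "l c = nat \<lfloor>ln (Y / real c)\<rfloor>" for c :: nat
  have c0: "c > 0" if "c \<in> X" for c using that X by (auto simp: rough_def)
  have l: "1 \<le> l c" "real (l c) \<le> ln (Y / real c)" "ln (Y / real c) \<le> real (l c) + 1" if "c \<in> X" for c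
    using X(4)[OF that] by (auto simp: l_def le_nat_floor of_nat_floor)
  have z1: "z \<ge> exp 1" using z by (simp add: ln_ge_iff)
  have "(\<Sum>c\<in>X. (1 / ln (Y / real c)) / real c) = (\<Sum>i\<in>l ` X. \<Sum>c\<in>{c\<in>X. l c = i}. (1 / ln (Y / real c)) / real c)"
    using X(1) by (rule sum.image_gen)
  also have "\<dots> \<le> (\<Sum>i\<in>l ` X. 28 / ln z * (1 / real i))"
  proof (rule sum_mono)
    fix i assume "i \<in> l ` X"
    hence i: "i \<ge> 1" using l by auto
    let ?X = "{c\<in>X. l c = i}"
    have 1: "(\<Sum>c\<in>?X. (1 / ln (Y / real c)) / real c) \<le> (\<Sum>c\<in>?X. (1 / real i) * (1 / real c))"
    proof (rule sum_mono)
      fix c assume c: "c \<in> ?X"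
      have "1 / ln (Y / real c) \<le> 1 / real i" using l[of c] c i by (intro divide_left_mono) auto
      hence "(1 / ln (Y / real c)) / real c \<le> (1 / real i) / real c" by (rule divide_right_mono) simp
      thus "(1 / ln (Y / real c)) / real c \<le> (1 / real i) * (1 / real c)" by simp
    qed
    have 2: "(\<Sum>c\<in>?X. (1 / real i) * (1 / real c)) = (1 / real i) * (\<Sum>c\<in>?X. 1 / real c)"
      by (rule sum_distrib_left [symmetric])
    have "(\<Sum>c\<in>?X. 1 / real c) \<le> 4 * (ln (exp 1) + 6) / ln z"
    proof (rule sum_inverse_rough_window_le)
      fix c assume c: "c \<in> ?X"
      have "real i \<le> ln (Y / real c)" "ln (Y / real c) \<le> real i + 1" using c l[of c] by auto
      hence "exp (real i) \<le> Y / real c" "Y / real c \<le> exp (real i + 1)"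
        using Y c0[of c] c exp_ln[of "Y / real c"] exp_le_cancel_iff[of "real i" "ln (Y / real c)"]
          exp_le_cancel_iff[of "ln (Y / real c)" "real i + 1"] by auto
      hence "real c \<le> Y / exp (real i)" "Y / exp (real i + 1) \<le> real c"
        using c0[of c] c by (auto simp: field_simps)
      thus "Y / exp (real i + 1) \<le> real c \<and> real c \<le> Y / exp (real i + 1) * exp 1"
        by (simp add: exp_add)
    qed (use X z z1 in auto)
    also have "4 * (ln (exp 1) + 6) / ln z = 28 / ln z" by simp
    finally have 3: "(\<Sum>c\<in>?X. 1 / real c) \<le> 28 / ln z" .
    have "(1 / real i) * (\<Sum>c\<in>?X. 1 / real c) \<le> (1 / real i) * (28 / ln z)"
      using 3 by (rule mult_left_mono) simp
    with 1 2 show "(\<Sum>c\<in>?X. (1 / ln (Y / real c)) / real c) \<le> 28 / ln z * (1 / real i)"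
      by (simp only: mult.commute)
  qed
  also have "\<dots> \<le> (\<Sum>i=1..H. 28 / ln z * (1 / real i))"
  proof (rule sum_mono2)
    show "l ` X \<subseteq> {1..H}"
    proof clarify
      fix c assume c: "c \<in> X"
      have "ln (Y / real c) \<le> ln Y" using Y c0[OF c] by (subst ln_le_cancel_iff) (auto simp: field_simps)
      hence "real (l c) < real H" using l[OF c] Y by linarith
      thus "l c \<in> {1..H}" using l[OF c] by auto
    qed
  qed (use z in \<open>auto intro!: mult_nonneg_nonneg\<close>)
  also have "\<dots> = 28 / ln z * (\<Sum>i=1..H. 1 / real i)" by (rule sum_distrib_left [symmetric])
  finally show ?thesis .
qed

text \<open>
  The set \<open>B\<close> consists of multiples of \<open>q\<close> aligned with \<open>h\<close>, and no point near \<open>h\<close> divisible by \<open>q\<close>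
  has small primes of weight more than \<open>w\<close>.  Then \<open>B\<close> has small reciprocal sum.
  
  Write \<open>n = q c b\<close> with \<open>c\<close> rough and \<open>b\<close> smooth.  The four summands of the bound come from:
  the \<open>n\<close> with \<open>c = 1\<close>, which are smooth apart from \<open>q\<close>; those with \<open>b > E\<close>, bounded by the tail of the
  smooth numbers; those with \<open>c \<ge> M / (q W)\<close>, for which \<open>b \<le> W\<^sup>2\<close>; and the rest.  For the rest,
  \<open>q c > 2 K\<close> holds, so \<open>c\<close> determines the multiple \<open>x\<close> near \<open>h\<close>; then \<open>b\<close> is composed of
  primes dividing \<open>x\<close>, and it lies in a window of ratio \<open>W\<close> at height \<open>M / (q c)\<close>.  This gives
  \<open>exp w / ln (M / (q c))\<close> up to the factor \<open>ln W + 6\<close>, and \<open>sum_inverse_rough_ln_le\<close> sums this over \<open>c\<close>.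
\<close>

lemma aligned_sum_le:
  fixes h :: int and B :: "nat set" and q H :: nat
  assumes z: "ln z \<ge> 1" "z > 0" and W: "ln W \<ge> 1" "W > 0" "W * W \<le> z" and E: "E > 1"
    and M: "M > 0" "M / E > 2 * K" and q: "q > 0" and Y: "M / real q > 1" "ln (M / real q) < real H"
    and B: "finite B" "\<And>n. n \<in> B \<Longrightarrow> q dvd n \<and> M \<le> real n \<and> real n \<le> M * W"
    and al: "\<And>n. n \<in> B \<Longrightarrow> \<exists>x. int n dvd x \<and> \<bar>real_of_int (x - h)\<bar> \<le> K"
    and few: "\<And>x. \<bar>real_of_int (x - h)\<bar> \<le> K \<Longrightarrow> int q dvd x \<Longrightarrow>
                 prime_weight {p \<in> primes_upto z. int p dvd x} \<le> w"
  shows "(\<Sum>n\<in>B. real q / real n)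
      \<le> (ln W + 6) * exp (prime_weight (primes_upto z)) / ln (M / real q)
       + 4 * (ln W + 6) / ln z * (2 * (ln z + 4) * exp (prime_weight (primes_upto z)) / ln E)
       + (2 * ln W + 1) * (4 * (2 * ln W + 6) / ln z)
       + (ln W + 6) * exp w * (28 / ln z * (\<Sum>i=1..H. 1 / real i))"
proof -
  define Y where "Y = M / real q"
  have Y1: "Y > 1" "ln Y < real H" using Y by (auto simp: Y_def)
  have We: "W \<ge> exp 1" using W by (simp add: ln_ge_iff)
  have W1: "W > 1" using We exp_gt_one[of 1] by (metis less_le_trans zero_less_one)
  have Wz: "W \<le> z"
  proof -
    have "W * 1 \<le> W * W" using W1 by (intro mult_left_mono) auto
    thus ?thesis using W by linarith
  qed
  define X where "X = (\<lambda>n. n div q) ` B"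
  have finX: "finite X" using B by (simp add: X_def)
  have BX: "real q / real n = 1 / real (n div q)" if "n \<in> B" for n
    using B(2)[OF that] q by (auto simp: real_of_nat_div)
  have X: "q * m \<in> B" "Y \<le> real m" "real m \<le> Y * W" "m > 0" if mX: "m \<in> X" for m
  proof -
    obtain n where n: "n \<in> B" "m = n div q" using mX unfolding X_def by blast
    have nm: "q * m = n" unfolding n(2) using B(2)[OF n(1)] by (intro dvd_mult_div_cancel) blast
    show "q * m \<in> B" unfolding nm by (rule n(1))
    have rn: "real q * real m = real n" unfolding nm [symmetric] by (rule of_nat_mult [symmetric])
    have "M \<le> real q * real m" "real q * real m \<le> M * W" unfolding rn using B(2)[OF n(1)] by blast+
    thus "Y \<le> real m" "real m \<le> Y * W" using q by (simp_all add: Y_def field_simps)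
    thus "m > 0" using Y1 by (auto intro!: Nat.gr0I)
  qed
  have "(\<Sum>n\<in>B. real q / real n) = (\<Sum>n\<in>B. 1 / real (n div q))" using BX by (intro sum.cong) auto
  also have "\<dots> = (\<Sum>m\<in>X. 1 / real m)" unfolding X_def
  proof (subst sum.reindex)
    show "inj_on (\<lambda>n. n div q) B"
      by (rule inj_on_inverseI[where g = "\<lambda>m. q * m"]) (use B in auto)
  qed auto
  finally have sumB: "(\<Sum>n\<in>B. real q / real n) = (\<Sum>m\<in>X. 1 / real m)" .
  have "\<forall>m\<in>X. \<exists>cb. m = fst cb * snd cb \<and> fst cb \<in> rough z \<and> snd cb \<in> smooth_over (primes_upto z)"
    using smooth_rough_decomposition X(4) by fastforce
  then obtain cb where cb: "\<And>m. m \<in> X \<Longrightarrow> m = fst (cb m) * snd (cb m) \<and> fst (cb m) \<in> rough z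
      \<and> snd (cb m) \<in> smooth_over (primes_upto z)" by metis
  define c where "c m = fst (cb m)" for m
  define b where "b m = snd (cb m)" for m
  have mcb: "m = c m * b m" and cr: "c m \<in> rough z" and bs: "b m \<in> smooth_over (primes_upto z)"
    if "m \<in> X" for m using cb[OF that] by (auto simp: c_def b_def)
  have mcbr: "real m = real (c m) * real (b m)" if "m \<in> X" for m
    using arg_cong[OF mcb[OF that], of real] by (simp only: of_nat_mult)
  have c0: "c m > 0" and b0: "b m > 0" if "m \<in> X" for m
    using cr[OF that] bs[OF that] by (auto simp: rough_def smooth_over_def)
  \<comment> \<open>The case distinction behind the four summands.\<close>
  define X1 where "X1 = {m\<in>X. c m = 1}"
  define X2 where "X2 = {m\<in>X. c m \<noteq> 1 \<and> real (b m) > E}"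
  define X3 where "X3 = {m\<in>X. c m \<noteq> 1 \<and> real (b m) \<le> E \<and> Y / real (c m) \<le> W}"
  define X4 where "X4 = {m\<in>X. c m \<noteq> 1 \<and> real (b m) \<le> E \<and> Y / real (c m) > W}"
  have fins: "finite X1" "finite X2" "finite X3" "finite X4"
    using finX by (auto simp: X1_def X2_def X3_def X4_def)
  have "X = X1 \<union> X2 \<union> X3 \<union> X4" by (auto simp: X1_def X2_def X3_def X4_def)
  hence "(\<Sum>m\<in>X. 1 / real m) = (\<Sum>m\<in>X1. 1 / real m) + (\<Sum>m\<in>X2. 1 / real m)
      + (\<Sum>m\<in>X3. 1 / real m) + (\<Sum>m\<in>X4. 1 / real m)"
  proof -
    have "X1 \<inter> X2 = {}" "(X1 \<union> X2) \<inter> X3 = {}" "(X1 \<union> X2 \<union> X3) \<inter> X4 = {}"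
      by (auto simp: X1_def X2_def X3_def X4_def)
    thus ?thesis unfolding \<open>X = X1 \<union> X2 \<union> X3 \<union> X4\<close>
      using fins by (simp add: sum.union_disjoint)
  qed
  moreover have "(\<Sum>m\<in>X1. 1 / real m) \<le> (ln W + 6) * exp (prime_weight (primes_upto z)) / ln Y"
  proof (rule sum_inverse_smooth_window_le)
    show "X1 \<subseteq> smooth_over (primes_upto z)"
    proof
      fix m assume "m \<in> X1"
      hence m: "m \<in> X" "c m = 1" by (auto simp: X1_def)
      hence "b m = m" using mcb[OF m(1)] by simp
      thus "m \<in> smooth_over (primes_upto z)" using bs[OF m(1)] by simp
    qed
  qed (use fins X Y1 W1 in \<open>auto simp: X1_def primes_upto_def\<close>)
  moreover have "(\<Sum>m\<in>X2. 1 / real m)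
      \<le> 4 * (ln W + 6) / ln z * (2 * (ln z + 4) * exp (prime_weight (primes_upto z)) / ln E)"
  proof -
    have "(\<Sum>m\<in>X2. 1 / real m) \<le> (\<Sum>d\<in>b ` X2. (4 * (ln W + 6) / ln z) / real d)"
    proof (rule sum_inverse_fibre_le)
      fix d assume d: "d \<in> b ` X2"
      show "(\<Sum>e\<in>c ` {m\<in>X2. b m = d}. 1 / real e) \<le> 4 * (ln W + 6) / ln z"
      proof (rule sum_inverse_rough_window_le)
        fix e assume "e \<in> c ` {m\<in>X2. b m = d}"
        then obtain m where m: "m \<in> X" "e = c m" "b m = d" by (auto simp: X2_def)
        show "Y / real d \<le> real e \<and> real e \<le> Y / real d * W"
          using X(2,3)[OF m(1)] mcbr[OF m(1)] b0[OF m(1)] m by (auto simp: field_simps)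
      qed (use z W1 Wz finX cr in \<open>auto simp: X2_def\<close>)
    next
      fix m assume "m \<in> X2" thus "m = b m * c m" using mcb[of m] by (simp add: X2_def mult.commute)
    qed (use fins in auto)
    also have "\<dots> = 4 * (ln W + 6) / ln z * (\<Sum>d\<in>b ` X2. 1 / real d)"
      by (simp add: sum_distrib_left)
    also have "\<dots> \<le> 4 * (ln W + 6) / ln z * (2 * (ln z + 4) * exp (prime_weight (primes_upto z)) / ln E)"
    proof (intro mult_left_mono sum_inverse_smooth_tail_le)
      show "z \<ge> 1" using W1 Wz by linarith
      show "4 * (ln W + 6) / ln z \<ge> 0" using z W by (intro divide_nonneg_nonneg mult_nonneg_nonneg) linarith+
    qed (use finX bs E W z in \<open>auto simp: X2_def\<close>)
    finally show ?thesis .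
  qed
  moreover have "(\<Sum>m\<in>X3. 1 / real m) \<le> (2 * ln W + 1) * (4 * (2 * ln W + 6) / ln z)"
  proof -
    \<comment> \<open>Here c and b both range over windows of ratio W * W, which is at most z.\<close>
    have lnWW: "ln (W * W) = 2 * ln W" using W by (simp add: ln_mult)
    have "(\<Sum>m\<in>X3. 1 / real m) \<le> (\<Sum>e\<in>c ` X3. (2 * ln W + 1) / real e)"
    proof (rule sum_inverse_fibre_le)
      fix e assume "e \<in> c ` X3"
      define N where "N = nat \<lfloor>W * W\<rfloor>"
      have WW: "W * W \<ge> 1" using W1 mult_mono[of 1 W 1 W] by simp
      have N: "N \<ge> 1" "real N \<le> W * W" using WW by (auto simp: N_def le_nat_floor of_nat_floor)
      have "(\<Sum>d\<in>b ` {m\<in>X3. c m = e}. 1 / real d) \<le> (\<Sum>d=1..N. 1 / real d)"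
      proof (rule sum_mono2)
        show "b ` {m\<in>X3. c m = e} \<subseteq> {1..N}"
        proof
          fix d assume "d \<in> b ` {m\<in>X3. c m = e}"
          then obtain m where m: "m \<in> X" "Y / real (c m) \<le> W" "d = b m" by (auto simp: X3_def)
          have "real (b m) \<le> (Y / real (c m)) * W"
            using X(3)[OF m(1)] mcbr[OF m(1)] c0[OF m(1)] by (auto simp: field_simps)
          also have "\<dots> \<le> W * W" using m W by (intro mult_right_mono) auto
          finally have "b m \<le> N" unfolding N_def by (rule le_nat_floor)
          thus "d \<in> {1..N}" using m b0[OF m(1)] by auto
        qed
      qed auto
      also have "\<dots> \<le> ln (real N) + 1" using N by (intro harmonic_upper) auto
      also have "ln (real N) \<le> ln (W * W)" using N WW by (subst ln_le_cancel_iff) auto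
      finally show "(\<Sum>d\<in>b ` {m\<in>X3. c m = e}. 1 / real d) \<le> 2 * ln W + 1" using lnWW by simp
    qed (use finX mcb in \<open>auto simp: X3_def\<close>)
    also have "\<dots> = (2 * ln W + 1) * (\<Sum>e\<in>c ` X3. 1 / real e)"
      by (simp add: sum_distrib_left)
    also have "\<dots> \<le> (2 * ln W + 1) * (4 * (ln (W * W) + 6) / ln z)"
    proof (intro mult_left_mono sum_inverse_rough_window_le)
      fix e assume "e \<in> c ` X3"
      then obtain m where m: "m \<in> X" "e = c m" "Y / real (c m) \<le> W" by (auto simp: X3_def)
      have "Y / W \<le> real e" using m c0[OF m(1)] W by (auto simp: field_simps)
      moreover have "real (c m) * 1 \<le> real (c m) * real (b m)"
        using b0[OF m(1)] by (intro mult_left_mono) auto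
      hence "real e \<le> Y * W" using m X(3)[OF m(1)] mcbr[OF m(1)] by simp
      ultimately show "Y / W \<le> real e \<and> real e \<le> Y / W * (W * W)" using W by simp
    next
      show "1 \<le> W * W" using W1 mult_mono[of 1 W 1 W] by simp
    qed (use finX cr z W in \<open>auto simp: X3_def\<close>)
    finally show ?thesis by (simp only: lnWW)
  qed
  moreover have "(\<Sum>m\<in>X4. 1 / real m) \<le> (ln W + 6) * exp w * (28 / ln z * (\<Sum>i=1..H. 1 / real i))"
  proof -
    have "(\<Sum>m\<in>X4. 1 / real m) \<le> (\<Sum>e\<in>c ` X4. ((ln W + 6) * exp w / ln (Y / real e)) / real e)"
    proof (rule sum_inverse_fibre_le)
      fix e assume "e \<in> c ` X4"
      then obtain m0 where m0: "m0 \<in> X" "e = c m0" "real (b m0) \<le> E" "Y / real e > W" by (auto simp: X4_def)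
      obtain x where x: "int (q * m0) dvd x" "\<bar>real_of_int (x - h)\<bar> \<le> K" using al[OF X(1)[OF m0(1)]] by auto
      define P where "P = {p \<in> primes_upto z. int p dvd x}"
      have qx: "int q dvd x" using x(1) by (auto intro: dvd_mult_left)
      \<comment> \<open>So the interval around h contains at most one multiple of q e.\<close>
      have qc: "real (q * e) > 2 * K"
      proof -
        have "M \<le> real q * real m0" using X(2)[OF m0(1)] q by (simp add: Y_def field_simps)
        also have "\<dots> = real (q * e) * real (b m0)" using mcbr[OF m0(1)] m0 by simp
        also have "\<dots> \<le> real (q * e) * E" using m0 by (intro mult_left_mono) auto
        finally have "M / E \<le> real (q * e)" using E by (simp add: field_simps)
        thus ?thesis using M by linarith
      qed
      have bx: "int (b m) dvd x" if mX: "m \<in> X" "c m = e" for m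
      proof -
        obtain x' where x': "int (q * m) dvd x'" "\<bar>real_of_int (x' - h)\<bar> \<le> K" using al[OF X(1)[OF mX(1)]] by auto
        have me: "m = e * b m" using mcb[OF mX(1)] unfolding mX(2) by assumption
        have m0e: "m0 = e * b m0" using mcb[OF m0(1)] unfolding m0(2) [symmetric] by assumption
        have "e dvd m" using me by (rule dvdI)
        moreover have "e dvd m0" using m0e by (rule dvdI)
        moreover have "b m dvd m" using dvd_triv_right[of "b m" e] unfolding me [symmetric] by assumption
        ultimately have qe: "q * e dvd q * m" "q * e dvd q * m0" "b m dvd q * m" by auto
        have "int (q * e) dvd int (q * m)" "int (q * e) dvd int (q * m0)" "int (b m) dvd int (q * m)"
          using qe by (simp_all only: int_dvd_int_iff)
        with x(1) x'(1) have bx': "int (q * e) dvd x'" "int (q * e) dvd x" "int (b m) dvd x'"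
          by (blast intro: dvd_trans)+
        hence d: "int (q * e) dvd x' - x" by (intro dvd_diff)
        have "x' - x = 0"
        proof (rule ccontr)
          assume "x' - x \<noteq> 0"
          hence "\<bar>int (q * e)\<bar> \<le> \<bar>x' - x\<bar>" using d by (rule dvd_imp_le_int)
          hence "real_of_int \<bar>int (q * e)\<bar> \<le> real_of_int \<bar>x' - x\<bar>" by (simp only: of_int_le_iff)
          hence "real (q * e) \<le> \<bar>real_of_int x' - real_of_int x\<bar>" by simp
          thus False using qc x(2) x'(2) by (auto simp: abs_if split: if_splits)
        qed
        thus ?thesis using bx'(3) by simp
      qed
      have "(\<Sum>d\<in>b ` {m\<in>X4. c m = e}. 1 / real d) \<le> (ln W + 6) * exp (prime_weight P) / ln (Y / real e)"
      proof (rule sum_inverse_smooth_window_le)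
        show "b ` {m\<in>X4. c m = e} \<subseteq> smooth_over P"
        proof
          fix d assume "d \<in> b ` {m\<in>X4. c m = e}"
          then obtain m where m: "m \<in> X" "c m = e" "d = b m" by (auto simp: X4_def)
          have "int p dvd x" if "p dvd b m" for p
            using bx[OF m(1,2)] that by (meson dvd_trans int_dvd_int_iff)
          thus "d \<in> smooth_over P" using bs[OF m(1)] m by (auto simp: smooth_over_def P_def)
        qed
        fix d assume "d \<in> b ` {m\<in>X4. c m = e}"
        then obtain m where m: "m \<in> X" "c m = e" "d = b m" by (auto simp: X4_def)
        show "Y / real e \<le> real d \<and> real d \<le> Y / real e * W"
          using X(2,3)[OF m(1)] mcbr[OF m(1)] c0[OF m(1)] m by (auto simp: field_simps)
      qed (use fins m0 W1 in \<open>auto simp: P_def primes_upto_def\<close>)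
      also have "\<dots> \<le> (ln W + 6) * exp w / ln (Y / real e)"
        using few[OF x(2) qx] m0 W W1 by (intro divide_right_mono mult_left_mono) (auto simp: P_def)
      finally show "(\<Sum>d\<in>b ` {m\<in>X4. c m = e}. 1 / real d) \<le> (ln W + 6) * exp w / ln (Y / real e)" .
    qed (use finX mcb in \<open>auto simp: X4_def\<close>)
    also have "\<dots> = (ln W + 6) * exp w * (\<Sum>e\<in>c ` X4. (1 / ln (Y / real e)) / real e)"
      by (simp add: sum_distrib_left)
    also have "\<dots> \<le> (ln W + 6) * exp w * (28 / ln z * (\<Sum>i=1..H. 1 / real i))"
    proof (intro mult_left_mono sum_inverse_rough_ln_le)
      fix e assume "e \<in> c ` X4"
      hence "Y / real e > W" by (auto simp: X4_def)
      hence "ln (Y / real e) \<ge> ln W" using W by (subst ln_le_cancel_iff) auto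
      thus "ln (Y / real e) \<ge> 1" using W by simp
    qed (use z Y1 finX cr W in \<open>auto simp: X4_def\<close>)
    finally show ?thesis .
  qed
  ultimately show ?thesis unfolding sumB Y_def by linarith
qed

lemma two_power_card_le:
  fixes A :: "nat set"
  assumes "finite A" "y > 0" "\<And>a. a \<in> A \<Longrightarrow> a \<ge> 2 \<and> a dvd y"
    and "\<And>a b. a \<in> A \<Longrightarrow> b \<in> A \<Longrightarrow> a \<noteq> b \<Longrightarrow> coprime a b"
  shows "2 ^ card A \<le> y"
proof -
  have "prod id A dvd y"
    using assms(1,3,4)
  proof (induction A rule: finite_induct)
    case (insert a A)
    have "coprime a (prod id A)" using insert by (intro prod_coprime_right) auto
    thus ?case using insert by (auto intro!: divides_mult)
  qed auto
  hence "prod id A \<le> y" using assms by (intro dvd_imp_le) auto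
  moreover have "(\<Prod>a\<in>A. 2) \<le> prod id A" using assms by (intro prod_mono) auto
  ultimately show ?thesis by simp
qed

text \<open>
  Primes up to \<open>T\<close> weigh at most about \<open>ln (ln T)\<close>.  At most \<open>ln N / ln 2\<close> prime divisors exceed \<open>T\<close>, and each
  of them weighs less than \<open>1 / (T - 1)\<close>.
\<close>

lemma prime_weight_divisors_le:
  assumes "y > 0" "real y \<le> N" "T \<ge> 2" "finite P" "\<And>p. p \<in> P \<Longrightarrow> prime p \<and> p dvd y"
  shows "prime_weight P \<le> ln (ln T) + 11 + (ln N / ln 2) / (T - 1)"
proof -
  define P1 where "P1 = {p\<in>P. real p \<le> T}"
  define P2 where "P2 = {p\<in>P. real p > T}"
  have "P = P1 \<union> P2" by (auto simp: P1_def P2_def)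
  hence "prime_weight P = prime_weight P1 + prime_weight P2" unfolding prime_weight_def using assms
    by (simp only:) (subst sum.union_disjoint; auto simp: P1_def P2_def)
  moreover have "prime_weight P1 \<le> prime_weight (primes_upto T)" unfolding prime_weight_def
    using assms by (intro sum_mono2) (auto simp: P1_def primes_upto_def Suc_le_eq prime_gt_0_nat)
  moreover have "prime_weight (primes_upto T) \<le> ln (ln T) + 11" by (rule prime_weight_primes_upto_le) fact
  moreover have "prime_weight P2 \<le> (ln N / ln 2) / (T - 1)"
  proof -
    have "prime_weight P2 \<le> (\<Sum>p\<in>P2. 1 / (T - 1))" unfolding prime_weight_def
      using assms by (intro sum_mono divide_left_mono) (auto simp: P2_def)
    also have "\<dots> = real (card P2) / (T - 1)" by simp
    also have "\<dots> \<le> (ln N / ln 2) / (T - 1)"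
    proof (rule divide_right_mono)
      have "2 ^ card P2 \<le> y"
      proof (rule two_power_card_le)
        fix p p' assume "p \<in> P2" "p' \<in> P2" "p \<noteq> p'"
        thus "coprime p p'" using assms by (intro primes_coprime) (auto simp: P2_def)
      qed (use assms in \<open>auto simp: P2_def prime_ge_2_nat\<close>)
      hence "real (2 ^ card P2) \<le> real y" by (simp only: of_nat_le_iff)
      hence "2 ^ card P2 \<le> real y" by (simp only: of_nat_power of_nat_numeral)
      hence "2 ^ card P2 \<le> N" using assms(2) by (rule order.trans)
      hence "ln (2 ^ card P2) \<le> ln N" by (subst ln_le_cancel_iff) (auto intro: less_le_trans[of 0 "2 ^ card P2"])
      thus "real (card P2) \<le> ln N / ln 2" by (simp add: ln_realpow field_simps)
    qed (use assms in auto)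
    finally show ?thesis .
  qed
  ultimately show ?thesis by linarith
qed

lemma prime_weight_Un_Int:
  assumes "finite A" "finite B" shows "prime_weight A + prime_weight B = prime_weight (A \<union> B) + prime_weight (A \<inter> B)"
  unfolding prime_weight_def using sum.union_inter[OF assms] by metis

text \<open>
  All primes up to \<open>z\<close> together weigh about \<open>ln (ln z)\<close>.  If \<open>x\<close> and \<open>x'\<close> both use more than half of that,
  the primes they share, which divide \<open>x - x'\<close>, weigh more than a nonzero integer of this size allows.
\<close>

lemma aligned_points_eq:
  fixes x x' :: int
  assumes "\<bar>real_of_int (x - x')\<bar> \<le> N" "z \<ge> 2" "T \<ge> 2"
    and "prime_weight {p \<in> primes_upto z. int p dvd x} > w" "prime_weight {p \<in> primes_upto z. int p dvd x'} > w"
    and "2 * w \<ge> ln (ln z) + 11 + (ln (ln T) + 11 + (ln N / ln 2) / (T - 1))"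
  shows "x = x'"
proof (rule ccontr)
  assume ne: "x \<noteq> x'"
  define P where "P = {p \<in> primes_upto z. int p dvd x}"
  define P' where "P' = {p \<in> primes_upto z. int p dvd x'}"
  have fin: "finite P" "finite P'" by (auto simp: P_def P'_def)
  have "prime_weight (P \<union> P') \<le> prime_weight (primes_upto z)" unfolding prime_weight_def
    by (intro sum_mono2) (auto simp: P_def P'_def primes_upto_def Suc_le_eq prime_gt_0_nat)
  also have "\<dots> \<le> ln (ln z) + 11" by (rule prime_weight_primes_upto_le) fact
  finally have 1: "prime_weight (P \<union> P') \<le> ln (ln z) + 11" .
  have 2: "prime_weight (P \<inter> P') \<le> ln (ln T) + 11 + (ln N / ln 2) / (T - 1)"
  proof (rule prime_weight_divisors_le)
    show "nat \<bar>x - x'\<bar> > 0" using ne by simp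
    show "real (nat \<bar>x - x'\<bar>) \<le> N" using assms by simp
    fix p assume "p \<in> P \<inter> P'"
    hence "prime p" "int p dvd x - x'" by (auto simp: P_def P'_def primes_upto_def)
    thus "prime p \<and> p dvd nat \<bar>x - x'\<bar>" by (simp add: int_dvd_int_iff [symmetric])
  qed (use fin assms in auto)
  show False using 1 2 prime_weight_Un_Int[OF fin] assms(4-6) unfolding P_def[symmetric] P'_def[symmetric] by linarith
qed

section \<open>Exact prime powers and balanced sets\<close>

definition exact_primepows :: "nat \<Rightarrow> nat set" where
  "exact_primepows n = (\<lambda>p. p ^ multiplicity p n) ` prime_factors n"

definition all_exact_primepows :: "nat set \<Rightarrow> nat set" where
  "all_exact_primepows A = (\<Union>n\<in>A. exact_primepows n)"

definition divisible_exactly :: "nat \<Rightarrow> nat set \<Rightarrow> nat set" where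
  "divisible_exactly q A = {n\<in>A. q \<in> exact_primepows n}"

definition recip_sum :: "nat set \<Rightarrow> real" where
  "recip_sum A = (\<Sum>n\<in>A. 1 / real n)"

lemma finite_exact_primepows [simp]: "finite (exact_primepows n)"
  by (simp add: exact_primepows_def)

lemma finite_all_exact_primepows [simp]: "finite A \<Longrightarrow> finite (all_exact_primepows A)"
  by (simp add: all_exact_primepows_def)

lemma finite_divisible_exactly [simp]: "finite A \<Longrightarrow> finite (divisible_exactly q A)"
  by (simp add: divisible_exactly_def)

lemma exact_primepow_dvd: "q \<in> exact_primepows n \<Longrightarrow> q dvd n"
  by (auto simp: exact_primepows_def multiplicity_dvd)

lemma exact_primepow_primepow: "q \<in> exact_primepows n \<Longrightarrow> primepow q"
  by (auto simp: exact_primepows_def prime_factors_multiplicity intro!: primepow_prime_power)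

lemma exact_primepow_pos: "q \<in> exact_primepows n \<Longrightarrow> q > 0"
  using exact_primepow_primepow primepow_gt_0_nat by blast

lemma all_exact_primepows_mono: "A \<subseteq> B \<Longrightarrow> all_exact_primepows A \<subseteq> all_exact_primepows B"
  by (auto simp: all_exact_primepows_def)

text \<open>
  The exact prime powers of \<open>n\<close> are its prime power components, so they determine divisibility by \<open>n\<close>.
\<close>

lemma dvd_if_exact_primepows_dvd:
  fixes x :: int
  assumes "n > 0" "\<And>q. q \<in> exact_primepows n \<Longrightarrow> int q dvd x"
  shows "int n dvd x"
proof (cases "x = 0")
  case False
  have "n dvd nat \<bar>x\<bar>"
  proof (rule multiplicity_le_imp_dvd)
    fix p :: nat assume p: "prime p"
    show "multiplicity p n \<le> multiplicity p (nat \<bar>x\<bar>)"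
    proof (cases "p dvd n")
      case True
      hence "p ^ multiplicity p n \<in> exact_primepows n"
        unfolding exact_primepows_def using p assms by (intro imageI) (auto simp: prime_factors_dvd)
      hence "int (p ^ multiplicity p n) dvd x" by (rule assms)
      hence "p ^ multiplicity p n dvd nat \<bar>x\<bar>"
        by (metis dvd_abs_iff int_dvd_int_iff nat_0_le abs_ge_zero)
      thus ?thesis using False p by (intro multiplicity_geI) auto
    qed (simp add: not_dvd_imp_multiplicity_0)
  qed (use assms in auto)
  thus ?thesis by (metis dvd_abs_iff int_dvd_int_iff nat_0_le abs_ge_zero)
qed auto

lemma two_power_card_exact_primepows_le:
  assumes "n > 0" shows "2 ^ card (exact_primepows n) \<le> n"
proof -
  have "(2::nat) ^ card (exact_primepows n) \<le> 2 ^ card (prime_factors n)"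
    unfolding exact_primepows_def by (intro power_increasing card_image_le) auto
  also have "\<dots> \<le> n"
  proof (rule two_power_card_le)
    fix a b assume "a \<in> prime_factors n" "b \<in> prime_factors n" "a \<noteq> b"
    thus "coprime a b" by (intro primes_coprime) auto
  qed (use assms in \<open>auto simp: in_prime_factors_iff prime_ge_2_nat\<close>)
  finally show ?thesis .
qed

text \<open>
  Call a set balanced if each of its exact prime powers \<open>q\<close> has weight at least \<open>\<tau>\<close>, where the weight
  is \<open>q\<close> times the reciprocal sum of the numbers which \<open>q\<close> divides exactly.  If
  \<open>q\<close> is underweight, deleting all numbers which it divides exactly costs less than \<open>\<tau> / q\<close>, and \<open>q\<close> is
  gone for good; hence the total loss is at most \<open>\<tau>\<close> times the sum of the \<open>1 / q\<close>.
\<close>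

lemma exists_balanced_subset:
  assumes "finite A" "\<tau> \<ge> 0"
  shows "\<exists>B\<subseteq>A. (\<forall>q\<in>all_exact_primepows B. real q * recip_sum (divisible_exactly q B) \<ge> \<tau>) \<and>
           recip_sum A \<le> recip_sum B + \<tau> * recip_sum (all_exact_primepows A - all_exact_primepows B)"
  using assms(1)
proof (induction A rule: finite_psubset_induct)
  case (psubset A)
  show ?case
  proof (cases "\<forall>q\<in>all_exact_primepows A. real q * recip_sum (divisible_exactly q A) \<ge> \<tau>")
    case True
    thus ?thesis by (intro exI[of _ A]) (auto simp: recip_sum_def)
  next
    case False
    then obtain q where q: "q \<in> all_exact_primepows A" "real q * recip_sum (divisible_exactly q A) < \<tau>" by (auto simp: not_le)
    have q0: "q > 0" using q by (auto simp: all_exact_primepows_def exact_primepow_pos)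
    define A' where "A' = A - divisible_exactly q A"
    have "A' \<subset> A" using q by (auto simp: A'_def divisible_exactly_def all_exact_primepows_def)
    from psubset.IH[OF this] obtain B where B: "B \<subseteq> A'"
      "\<forall>q\<in>all_exact_primepows B. real q * recip_sum (divisible_exactly q B) \<ge> \<tau>"
      "recip_sum A' \<le> recip_sum B + \<tau> * recip_sum (all_exact_primepows A' - all_exact_primepows B)" by blast
    have qA': "q \<notin> all_exact_primepows A'" by (auto simp: A'_def divisible_exactly_def all_exact_primepows_def)
    have sub: "all_exact_primepows A' \<subseteq> all_exact_primepows A" "all_exact_primepows B \<subseteq> all_exact_primepows A'"
      using B by (auto intro!: all_exact_primepows_mono simp: A'_def)
    have "recip_sum A = recip_sum A' + recip_sum (divisible_exactly q A)" unfolding recip_sum_def A'_def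
      using psubset.hyps by (intro sum.subset_diff) (auto simp: divisible_exactly_def)
    also have "recip_sum (divisible_exactly q A) \<le> \<tau> / real q" using q q0 by (simp add: field_simps)
    also have "recip_sum A' + \<tau> / real q \<le> recip_sum B + \<tau> * (recip_sum (all_exact_primepows A' - all_exact_primepows B) + 1 / real q)"
      using B(3) by (simp add: algebra_simps)
    also have "recip_sum (all_exact_primepows A' - all_exact_primepows B) + 1 / real q = recip_sum (insert q (all_exact_primepows A' - all_exact_primepows B))"
      unfolding recip_sum_def using qA' psubset.hyps by (subst sum.insert) (auto simp: A'_def)
    also have "recip_sum B + \<tau> * \<dots> \<le> recip_sum B + \<tau> * recip_sum (all_exact_primepows A - all_exact_primepows B)"
      unfolding recip_sum_def using psubset.hyps q sub qA' assms(2)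
      by (intro add_left_mono mult_left_mono sum_mono2) auto
    finally show ?thesis using B(1,2) by (intro exI[of _ B]) (auto simp: A'_def)
  qed
qed

text \<open>
  Delete elements one by one.  The deletion of \<open>x\<close> keeps the set balanced unless some exact prime
  power of \<open>x\<close> is critical, that is, its weight is less than \<open>\<tau> + q / M\<close>.  If every element had a
  critical prime power, the whole reciprocal sum would be at most the sum of \<open>\<tau> / q + 1 / M\<close> over
  \<open>q \<in> Q\<close>, which is below 2 by assumption.  So the deletions continue until the sum drops
  below 2, and each of them changes it by at most \<open>1 / M\<close>.
\<close>

lemma exists_balanced_subset_near_two:
  assumes "finite B" "M > 0" "\<And>n. n \<in> B \<Longrightarrow> M \<le> real n"
    and Q: "finite Q" "all_exact_primepows B \<subseteq> Q" "\<tau> * recip_sum Q + real (card Q) / M < 2" "\<tau> \<ge> 0"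
    and "\<And>q. q \<in> all_exact_primepows B \<Longrightarrow> real q * recip_sum (divisible_exactly q B) \<ge> \<tau>" "recip_sum B \<ge> 2 - 1 / M"
  shows "\<exists>C\<subseteq>B. (\<forall>q\<in>all_exact_primepows C. real q * recip_sum (divisible_exactly q C) \<ge> \<tau>) \<and> 2 - 1 / M \<le> recip_sum C \<and> recip_sum C < 2"
  using assms(1,3,5,8-)
proof (induction B rule: finite_psubset_induct)
  case (psubset B)
  show ?case
  proof (cases "recip_sum B < 2")
    case True
    thus ?thesis using psubset.prems by (intro exI[of _ B]) auto
  next
    case False
    have "\<exists>x\<in>B. \<forall>q\<in>exact_primepows x. real q * recip_sum (divisible_exactly q B) \<ge> \<tau> + real q / M"
    proof (rule ccontr)
      assume "\<not> ?thesis"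
      hence crit: "\<And>x. x \<in> B \<Longrightarrow> \<exists>q\<in>exact_primepows x. real q * recip_sum (divisible_exactly q B) < \<tau> + real q / M"
        by (auto simp: not_le)
      define C where "C = {q\<in>all_exact_primepows B. real q * recip_sum (divisible_exactly q B) < \<tau> + real q / M}"
      have finC: "finite C" using psubset.hyps by (simp add: C_def)
      have "recip_sum B \<le> (\<Sum>x\<in>B. \<Sum>q\<in>C. if q \<in> exact_primepows x then 1 / real x else 0)"
        unfolding recip_sum_def
      proof (rule sum_mono)
        fix x assume x: "x \<in> B"
        then obtain q where q: "q \<in> exact_primepows x" "q \<in> C" using crit[OF x] by (auto simp: C_def all_exact_primepows_def)
        have "1 / real x = (\<Sum>q\<in>{q}. if q \<in> exact_primepows x then 1 / real x else 0)" using q by simp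
        also have "\<dots> \<le> (\<Sum>q\<in>C. if q \<in> exact_primepows x then 1 / real x else 0)"
          using q finC by (intro sum_mono2) auto
        finally show "1 / real x \<le> (\<Sum>q\<in>C. if q \<in> exact_primepows x then 1 / real x else 0)" .
      qed
      also have "\<dots> = (\<Sum>q\<in>C. \<Sum>x\<in>B. if q \<in> exact_primepows x then 1 / real x else 0)"
        by (rule sum.swap)
      also have "\<dots> = (\<Sum>q\<in>C. recip_sum (divisible_exactly q B))"
        unfolding recip_sum_def divisible_exactly_def using psubset.hyps by (intro sum.cong sum.inter_filter [symmetric]) auto
      also have "\<dots> \<le> (\<Sum>q\<in>C. \<tau> * (1 / real q) + 1 / M)"
      proof (rule sum_mono)
        fix q assume q: "q \<in> C"
        hence "q > 0" by (auto simp: C_def all_exact_primepows_def exact_primepow_pos)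
        thus "recip_sum (divisible_exactly q B) \<le> \<tau> * (1 / real q) + 1 / M"
          using q by (auto simp: C_def field_simps)
      qed
      also have "\<dots> \<le> (\<Sum>q\<in>Q. \<tau> * (1 / real q) + 1 / M)"
        using Q psubset.prems assms(2) by (intro sum_mono2) (auto simp: C_def)
      also have "\<dots> = \<tau> * recip_sum Q + real (card Q) / M"
        by (simp add: recip_sum_def sum.distrib sum_distrib_left)
      finally show False using Q(3) False by linarith
    qed
    then obtain x where x: "x \<in> B" "\<And>q. q \<in> exact_primepows x \<Longrightarrow> real q * recip_sum (divisible_exactly q B) \<ge> \<tau> + real q / M" by blast
    have x0: "real x \<ge> M" using psubset.prems x by auto
    have rB: "recip_sum B = recip_sum (B - {x}) + 1 / real x"
      unfolding recip_sum_def using psubset.hyps x by (simp add: sum.remove)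
    have "1 / real x \<le> 1 / M" using x0 assms(2) by (intro divide_left_mono) auto
    have "\<exists>C\<subseteq>B - {x}. (\<forall>q\<in>all_exact_primepows C. real q * recip_sum (divisible_exactly q C) \<ge> \<tau>) \<and> 2 - 1 / M \<le> recip_sum C \<and> recip_sum C < 2"
    proof (rule psubset.IH)
      show "B - {x} \<subset> B" using x by auto
      show "all_exact_primepows (B - {x}) \<subseteq> Q" using psubset.prems(2) all_exact_primepows_mono[of "B - {x}" B] by auto
      show "recip_sum (B - {x}) \<ge> 2 - 1 / M" using rB False \<open>1 / real x \<le> 1 / M\<close> by linarith
      show "\<And>n. n \<in> B - {x} \<Longrightarrow> M \<le> real n" using psubset.prems by auto
      fix q assume q: "q \<in> all_exact_primepows (B - {x})"
      hence qB: "q \<in> all_exact_primepows B" using all_exact_primepows_mono[of "B - {x}" B] by auto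
      show "real q * recip_sum (divisible_exactly q (B - {x})) \<ge> \<tau>"
      proof (cases "q \<in> exact_primepows x")
        case True
        have "divisible_exactly q (B - {x}) = divisible_exactly q B - {x}" "x \<in> divisible_exactly q B" using x True by (auto simp: divisible_exactly_def)
        hence "recip_sum (divisible_exactly q B) = recip_sum (divisible_exactly q (B - {x})) + 1 / real x"
          unfolding recip_sum_def using psubset.hyps by (simp add: sum.remove)
        moreover have "real q * (1 / real x) \<le> real q * (1 / M)"
          using \<open>1 / real x \<le> 1 / M\<close> by (intro mult_left_mono) auto
        ultimately show ?thesis using x(2)[OF True] by (simp add: algebra_simps)
      next
        case False
        hence "divisible_exactly q (B - {x}) = divisible_exactly q B" by (auto simp: divisible_exactly_def)
        thus ?thesis using psubset.prems qB by auto
      qed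
    qed
    thus ?thesis by blast
  qed
qed

section \<open>The circle method\<close>

text \<open>
  The real form of \<open>\<Prod> (1 + exp (2 i t))\<close>: the phases are collected in the single factor
  \<open>cos (u + \<Sum> t)\<close>, whose sign matters on the major arcs.
\<close>

lemma sum_Pow_cos:
  fixes t :: "'a \<Rightarrow> real"
  assumes "finite A"
  shows "(\<Sum>S\<in>Pow A. cos (u + 2 * (\<Sum>n\<in>S. t n))) = 2 ^ card A * cos (u + (\<Sum>n\<in>A. t n)) * (\<Prod>n\<in>A. cos (t n))"
  using assms
proof (induction A arbitrary: u rule: finite_induct)
  case (insert x A)
  have "(\<Sum>S\<in>Pow (insert x A). cos (u + 2 * (\<Sum>n\<in>S. t n)))
      = (\<Sum>S\<in>Pow A. cos (u + 2 * (\<Sum>n\<in>S. t n))) + (\<Sum>S\<in>insert x ` Pow A. cos (u + 2 * (\<Sum>n\<in>S. t n)))"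
    unfolding Pow_insert using insert by (intro sum.union_disjoint) auto
  also have "(\<Sum>S\<in>insert x ` Pow A. cos (u + 2 * (\<Sum>n\<in>S. t n)))
      = (\<Sum>S\<in>Pow A. cos (u + 2 * (\<Sum>n\<in>insert x S. t n)))"
  proof (subst sum.reindex)
    show "inj_on (insert x) (Pow A)"
      by (rule inj_on_inverseI[where g = "\<lambda>S. S - {x}"]) (use insert in auto)
  qed simp
  also have "\<dots> = (\<Sum>S\<in>Pow A. cos ((u + 2 * t x) + 2 * (\<Sum>n\<in>S. t n)))"
  proof (rule sum.cong)
    fix S assume "S \<in> Pow A"
    hence "finite S" "x \<notin> S" using insert finite_subset by auto
    thus "cos (u + 2 * (\<Sum>n\<in>insert x S. t n)) = cos ((u + 2 * t x) + 2 * (\<Sum>n\<in>S. t n))"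
      by (simp add: algebra_simps)
  qed auto
  also have "(\<Sum>S\<in>Pow A. cos (u + 2 * (\<Sum>n\<in>S. t n))) + \<dots>
     = 2 ^ card A * (\<Prod>n\<in>A. cos (t n)) * (cos (u + (\<Sum>n\<in>A. t n)) + cos ((u + 2 * t x) + (\<Sum>n\<in>A. t n)))"
    unfolding insert.IH by (simp add: algebra_simps)
  also have "cos (u + (\<Sum>n\<in>A. t n)) + cos ((u + 2 * t x) + (\<Sum>n\<in>A. t n))
     = 2 * cos (u + (\<Sum>n\<in>insert x A. t n)) * cos (t x)"
  proof -
    have "cos (a - t x) + cos (a + t x) = 2 * cos a * cos (t x)" for a
      by (simp add: cos_add cos_diff)
    from this[of "u + t x + (\<Sum>n\<in>A. t n)"] show ?thesis using insert by (simp add: algebra_simps)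
  qed
  finally show ?case using insert by (simp add: algebra_simps)
qed auto

lemma sum_cos_orthogonality:
  fixes j :: int
  assumes "Q > 0"
  shows "(\<Sum>h<Q. cos (2 * pi * real h * (real_of_int j / real Q))) = (if int Q dvd j then real Q else 0)"
proof -
  define w where "w = cis (2 * pi * (real_of_int j / real Q))"
  have "(\<Sum>h<Q. cos (2 * pi * real h * (real_of_int j / real Q))) = Re (\<Sum>h<Q. w ^ h)"
    by (simp add: w_def DeMoivre algebra_simps)
  also have "(\<Sum>h<Q. w ^ h) = (if int Q dvd j then of_nat Q else 0)"
  proof (cases "int Q dvd j")
    case True
    then obtain k where k: "j = int Q * k" by auto
    have "w = cis (2 * pi * of_int k)" using assms by (simp add: w_def k)
    also have "\<dots> = 1" by (rule cis_multiple_2pi) auto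
    finally show ?thesis using True by simp
  next
    case False
    have "w \<noteq> 1"
    proof
      assume "w = 1"
      hence "cos (2 * pi * (real_of_int j / real Q)) = 1" by (metis cis.simps(1) one_complex.simps(1) w_def)
      then obtain m :: int where m: "2 * pi * (real_of_int j / real Q) = real_of_int m * 2 * pi"
        unfolding cos_one_2pi_int by auto
      hence "real_of_int j = real_of_int m * real Q" using assms by (simp add: field_simps)
      hence "real_of_int j = real_of_int (m * int Q)" by simp
      hence "j = m * int Q" by (simp only: of_int_eq_iff)
      thus False using False by simp
    qed
    moreover have "w ^ Q = 1"
    proof -
      have "w ^ Q = cis (2 * pi * of_int j)" using assms by (simp add: w_def DeMoivre)
      also have "\<dots> = 1" by (rule cis_multiple_2pi) auto
      finally show ?thesis .
    qed
    ultimately have "(\<Sum>h<Q. w ^ h) = 0" by (subst geometric_sum) auto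
    thus ?thesis using False by simp
  qed
  finally show ?thesis by simp
qed

lemma Lcm_pos:
  fixes A :: "nat set"
  assumes "finite A" "0 \<notin> A" shows "Lcm A > 0"
proof -
  have "Lcm A dvd prod id A" using assms by (intro Lcm_least) auto
  moreover have "prod id A \<noteq> 0" using assms by simp
  ultimately show ?thesis by (metis dvd_0_left neq0_conv)
qed

lemma recip_sum_Lcm:
  assumes "finite A" "0 \<notin> A" "S \<subseteq> A"
  shows "recip_sum S = real (\<Sum>n\<in>S. Lcm A div n) / real (Lcm A)"
proof -
  have L: "Lcm A > 0" using assms by (intro Lcm_pos)
  have "1 / real n = real (Lcm A div n) / real (Lcm A)" if "n \<in> S" for n
  proof -
    have "n dvd Lcm A" "n > 0" using that assms by (auto intro!: dvd_Lcm Nat.gr0I)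
    thus ?thesis using L by (simp add: real_of_nat_div)
  qed
  thus ?thesis unfolding recip_sum_def by (simp add: sum_divide_distrib)
qed

text \<open>
  By orthogonality the double sum is \<open>Lcm A\<close> times the number of subsets with integral reciprocal
  sum.  The empty set accounts for one of them, and any further one has sum strictly between 0 and 2.
\<close>

lemma unit_sum_if_main_term:
  assumes A: "finite A" "0 \<notin> A" "recip_sum A < 2"
    and main: "real (Lcm A) < (\<Sum>h<Lcm A. \<Sum>S\<in>Pow A. cos (2 * pi * real h * recip_sum S))"
  shows "\<exists>S\<subseteq>A. recip_sum S = 1"
proof (rule ccontr)
  assume no: "\<not> (\<exists>S\<subseteq>A. recip_sum S = 1)"
  define Q where "Q = Lcm A"
  have Q: "Q > 0" using A unfolding Q_def by (intro Lcm_pos)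
  have "(\<Sum>h<Q. \<Sum>S\<in>Pow A. cos (2 * pi * real h * recip_sum S))
      = (\<Sum>S\<in>Pow A. \<Sum>h<Q. cos (2 * pi * real h * recip_sum S))" by (rule sum.swap)
  also have "\<dots> = (\<Sum>S\<in>Pow A. if S = {} then real Q else 0)"
  proof (rule sum.cong)
    fix S assume S: "S \<in> Pow A"
    define j where "j = (\<Sum>n\<in>S. Q div n)"
    have r: "recip_sum S = real_of_int (int j) / real Q"
      using recip_sum_Lcm[of A S] S A by (simp add: j_def Q_def)
    have "int Q dvd int j \<longleftrightarrow> S = {}"
    proof
      assume "int Q dvd int j"
      then obtain k where k: "int j = int Q * k" by (rule dvdE)
      have rk: "recip_sum S = real_of_int k" using r k Q by simp
      have "recip_sum S \<le> recip_sum A" unfolding recip_sum_def using S A by (intro sum_mono2) auto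
      moreover have "recip_sum S \<ge> 0" unfolding recip_sum_def by (intro sum_nonneg) auto
      ultimately have "k = 0 \<or> k = 1" using A(3) rk by linarith
      moreover have "recip_sum S \<noteq> 1" using no S by auto
      ultimately have "recip_sum S = 0" using rk by auto
      have finS: "finite S" using S A finite_subset by auto
      show "S = {}"
      proof (rule ccontr)
        assume "S \<noteq> {}"
        moreover have "0 < 1 / real n" if "n \<in> S" for n
          using that S A by (auto intro!: Nat.gr0I simp: zero_less_divide_iff)
        ultimately have "recip_sum S > 0" unfolding recip_sum_def using finS by (intro sum_pos) auto
        thus False using \<open>recip_sum S = 0\<close> by simp
      qed
    qed (simp add: j_def)
    thus "(\<Sum>h<Q. cos (2 * pi * real h * recip_sum S)) = (if S = {} then real Q else 0)"
      unfolding r by (subst sum_cos_orthogonality[OF Q]) simp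
  qed auto
  also have "\<dots> = real Q" using A by (simp add: sum.delta)
  finally show False using main by (simp add: Q_def)
qed

text \<open>
  The range \<open>\<bar>x\<bar> \<le> 2\<close> covers \<open>\<bar>x\<bar> \<le> pi / 2\<close>, and there \<open>x ^ 4 / 24 \<le> x\<^sup>2 / 6\<close> in the Taylor expansion.
\<close>

lemma cos_le_exp:
  fixes x :: real
  assumes "\<bar>x\<bar> \<le> 2" shows "cos x \<le> exp (- (x\<^sup>2 / 3))"
proof -
  obtain t where t: "cos x = (\<Sum>m<4. cos_coeff m * x ^ m) + cos (t + 1/2 * real (4::nat) * pi) / fact 4 * x ^ 4"
    using Maclaurin_cos_expansion[of x 4] by blast
  have "{..<4} = {0, 1, 2, 3::nat}" by auto
  hence "(\<Sum>m<4. cos_coeff m * x ^ m) = 1 - x\<^sup>2 / 2"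
    by (simp add: cos_coeff_def fact_numeral)
  moreover have "cos (t + 1/2 * real (4::nat) * pi) / fact 4 * x ^ 4 \<le> 1 / 24 * x ^ 4"
    by (intro mult_right_mono) (auto simp: fact_numeral)
  moreover have "x ^ 4 \<le> 4 * x\<^sup>2"
  proof -
    have "x\<^sup>2 \<le> 2\<^sup>2" using assms by (subst abs_le_square_iff [symmetric]) auto
    hence "x\<^sup>2 * x\<^sup>2 \<le> 4 * x\<^sup>2" by (intro mult_right_mono) auto
    thus ?thesis by (simp add: power4_eq_xxxx power2_eq_square mult.assoc)
  qed
  ultimately have "cos x \<le> 1 + - (x\<^sup>2 / 3)" using t by linarith
  also have "\<dots> \<le> exp (- (x\<^sup>2 / 3))" by (rule exp_ge_add_one_self)
  finally show ?thesis .
qed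

text \<open>
  The distance \<open>d\<close> from \<open>h / n\<close> to the nearest integer exceeds \<open>K / n\<close>, and \<open>\<bar>cos (pi h / n)\<bar> = cos (pi d)\<close>.
\<close>

lemma abs_cos_minor_le:
  fixes h :: int
  assumes n: "n > 0" and far: "\<And>x. int n dvd x \<Longrightarrow> \<bar>real_of_int (x - h)\<bar> > K" and K: "K \<ge> 0"
  shows "\<bar>cos (pi * real_of_int h / real n)\<bar> \<le> exp (- ((K / real n)\<^sup>2))"
proof -
  define t where "t = real_of_int h / real n"
  define k where "k = round t"
  define d where "d = t - real_of_int k"
  have d: "\<bar>d\<bar> \<le> 1 / 2" using of_int_round_abs_le[of t] by (simp add: d_def k_def abs_minus_commute)
  have "\<bar>real_of_int (int n * k - h)\<bar> > K" by (rule far) simp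
  also have "real_of_int (int n * k - h) = - (real n * d)" using n by (simp add: d_def t_def field_simps)
  finally have Kd: "K / real n < \<bar>d\<bar>" using n by (simp add: abs_mult field_simps)
  have "sin (real_of_int k * pi) = 0" by (simp add: sin_times_pi_eq_0)
  moreover from this have "\<bar>cos (real_of_int k * pi)\<bar> = 1"
    using sin_cos_squared_add[of "real_of_int k * pi"] by (simp add: power2_eq_1_iff abs_if) linarith
  moreover have "cos (pi * t) = cos (pi * d + real_of_int k * pi)" by (simp add: d_def algebra_simps)
  ultimately have "\<bar>cos (pi * t)\<bar> = \<bar>cos (pi * d)\<bar>" by (simp add: cos_add abs_mult)
  also have "\<bar>pi * d\<bar> \<le> pi / 2" using d by (simp add: abs_mult)
  hence "cos (pi * d) \<ge> 0" by (intro cos_ge_zero) linarith+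
  hence "\<bar>cos (pi * d)\<bar> = cos (pi * d)" by simp
  also have "\<dots> \<le> exp (- ((pi * d)\<^sup>2 / 3))"
    using \<open>\<bar>pi * d\<bar> \<le> pi / 2\<close> pi_less_4 by (intro cos_le_exp) linarith
  also have "\<dots> \<le> exp (- ((K / real n)\<^sup>2))"
  proof -
    have "(K / real n)\<^sup>2 \<le> d\<^sup>2" using Kd K n by (subst abs_le_square_iff [symmetric]) auto
    moreover have "4 * d\<^sup>2 \<le> pi\<^sup>2 * d\<^sup>2"
      using pi_ge_two power_mono[of 2 pi 2] by (intro mult_right_mono) auto
    moreover have "0 \<le> d\<^sup>2" by simp
    ultimately have "3 * (K / real n)\<^sup>2 \<le> pi\<^sup>2 * d\<^sup>2" by linarith
    thus ?thesis by (simp add: power_mult_distrib)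
  qed
  finally show ?thesis by (simp add: t_def)
qed

definition unaligned :: "nat set \<Rightarrow> real \<Rightarrow> int \<Rightarrow> nat set" where
  "unaligned A K h = {n\<in>A. \<forall>x. int n dvd x \<longrightarrow> \<bar>real_of_int (x - h)\<bar> > K}"

lemma prod_cos_le:
  assumes A: "finite A" "0 \<notin> A" "\<And>n. n \<in> A \<Longrightarrow> real n \<le> N" "K \<ge> 0" "N > 0"
  shows "(\<Prod>n\<in>A. \<bar>cos (pi * real_of_int h / real n)\<bar>) \<le> exp (- ((K / N)\<^sup>2) * real (card (unaligned A K h)))"
proof -
  let ?U = "unaligned A K h"
  have "(\<Prod>n\<in>A. \<bar>cos (pi * real_of_int h / real n)\<bar>)
     \<le> (\<Prod>n\<in>A. if n \<in> ?U then exp (- ((K / N)\<^sup>2)) else 1)"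
  proof (rule prod_mono, intro conjI)
    fix n assume n: "n \<in> A"
    hence n0: "n > 0" using A by (auto intro!: Nat.gr0I)
    show "\<bar>cos (pi * real_of_int h / real n)\<bar> \<le> (if n \<in> ?U then exp (- ((K / N)\<^sup>2)) else 1)"
    proof (cases "n \<in> ?U")
      case True
      hence "\<bar>cos (pi * real_of_int h / real n)\<bar> \<le> exp (- ((K / real n)\<^sup>2))"
        using n0 A by (intro abs_cos_minor_le) (auto simp: unaligned_def)
      also have "\<dots> \<le> exp (- ((K / N)\<^sup>2))"
      proof -
        have "K / N \<le> K / real n" using A n n0 by (intro divide_left_mono) auto
        hence "(K / N)\<^sup>2 \<le> (K / real n)\<^sup>2" using A by (intro power_mono) auto
        thus ?thesis by simp
      qed
      finally show ?thesis using True by simp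
    qed auto
  qed auto
  also have "\<dots> = (\<Prod>n\<in>?U. exp (- ((K / N)\<^sup>2)))"
    using A by (subst prod.inter_filter [symmetric]) (auto simp: unaligned_def intro!: prod.cong)
  also have "\<dots> = exp (- ((K / N)\<^sup>2) * real (card ?U))"
    by (simp add: exp_of_nat_mult [symmetric] mult.commute)
  finally show ?thesis .
qed

text \<open>
  Such an \<open>h\<close> is determined by \<open>h div d\<close> and \<open>h mod d\<close>, and \<open>h mod d\<close> is the residue of an integer in \<open>[-K, K]\<close>.
\<close>

lemma card_near_multiples_le:
  fixes d Q :: nat
  assumes "d dvd Q" "Q > 0" "K \<ge> 0"
  shows "real (card {h. h < Q \<and> (\<exists>x. int d dvd x \<and> \<bar>real_of_int (x - int h)\<bar> \<le> K)}) \<le> real (Q div d) * (2 * K + 1)"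
proof -
  let ?H = "{h. h < Q \<and> (\<exists>x. int d dvd x \<and> \<bar>real_of_int (x - int h)\<bar> \<le> K)}"
  define k where "k = nat \<lfloor>K\<rfloor>"
  have d: "d > 0" using assms by (auto intro!: Nat.gr0I)
  let ?I = "{0..<Q div d} \<times> ((\<lambda>v. nat (v mod int d)) ` {- int k..int k})"
  have "?H \<subseteq> (\<lambda>(u, r). u * d + r) ` ?I"
  proof
    fix h assume "h \<in> ?H"
    then obtain x where x: "h < Q" "int d dvd x" "\<bar>real_of_int (x - int h)\<bar> \<le> K" by auto
    define v where "v = int h - x"
    have "\<bar>v\<bar> \<le> \<lfloor>K\<rfloor>" using x(3) unfolding le_floor_iff v_def by (simp add: abs_minus_commute)
    hence v: "v \<in> {- int k..int k}" using assms(3) by (auto simp: k_def)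
    have "int h mod int d = v mod int d" unfolding v_def using x(2) by (simp add: mod_diff_eq mod_diff_right_eq[symmetric] dvd_eq_mod_eq_0)
    hence "int (h mod d) = v mod int d" by (simp only: zmod_int)
    hence "h mod d = nat (v mod int d)" by (metis nat_int)
    moreover have "h div d < Q div d" using x(1) assms(1) d by (simp add: div_less_iff_less_mult)
    ultimately have "(h div d, h mod d) \<in> ?I" using v by auto
    thus "h \<in> (\<lambda>(u, r). u * d + r) ` ?I" by (rule rev_image_eqI) simp
  qed
  hence "card ?H \<le> card ((\<lambda>(u, r). u * d + r) ` ?I)" by (intro card_mono) auto
  also have "\<dots> \<le> card ?I" by (intro card_image_le) auto
  also have "\<dots> \<le> (Q div d) * card {- int k..int k}"
    unfolding card_cartesian_product by (intro mult_mono card_image_le) auto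
  finally have "real (card ?H) \<le> real ((Q div d) * card {- int k..int k})"
    by (rule of_nat_mono)
  hence "real (card ?H) \<le> real (Q div d) * real (card {- int k..int k})"
    by (simp only: of_nat_mult)
  also have "real (card {- int k..int k}) = 2 * real k + 1" by simp
  also have "real (Q div d) * (2 * real k + 1) \<le> real (Q div d) * (2 * K + 1)"
    using assms by (intro mult_left_mono) (auto simp: k_def of_nat_floor)
  finally show ?thesis .
qed

text \<open>
  For \<open>h\<close> let \<open>D h\<close> be the set of exact prime powers \<open>q\<close> for which at least \<open>t\<close> of the numbers
  exactly divisible by \<open>q\<close> are unaligned with \<open>h\<close>.  By assumption \<open>key\<close> all other \<open>q\<close> divide a common point
  \<open>x\<close> within \<open>K\<close> of \<open>h\<close>.
  
  If \<open>D h\<close> is empty, \<open>x\<close> is a multiple of \<open>Lcm A\<close> and \<open>h\<close> lies on a major arc.  Otherwise, as a number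
  has at most \<open>w\<close> exact prime powers, at least \<open>t |D h| / w\<close> numbers are unaligned, and the product of cosines is at most
  \<open>e ^ |D h|\<close> with \<open>e = exp (- ((K / N)\<^sup>2 t / w))\<close>.  On the other hand, at most \<open>(2 K + 1) P ^ |X|\<close> values of \<open>h\<close> have \<open>D h = X\<close>.
  Summing \<open>(P e) ^ |X|\<close> over all nonempty \<open>X\<close> gives the expression in assumption \<open>small\<close>.
\<close>

lemma minor_arcs_imp_unit_sum:
  assumes A: "finite A" "0 \<notin> A" "A \<noteq> {}" "\<And>n. n \<in> A \<Longrightarrow> M \<le> real n \<and> real n \<le> N"
    and M: "M > 0" and K: "0 \<le> K" "2 * K \<le> M" and R: "2 - 1 / M \<le> recip_sum A" "recip_sum A < 2"
    and w: "w > 0" "\<And>n. n \<in> A \<Longrightarrow> real (card (exact_primepows n)) \<le> w"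
    and P: "P \<ge> 0" "\<And>q. q \<in> all_exact_primepows A \<Longrightarrow> real q \<le> P"
    and key: "\<And>h::int. \<exists>x. \<bar>real_of_int (x - h)\<bar> \<le> K \<and>
       (\<forall>q\<in>all_exact_primepows A. real (card (divisible_exactly q (unaligned A K h))) < t \<longrightarrow> int q dvd x)"
    and small: "(2 * K + 1) * ((1 + P * exp (- ((K / N)\<^sup>2 * t / w))) ^ card (all_exact_primepows A) - 1) \<le> 1 / 2"
    and big: "2 * real (Lcm A) < 2 ^ card A"
  shows "\<exists>S\<subseteq>A. recip_sum S = 1"
proof -
  define Q where "Q = Lcm A"
  have Q: "Q > 0" using A unfolding Q_def by (intro Lcm_pos)
  have Npos: "N > 0" using A M by fastforce
  define e where "e = exp (- ((K / N)\<^sup>2 * t / w))"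
  define F where "F h = (\<Sum>S\<in>Pow A. cos (2 * pi * real_of_int h * recip_sum S))" for h
  define D where "D h = {q\<in>all_exact_primepows A. t \<le> real (card (divisible_exactly q (unaligned A K h)))}" for h
  have finQ: "finite (all_exact_primepows A)" using A(1) by simp
  have Apos: "n > 0" if "n \<in> A" for n
    using that A(2) by (cases n) auto
  have Feq: "F h = 2 ^ card A * cos (pi * real_of_int h * recip_sum A) * (\<Prod>n\<in>A. cos (pi * real_of_int h / real n))" for h
  proof -
    have "F h = (\<Sum>S\<in>Pow A. cos (0 + 2 * (\<Sum>n\<in>S. pi * real_of_int h / real n)))"
      unfolding F_def recip_sum_def by (intro sum.cong) (simp_all add: sum_distrib_left mult_ac)
    also have "\<dots> = 2 ^ card A * cos (0 + (\<Sum>n\<in>A. pi * real_of_int h / real n)) * (\<Prod>n\<in>A. cos (pi * real_of_int h / real n))"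
      by (rule sum_Pow_cos) fact
    also have "0 + (\<Sum>n\<in>A. pi * real_of_int h / real n) = pi * real_of_int h * recip_sum A"
      unfolding recip_sum_def by (simp add: sum_distrib_left)
    finally show ?thesis .
  qed
  have major: "F h \<ge> 0" if x: "int Q dvd x" "\<bar>real_of_int (x - h)\<bar> \<le> K" for h x
  proof -
    define d where "d = h - x"
    have dK: "\<bar>real_of_int d\<bar> \<le> M / 2" using x(2) K by (simp add: d_def abs_minus_commute)
    have "F h = F d" unfolding F_def
    proof (rule sum.cong)
      fix S assume "S \<in> Pow A"
      hence r: "recip_sum S = real (\<Sum>n\<in>S. Q div n) / real Q" using recip_sum_Lcm[of A S] A by (simp add: Q_def)
      obtain y where y: "x = int Q * y" using x(1) by (rule dvdE)
      have "real_of_int x * recip_sum S = real_of_int (y * int (\<Sum>n\<in>S. Q div n))"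
        unfolding r y using Q by simp
      then obtain m :: int where m: "real_of_int x * recip_sum S = real_of_int m" by blast
      have "2 * pi * real_of_int h * recip_sum S = 2 * pi * real_of_int d * recip_sum S + 2 * pi * real_of_int m"
        unfolding m [symmetric] d_def by (simp add: algebra_simps)
      also have "cos \<dots> = cos (2 * pi * real_of_int d * recip_sum S)"
        by (simp add: cos_add sin_integer_2pi cos_integer_2pi)
      finally show "cos (2 * pi * real_of_int h * recip_sum S) = cos (2 * pi * real_of_int d * recip_sum S)" .
    qed auto
    also have "\<dots> \<ge> 0" unfolding Feq
    proof (intro mult_nonneg_nonneg prod_nonneg)
      \<comment> \<open>As 2 pi d is a multiple of the period, only the small defect 2 - R(A) matters.\<close>
      define r where "r = 2 - recip_sum A"
      have r: "0 \<le> r" "r \<le> 1 / M" using R by (auto simp: r_def)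
      have "cos (pi * real_of_int d * recip_sum A) = cos (2 * pi * real_of_int d - pi * real_of_int d * r)"
        by (simp add: r_def algebra_simps)
      also have "\<dots> = cos (pi * real_of_int d * r)"
        by (simp add: cos_diff sin_integer_2pi cos_integer_2pi)
      finally have c: "cos (pi * real_of_int d * recip_sum A) = cos (pi * real_of_int d * r)" .
      have "\<bar>real_of_int d\<bar> * r \<le> (M / 2) * (1 / M)" using dK r M by (intro mult_mono) auto
      hence "pi * (\<bar>real_of_int d\<bar> * r) \<le> pi * (1 / 2)" using M by (intro mult_left_mono) auto
      hence "\<bar>pi * real_of_int d * r\<bar> \<le> pi / 2" using r by (simp add: abs_mult)
      hence "cos (pi * real_of_int d * r) \<ge> 0" by (intro cos_ge_zero) linarith+
      thus "cos (pi * real_of_int d * recip_sum A) \<ge> 0" using c by simp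
    next
      fix n assume n: "n \<in> A"
      hence nM: "M \<le> real n" using A by auto
      have "\<bar>real_of_int d\<bar> / real n \<le> 1 / 2" using dK nM M by (simp add: field_simps)
      hence "pi * (\<bar>real_of_int d\<bar> / real n) \<le> pi * (1 / 2)" by (intro mult_left_mono) auto
      hence "\<bar>pi * real_of_int d / real n\<bar> \<le> pi / 2" by (simp add: abs_mult)
      thus "cos (pi * real_of_int d / real n) \<ge> 0" by (intro cos_ge_zero) linarith+
    qed auto
    finally show ?thesis .
  qed
  have noD: "F h \<ge> 0" if Dh: "D h = {}" for h
  proof -
    obtain x where x: "\<bar>real_of_int (x - h)\<bar> \<le> K"
      "\<forall>q\<in>all_exact_primepows A. real (card (divisible_exactly q (unaligned A K h))) < t \<longrightarrow> int q dvd x" using key[of h] by blast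
    have q: "int q dvd x" if "q \<in> all_exact_primepows A" for q
    proof -
      have "q \<notin> D h" using Dh by simp
      hence "real (card (divisible_exactly q (unaligned A K h))) < t" using that by (simp add: D_def not_le)
      thus ?thesis using x(2) that by blast
    qed
    have "Q dvd nat \<bar>x\<bar>" unfolding Q_def
    proof (rule Lcm_least)
      fix n assume n: "n \<in> A"
      have "int n dvd x"
      proof (rule dvd_if_exact_primepows_dvd)
        show "n > 0" by (rule Apos) fact
        fix r assume "r \<in> exact_primepows n"
        hence "r \<in> all_exact_primepows A" using n unfolding all_exact_primepows_def by blast
        thus "int r dvd x" by (rule q)
      qed
      thus "n dvd nat \<bar>x\<bar>" by (simp only: dvd_nat_abs_iff)
    qed
    hence "int Q dvd x" by (simp only: dvd_nat_abs_iff)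
    thus ?thesis using x(1) by (rule major)
  qed
  have minor: "\<bar>F h\<bar> \<le> 2 ^ card A * e ^ card (D h)" for h
  proof -
    let ?U = "unaligned A K h"
    have finU: "finite ?U" "?U \<subseteq> A" using A by (auto simp: unaligned_def)
    have "t * real (card (D h)) = (\<Sum>q\<in>D h. t)" by simp
    also have "\<dots> \<le> (\<Sum>q\<in>D h. real (card (divisible_exactly q ?U)))" by (intro sum_mono) (auto simp: D_def)
    also have "\<dots> \<le> (\<Sum>q\<in>all_exact_primepows A. real (card (divisible_exactly q ?U)))"
      using finQ by (intro sum_mono2) (auto simp: D_def)
    also have "\<dots> = (\<Sum>q\<in>all_exact_primepows A. \<Sum>n\<in>?U. if q \<in> exact_primepows n then 1 else 0)"
      unfolding divisible_exactly_def using finU by (intro sum.cong) (simp_all add: sum.If_cases Int_def)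
    also have "\<dots> = (\<Sum>n\<in>?U. \<Sum>q\<in>all_exact_primepows A. if q \<in> exact_primepows n then 1 else 0)" by (rule sum.swap)
    also have "\<dots> \<le> (\<Sum>n\<in>?U. w)"
    proof (rule sum_mono)
      fix n assume n: "n \<in> ?U"
      have "(\<Sum>q\<in>all_exact_primepows A. if q \<in> exact_primepows n then 1 else 0) = real (card (all_exact_primepows A \<inter> exact_primepows n))"
        using finQ by (simp add: sum.If_cases Int_def)
      also have "\<dots> \<le> real (card (exact_primepows n))" by (simp add: card_mono)
      also have "\<dots> \<le> w" using n finU w by auto
      finally show "(\<Sum>q\<in>all_exact_primepows A. if q \<in> exact_primepows n then 1 else 0) \<le> w" .
    qed
    also have "\<dots> = w * real (card ?U)" by simp
    finally have tU: "t * real (card (D h)) / w \<le> real (card ?U)" using w by (simp add: field_simps)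
    have "\<bar>F h\<bar> = 2 ^ card A * \<bar>cos (pi * real_of_int h * recip_sum A)\<bar> * (\<Prod>n\<in>A. \<bar>cos (pi * real_of_int h / real n)\<bar>)"
      unfolding Feq by (simp add: abs_mult abs_prod)
    also have "\<dots> \<le> 2 ^ card A * 1 * exp (- ((K / N)\<^sup>2) * real (card ?U))"
      using A K Npos by (intro mult_mono prod_cos_le) (auto intro!: prod_nonneg)
    also have "\<dots> \<le> 2 ^ card A * 1 * exp (- ((K / N)\<^sup>2) * (t * real (card (D h)) / w))"
    proof (intro mult_left_mono)
      have "(K / N)\<^sup>2 * (t * real (card (D h)) / w) \<le> (K / N)\<^sup>2 * real (card ?U)"
        using tU by (intro mult_left_mono) auto
      thus "exp (- ((K / N)\<^sup>2) * real (card ?U)) \<le> exp (- ((K / N)\<^sup>2) * (t * real (card (D h)) / w))"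
        unfolding exp_le_cancel_iff by (simp only: mult_minus_left neg_le_iff_le)
    qed simp
    also have "exp (- ((K / N)\<^sup>2) * (t * real (card (D h)) / w)) = e ^ card (D h)"
      unfolding e_def exp_of_nat_mult [symmetric] by (simp add: mult_ac)
    finally show ?thesis by simp
  qed
  have count: "real (card {h. h < Q \<and> D (int h) = X}) \<le> (2 * K + 1) * P ^ card X" if X: "X \<subseteq> all_exact_primepows A" for X
  proof -
    define d where "d = Lcm (all_exact_primepows A - X)"
    have dQ: "d dvd Q" unfolding d_def Q_def
    proof (rule Lcm_least)
      fix q assume "q \<in> all_exact_primepows A - X"
      then obtain n where "n \<in> A" "q \<in> exact_primepows n" by (auto simp: all_exact_primepows_def)
      thus "q dvd Lcm A" using exact_primepow_dvd dvd_Lcm dvd_trans by blast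
    qed
    have d0: "d > 0" using dQ Q by (auto intro!: Nat.gr0I)
    have finX: "finite X" using X finQ finite_subset by auto
    have X0: "q > 0" if "q \<in> X" for q using that X by (auto simp: all_exact_primepows_def exact_primepow_pos)
    \<comment> \<open>Hence the number of multiples of d below Q is at most the product of X.\<close>
    have "Q dvd d * \<Prod>X" unfolding Q_def
    proof (rule Lcm_least)
      fix n assume n: "n \<in> A"
      have "int n dvd int (d * \<Prod>X)"
      proof (rule dvd_if_exact_primepows_dvd)
        show "n > 0" by (rule Apos) fact
        fix q assume "q \<in> exact_primepows n"
        hence "q \<in> all_exact_primepows A" using n by (auto simp: all_exact_primepows_def)
        hence "q dvd d \<or> q dvd \<Prod>X" unfolding d_def using finX by (auto intro: dvd_Lcm dvd_prodI[of X q id, unfolded id_def])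
        hence "q dvd d * \<Prod>X" by auto
        thus "int q dvd int (d * \<Prod>X)" by (simp only: int_dvd_int_iff)
      qed
      thus "n dvd d * \<Prod>X" by (simp only: int_dvd_int_iff)
    qed
    moreover have "\<Prod>X > 0" using X0 by (intro prod_pos) auto
    ultimately have "Q \<le> d * \<Prod>X" using d0 by (intro dvd_imp_le) auto
    hence "Q div d \<le> d * \<Prod>X div d" by (rule div_le_mono)
    hence Qd: "Q div d \<le> \<Prod>X" using d0 by simp
    have "{h. h < Q \<and> D (int h) = X} \<subseteq> {h. h < Q \<and> (\<exists>x. int d dvd x \<and> \<bar>real_of_int (x - int h)\<bar> \<le> K)}"
    proof clarify
      fix h assume h: "h < Q" "X = D (int h)"
      obtain x where x: "\<bar>real_of_int (x - int h)\<bar> \<le> K"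
        "\<forall>q\<in>all_exact_primepows A. real (card (divisible_exactly q (unaligned A K (int h)))) < t \<longrightarrow> int q dvd x" using key[of "int h"] by blast
      have "q dvd nat \<bar>x\<bar>" if "q \<in> all_exact_primepows A - X" for q
      proof -
        have "int q dvd x" using that x(2) h(2) by (auto simp: D_def not_le)
        thus ?thesis by (simp only: dvd_nat_abs_iff)
      qed
      hence "d dvd nat \<bar>x\<bar>" unfolding d_def by (intro Lcm_least)
      hence "int d dvd x" by (simp only: dvd_nat_abs_iff)
      thus "\<exists>x. int d dvd x \<and> \<bar>real_of_int (x - int h)\<bar> \<le> K" using x(1) by blast
    qed
    hence "real (card {h. h < Q \<and> D (int h) = X})
        \<le> real (card {h. h < Q \<and> (\<exists>x. int d dvd x \<and> \<bar>real_of_int (x - int h)\<bar> \<le> K)})"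
      by (intro of_nat_mono card_mono) auto
    also have "\<dots> \<le> real (Q div d) * (2 * K + 1)" using dQ Q K by (intro card_near_multiples_le) auto
    also have "\<dots> \<le> real (\<Prod>X) * (2 * K + 1)"
    proof (intro mult_right_mono)
      show "real (Q div d) \<le> real (\<Prod>X)" using Qd by (rule of_nat_mono)
    qed (use K in simp)
    also have "real (\<Prod>X) \<le> P ^ card X"
    proof -
      have "real (\<Prod>X) = (\<Prod>q\<in>X. real q)" by simp
      also have "\<dots> \<le> (\<Prod>q\<in>X. P)" using P X by (intro prod_mono) auto
      finally show ?thesis by simp
    qed
    hence "real (\<Prod>X) * (2 * K + 1) \<le> P ^ card X * (2 * K + 1)" using K by (intro mult_right_mono) auto
    finally show ?thesis by (simp add: mult.commute)
  qed
  \<comment> \<open>The frequencies outside H contribute a nonnegative amount by noD.\<close>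
  define H where "H = {h. h < Q \<and> D (int h) \<noteq> {}}"
  have finH: "finite H" by (simp add: H_def)
  define XX where "XX = Pow (all_exact_primepows A) - {{}}"
  have sumH: "(\<Sum>h\<in>H. e ^ card (D (int h))) \<le> 1 / 2"
  proof -
    have "(\<Sum>h\<in>H. e ^ card (D (int h))) = (\<Sum>X\<in>(\<lambda>h. D (int h)) ` H. \<Sum>h\<in>{h\<in>H. D (int h) = X}. e ^ card (D (int h)))"
      using finH by (rule sum.image_gen)
    also have "\<dots> \<le> (\<Sum>X\<in>XX. \<Sum>h\<in>{h\<in>H. D (int h) = X}. e ^ card (D (int h)))"
      using finQ by (intro sum_mono2) (auto simp: XX_def H_def D_def e_def intro!: sum_nonneg)
    also have "\<dots> \<le> (\<Sum>X\<in>XX. (2 * K + 1) * (P * e) ^ card X)"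
    proof (rule sum_mono)
      fix X assume X: "X \<in> XX"
      have "(\<Sum>h\<in>{h\<in>H. D (int h) = X}. e ^ card (D (int h))) = (\<Sum>h\<in>{h\<in>H. D (int h) = X}. e ^ card X)"
        by (intro sum.cong) auto
      also have "\<dots> = real (card {h\<in>H. D (int h) = X}) * e ^ card X" by simp
      also have "\<dots> \<le> ((2 * K + 1) * P ^ card X) * e ^ card X"
      proof (intro mult_right_mono)
        have "real (card {h\<in>H. D (int h) = X}) \<le> real (card {h. h < Q \<and> D (int h) = X})"
          by (intro of_nat_mono card_mono) (auto simp: H_def)
        also have "\<dots> \<le> (2 * K + 1) * P ^ card X" using X by (intro count) (auto simp: XX_def)
        finally show "real (card {h\<in>H. D (int h) = X}) \<le> (2 * K + 1) * P ^ card X" .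
      qed (simp add: e_def)
      also have "\<dots> = (2 * K + 1) * (P * e) ^ card X" by (simp add: power_mult_distrib)
      finally show "(\<Sum>h\<in>{h\<in>H. D (int h) = X}. e ^ card (D (int h))) \<le> (2 * K + 1) * (P * e) ^ card X" .
    qed
    also have "\<dots> = (2 * K + 1) * (\<Sum>X\<in>XX. (P * e) ^ card X)" by (rule sum_distrib_left [symmetric])
    also have "(\<Sum>X\<in>XX. (P * e) ^ card X) = (\<Sum>X\<in>Pow (all_exact_primepows A). (P * e) ^ card X) - 1"
      unfolding XX_def using finQ by (subst sum_diff1) auto
    also have "(\<Sum>X\<in>Pow (all_exact_primepows A). (P * e) ^ card X) = (1 + P * e) ^ card (all_exact_primepows A)"
    proof -
      have "(\<Prod>q\<in>all_exact_primepows A. P * e + 1) = (\<Sum>X\<in>Pow (all_exact_primepows A). (\<Prod>q\<in>X. P * e) * (\<Prod>q\<in>all_exact_primepows A - X. 1))"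
        by (rule prod_add) fact
      thus ?thesis by (simp add: add.commute)
    qed
    finally show ?thesis using small by (simp add: e_def)
  qed
  have F0: "F 0 = 2 ^ card A" unfolding F_def using A by (simp add: card_Pow)
  have "2 ^ card A * (1 / 2) \<le> 2 ^ card A * (1 - (\<Sum>h\<in>H. e ^ card (D (int h))))"
    using sumH by (intro mult_left_mono) auto
  also have "\<dots> = F 0 - (\<Sum>h\<in>H. 2 ^ card A * e ^ card (D (int h)))"
    by (simp add: F0 algebra_simps sum_distrib_left)
  also have "\<dots> \<le> (\<Sum>h<Q. F (int h))"
  proof -
    have "(\<Sum>h\<in>{..<Q}. (if h = 0 then F 0 else 0) - (if h \<in> H then 2 ^ card A * e ^ card (D (int h)) else 0))
        \<le> (\<Sum>h<Q. F (int h))"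
    proof (rule sum_mono)
      fix h assume h: "h \<in> {..<Q}"
      have e0: "e > 0" by (simp add: e_def)
      have "F (int h) \<ge> - (2 ^ card A * e ^ card (D (int h)))" using minor[of "int h"] by linarith
      moreover have "h \<notin> H \<Longrightarrow> F (int h) \<ge> 0" using noD[of "int h"] h by (auto simp: H_def)
      moreover have "2 ^ card A * e ^ card (D (int h)) > 0" using e0 by simp
      ultimately show "(if h = 0 then F 0 else 0) - (if h \<in> H then 2 ^ card A * e ^ card (D (int h)) else 0) \<le> F (int h)"
        by auto
    qed
    moreover have "(\<Sum>h\<in>{..<Q}. (if h = 0 then F 0 else 0) - (if h \<in> H then 2 ^ card A * e ^ card (D (int h)) else 0))
        = F 0 - (\<Sum>h\<in>H. 2 ^ card A * e ^ card (D (int h)))"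
    proof -
      have "{..<Q} \<inter> {h. h \<in> H} = H" by (auto simp: H_def)
      thus ?thesis using Q by (simp add: sum_subtractf sum.If_cases sum.delta)
    qed
    ultimately show ?thesis by simp
  qed
  finally have "real Q < (\<Sum>h<Q. F (int h))" using big unfolding Q_def by linarith
  thus ?thesis using A R(2) unfolding F_def Q_def by (intro unit_sum_if_main_term) auto
qed

section \<open>Choice of the parameters\<close>

lemma recip_sum_mono: "finite B \<Longrightarrow> A \<subseteq> B \<Longrightarrow> recip_sum A \<le> recip_sum B"
  unfolding recip_sum_def by (intro sum_mono2) auto

lemma finite_primepow_le [simp]: "finite {q. primepow q \<and> real q \<le> x}"
  by (rule finite_subset[OF _ finite_nat_real_le[of x primepow]]) auto

lemma recip_sum_primepow_le:
  assumes "L \<ge> 1"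
  shows "recip_sum {q. primepow q \<and> real q \<le> exp L} \<le> ln L + 11"
proof -
  define n where "n = nat \<lfloor>exp L\<rfloor>"
  have "exp L \<ge> 2" using exp_ge_add_one_self[of L] assms by linarith
  hence n: "n \<ge> 2" "real n \<le> exp L" by (auto simp: n_def le_nat_floor of_nat_floor)
  have "recip_sum {q. primepow q \<and> real q \<le> exp L} \<le> recip_sum {q. q \<le> n \<and> primepow q}"
    by (rule recip_sum_mono) (auto simp: n_def le_nat_floor)
  also have "\<dots> \<le> ln (ln (real n)) + 11"
    unfolding recip_sum_def using n(1) by (rule sum_inverse_primepow_le)
  also have "ln (ln (real n)) \<le> ln L"
  proof (subst ln_le_cancel_iff)
    show "ln (real n) \<le> L" using n by (simp add: ln_le_cancel_iff[of "real n" "exp L", simplified])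
  qed (use n assms in auto)
  finally show ?thesis by simp
qed

text \<open>
  The product of the exact prime powers is a common multiple of \<open>A\<close>.
\<close>

lemma Lcm_le_power_card:
  assumes "finite A" "0 \<notin> A" "P \<ge> 0" "\<And>q. q \<in> all_exact_primepows A \<Longrightarrow> real q \<le> P"
  shows "real (Lcm A) \<le> P ^ card (all_exact_primepows A)"
proof -
  have fin: "finite (all_exact_primepows A)" using assms(1) by simp
  have "Lcm A dvd \<Prod>(all_exact_primepows A)"
  proof (rule Lcm_least)
    fix n assume n: "n \<in> A"
    have "int n dvd int (\<Prod>(all_exact_primepows A))"
    proof (rule dvd_if_exact_primepows_dvd)
      show "n > 0" using n assms(2) by (cases n) auto
      fix q assume "q \<in> exact_primepows n"
      hence "q \<in> all_exact_primepows A" using n by (auto simp: all_exact_primepows_def)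
      hence "q dvd \<Prod>(all_exact_primepows A)" using dvd_prodI[OF fin, of q id] by simp
      thus "int q dvd int (\<Prod>(all_exact_primepows A))" by (simp only: int_dvd_int_iff)
    qed
    thus "n dvd \<Prod>(all_exact_primepows A)" by (simp only: int_dvd_int_iff)
  qed
  moreover have "\<Prod>(all_exact_primepows A) > 0" by (intro prod_pos) (auto simp: all_exact_primepows_def exact_primepow_pos)
  ultimately have "Lcm A \<le> \<Prod>(all_exact_primepows A)" by (intro dvd_imp_le) auto
  hence "real (Lcm A) \<le> real (\<Prod>(all_exact_primepows A))" by (rule of_nat_mono)
  also have "\<dots> = (\<Prod>q\<in>all_exact_primepows A. real q)" by simp
  also have "\<dots> \<le> (\<Prod>q\<in>all_exact_primepows A. P)" using assms by (intro prod_mono) auto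
  finally show ?thesis by simp
qed

lemma power_minus_one_le:
  fixes s :: real
  assumes "s \<ge> 0" "s * real m \<le> 1"
  shows "(1 + s) ^ m - 1 \<le> 2 * (s * real m)"
proof -
  have "(1 + s) ^ m \<le> exp s ^ m" using assms exp_ge_add_one_self[of s] by (intro power_mono) auto
  also have "\<dots> = exp (s * real m)" by (simp add: exp_of_nat_mult [symmetric] mult.commute)
  also have "\<dots> \<le> 1 + s * real m + (s * real m)\<^sup>2" using assms by (intro exp_bound) auto
  also have "(s * real m)\<^sup>2 \<le> s * real m"
    using assms mult_right_mono[of "s * real m" 1 "s * real m"] by (simp add: power2_eq_square)
  finally show ?thesis by simp
qed

text \<open>
  The inequalities between the parameters, all true for large \<open>L = ln N\<close>.  With window ratio \<open>W = exp (L powr (1/5))\<close>,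
  smoothness bound \<open>E0 = exp (L powr (4/5))\<close>, \<open>z = exp (L powr (1/2))\<close>, \<open>E = exp (L powr (3/4))\<close> and
  \<open>\<tau> = L powr (-1/100)\<close> they say, after \<open>L \<ge> 10\<close> and in this order: the loss in making the set balanced is at most 1; the
  prime powers are so few that \<open>Lcm A\<close> is small compared with \<open>2 ^ |A|\<close>; each prime power with many unaligned
  multiples saves the factor \<open>exp (4 L)\<close>; the bound of \<open>aligned_sum_le\<close> with \<open>w = (13/50) ln L\<close> is below \<open>\<tau> / 2\<close>; the
  weight \<open>w\<close> is enough for \<open>aligned_points_eq\<close>; and \<open>W\<^sup>2 \<le> z\<close>.
  
  The number \<open>13/50\<close> can be any number strictly between \<open>1/4\<close>, half of the exponent of \<open>ln z\<close>, and
  \<open>1/2 - 1/5 - 1/100\<close>, the exponent that the last summand of \<open>aligned_sum_le\<close> leaves.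
\<close>

definition admissible :: "real \<Rightarrow> bool" where
  "admissible L \<longleftrightarrow> L \<ge> 10 \<and>
     L powr (-1/100) * (ln L + 11) \<le> 1 \<and>
     L * exp (L powr (1/5)) / exp (L powr (4/5)) < 1/2 \<and>
     4 * L \<le> L powr (-1/100) * exp (L powr (4/5)) / (2 * exp (L powr (1/5))) / (L / ln 2)
            * (1 / (4 * exp (L powr (3/4)) * exp (L powr (1/5))))\<^sup>2 \<and>
     (L powr (1/5) + 6) * (exp 11 * L powr (1/2)) / (L powr (4/5) - L powr (1/5))
      + 4 * (L powr (1/5) + 6) / L powr (1/2) * (2 * (L powr (1/2) + 4) * (exp 11 * L powr (1/2)) / L powr (3/4))
      + (2 * L powr (1/5) + 1) * (4 * (2 * L powr (1/5) + 6) / L powr (1/2))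
      + (L powr (1/5) + 6) * L powr (13/50) * (28 / L powr (1/2) * (ln (L + 2) + 1))
      < L powr (-1/100) / 2 \<and>
     2 * (13/50 * ln L) \<ge> 1/2 * ln L + 11 + (ln (ln L) + 11 + (L / ln 2) / (L - 1)) \<and>
     2 * L powr (1/5) \<le> L powr (1/2)"

lemma eventually_admissible: "eventually admissible at_top"
  unfolding admissible_def
  by (intro eventually_conj) real_asymp+

text \<open>
  The set \<open>A\<close> is replaced by a balanced subset \<open>C\<close> with reciprocal sum just below 2.  The assumption
  \<open>key\<close> of \<open>minor_arcs_imp_unit_sum\<close> is met with \<open>K = M / (4 E)\<close>: when fewer than \<open>t\<close> of the
  numbers exactly divisible by \<open>q\<close> are unaligned, these carry at most half of the weight \<open>\<tau>\<close> of \<open>q\<close>, so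
  the aligned ones carry the other half, and \<open>aligned_sum_le\<close> yields a point with many small primes.
\<close>

lemma window_unit_sum:
  fixes A :: "nat set" and L M :: real
  defines "W \<equiv> exp (L powr (1/5))" and "E0 \<equiv> exp (L powr (4/5))"
  assumes L: "admissible L" and M: "M > 0"
    and A: "finite A" "\<And>n. n \<in> A \<Longrightarrow> n > 1 \<and> M \<le> real n \<and> real n \<le> M * W \<and> real n \<le> exp L"
    and smooth: "\<And>n q. n \<in> A \<Longrightarrow> q \<in> exact_primepows n \<Longrightarrow> real q * E0 \<le> real n"
    and big: "recip_sum A \<ge> 4"
  shows "\<exists>S\<subseteq>A. recip_sum S = 1"
proof -
  define z where "z = exp (L powr (1/2))"
  define E where "E = exp (L powr (3/4))"
  define \<tau> where "\<tau> = L powr (-1/100)"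
  define K where "K = M / (4 * E)"
  define t where "t = \<tau> * E0 / (2 * W)"
  define w0 where "w0 = 13/50 * ln L"
  have L10: "L \<ge> 10" and C1: "\<tau> * (ln L + 11) \<le> 1" and C5: "L * W / E0 < 1 / 2"
    and C4: "4 * L \<le> t / (L / ln 2) * (1 / (4 * E * W))\<^sup>2"
    and C7: "2 * w0 \<ge> 1/2 * ln L + 11 + (ln (ln L) + 11 + (L / ln 2) / (L - 1))"
    and C8: "2 * L powr (1/5) \<le> L powr (1/2)"
    using L unfolding admissible_def W_def E0_def E_def \<tau>_def t_def w0_def by blast+
  have C6: "(ln W + 6) * (exp 11 * L powr (1/2)) / (L powr (4/5) - L powr (1/5))
      + 4 * (ln W + 6) / ln z * (2 * (ln z + 4) * (exp 11 * L powr (1/2)) / ln E)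
      + (2 * ln W + 1) * (4 * (2 * ln W + 6) / ln z)
      + (ln W + 6) * exp w0 * (28 / ln z * (ln (L + 2) + 1)) < \<tau> / 2"
  proof -
    have ew: "exp w0 = L powr (13/50)" using L10 by (simp add: w0_def powr_def)
    show ?thesis unfolding ew W_def z_def E_def \<tau>_def ln_exp
      using L unfolding admissible_def by blast
  qed
  have pos: "W > 0" "E0 > 0" "z > 0" "E > 0" "\<tau> > 0" "K > 0" "t > 0"
    using L10 M by (auto simp: W_def E0_def z_def E_def \<tau>_def K_def t_def)
  have L15: "L powr (1/5) \<ge> 1" "L powr (1/2) \<ge> 1" "L powr (3/4) > 0" using L10 by (auto simp: ge_one_powr_ge_zero)
  have W1: "W \<ge> 1" and E1: "E > 1" using L15 by (auto simp: W_def E_def)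
  have W2: "2 * W < E0" "L * W < E0 / 2"
  proof -
    show *: "L * W < E0 / 2" using C5 pos by (simp add: field_simps)
    have "2 * W \<le> L * W" using L10 pos by (intro mult_right_mono) auto
    thus "2 * W < E0" using * pos by linarith
  qed
  have A0: "0 \<notin> A" using A(2)[of 0] by auto
  have pp: "primepow q \<and> real q \<le> exp L \<and> real q * E0 \<le> M * W" if qA: "q \<in> all_exact_primepows A" for q
  proof -
    obtain n where n: "n \<in> A" "q \<in> exact_primepows n" using qA by (auto simp: all_exact_primepows_def)
    have "q \<le> n" using exact_primepow_dvd[OF n(2)] A(2)[OF n(1)] by (intro dvd_imp_le) auto
    hence "real q \<le> exp L" using A(2)[OF n(1)] by linarith
    thus ?thesis using exact_primepow_primepow[OF n(2)] smooth[OF n] A(2)[OF n(1)] by auto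
  qed
  have "A \<noteq> {}" using big by (auto simp: recip_sum_def)
  then obtain n0 where n0: "n0 \<in> A" by blast
  have MexpL: "M \<le> exp L" using A(2)[OF n0] by linarith
  have M2: "M \<ge> 2"
  proof -
    obtain p where p: "prime p" "p dvd n0" using A(2)[OF n0] prime_factor_nat[of n0] by auto
    hence q: "p ^ multiplicity p n0 \<in> exact_primepows n0"
      unfolding exact_primepows_def using A(2)[OF n0] by (intro imageI) (auto simp: prime_factors_dvd)
    hence "real (p ^ multiplicity p n0) \<ge> 1" using exact_primepow_pos[OF q] by linarith
    hence "1 * E0 \<le> real (p ^ multiplicity p n0) * E0" using pos by (intro mult_right_mono) auto
    also have "\<dots> \<le> M * W" using smooth[OF n0 q] A(2)[OF n0] by linarith
    finally have "2 * W < M * W" using W2 by linarith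
    thus ?thesis using pos by (simp add: mult_less_cancel_right)
  qed
  have rA: "recip_sum (all_exact_primepows A) \<le> ln L + 11"
  proof -
    have "recip_sum (all_exact_primepows A) \<le> recip_sum {q. primepow q \<and> real q \<le> exp L}"
      using pp by (intro recip_sum_mono) auto
    also have "\<dots> \<le> ln L + 11" using L10 by (intro recip_sum_primepow_le) auto
    finally show ?thesis .
  qed
  have card_le: "real (card X) \<le> y" if "X \<subseteq> all_exact_primepows A" "\<And>q. q \<in> X \<Longrightarrow> real q \<le> y" "y \<ge> 0" for X y
  proof -
    have "X \<subseteq> {1..nat \<lfloor>y\<rfloor>}"
    proof
      fix q assume q: "q \<in> X"
      hence "primepow q" using pp that(1) by blast
      hence "q > 0" by (rule primepow_gt_0_nat)
      moreover have "q \<le> nat \<lfloor>y\<rfloor>" using that(2)[OF q] by (rule le_nat_floor)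
      ultimately show "q \<in> {1..nat \<lfloor>y\<rfloor>}" by simp
    qed
    hence "card X \<le> card {1..nat \<lfloor>y\<rfloor>}" by (intro card_mono) auto
    hence "real (card X) \<le> real (nat \<lfloor>y\<rfloor>)" by simp
    also have "\<dots> \<le> y" using that by (intro of_nat_floor) auto
    finally show ?thesis .
  qed
  have cardA: "real (card (all_exact_primepows A)) \<le> M * W / E0"
    using pp pos M by (intro card_le) (auto simp: field_simps)
  have cardL: "real (card (all_exact_primepows A)) \<le> exp L"
    using pp by (intro card_le) auto
  obtain B where B: "B \<subseteq> A" "\<And>q. q \<in> all_exact_primepows B \<Longrightarrow> real q * recip_sum (divisible_exactly q B) \<ge> \<tau>"
    "recip_sum A \<le> recip_sum B + \<tau> * recip_sum (all_exact_primepows A - all_exact_primepows B)"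
    using exists_balanced_subset[OF A(1), of \<tau>] pos by auto
  have finB: "finite B" using B A finite_subset by auto
  have "\<tau> * recip_sum (all_exact_primepows A - all_exact_primepows B) \<le> \<tau> * (ln L + 11)"
  proof (intro mult_left_mono)
    have "recip_sum (all_exact_primepows A - all_exact_primepows B) \<le> recip_sum (all_exact_primepows A)" using A by (intro recip_sum_mono) auto
    thus "recip_sum (all_exact_primepows A - all_exact_primepows B) \<le> ln L + 11" using rA by linarith
  qed (use pos in simp)
  hence rB: "recip_sum B \<ge> 3" using B(3) C1 big by linarith
  have "\<exists>C\<subseteq>B. (\<forall>q\<in>all_exact_primepows C. real q * recip_sum (divisible_exactly q C) \<ge> \<tau>) \<and> 2 - 1 / M \<le> recip_sum C \<and> recip_sum C < 2"
  proof (rule exists_balanced_subset_near_two)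
    show "all_exact_primepows B \<subseteq> all_exact_primepows A" using B by (intro all_exact_primepows_mono)
    have "\<tau> * recip_sum (all_exact_primepows A) \<le> \<tau> * (ln L + 11)" using rA pos by (intro mult_left_mono) auto
    moreover have "real (card (all_exact_primepows A)) / M \<le> (M * W / E0) / M" using cardA M by (intro divide_right_mono) auto
    moreover have "(M * W / E0) / M < 1" using M pos W2 W1 by (simp add: field_simps)
    ultimately show "\<tau> * recip_sum (all_exact_primepows A) + real (card (all_exact_primepows A)) / M < 2" using C1 by linarith
    show "\<And>n. n \<in> B \<Longrightarrow> M \<le> real n" using B A by auto
    show "recip_sum B \<ge> 2 - 1 / M" using rB M divide_pos_pos[of 1 M] by linarith
  qed (use finB A M pos B in auto)
  then obtain C where C: "C \<subseteq> B" "\<And>q. q \<in> all_exact_primepows C \<Longrightarrow> real q * recip_sum (divisible_exactly q C) \<ge> \<tau>"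
    "2 - 1 / M \<le> recip_sum C" "recip_sum C < 2" by blast
  have finC: "finite C" using C finB finite_subset by auto
  have CA: "C \<subseteq> A" using C B by auto
  have eC: "all_exact_primepows C \<subseteq> all_exact_primepows A" using CA by (rule all_exact_primepows_mono)
  have finEC: "finite (all_exact_primepows C)" using finC by simp
  have cardEC: "card (all_exact_primepows C) \<le> card (all_exact_primepows A)" using eC A by (intro card_mono) auto
  have "1 / M \<le> 1 / 2" using M2 by (intro divide_left_mono) auto
  hence rC1: "recip_sum C \<ge> 3 / 2" using C(3) by linarith
  have "C \<noteq> {}" using rC1 by (auto simp: recip_sum_def)
  have key: "\<exists>x. \<bar>real_of_int (x - h)\<bar> \<le> K \<and>
       (\<forall>q\<in>all_exact_primepows C. real (card (divisible_exactly q (unaligned C K h))) < t \<longrightarrow> int q dvd x)" for h :: int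
  proof -
    define D where "D = {q\<in>all_exact_primepows C. real (card (divisible_exactly q (unaligned C K h))) < t}"
    have one: "\<exists>x. \<bar>real_of_int (x - h)\<bar> \<le> K \<and> int q dvd x \<and> prime_weight {p \<in> primes_upto z. int p dvd x} > w0"
      if qD: "q \<in> D" for q
    proof (rule ccontr)
      assume no: "\<not> ?thesis"
      have qC: "q \<in> all_exact_primepows C" and few: "real (card (divisible_exactly q (unaligned C K h))) < t" using qD by (auto simp: D_def)
      have qA: "q \<in> all_exact_primepows A" using qC eC by auto
      have q0: "q > 0" using qC by (auto simp: all_exact_primepows_def exact_primepow_pos)
      define U where "U = divisible_exactly q (unaligned C K h)"
      define V where "V = divisible_exactly q C - U"
      have fin: "finite (divisible_exactly q C)" "U \<subseteq> divisible_exactly q C" using finC by (auto simp: U_def divisible_exactly_def unaligned_def)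
      have qE: "real q * E0 \<le> M * W" using pp[OF qA] by simp
      have "\<tau> \<le> real q * recip_sum (divisible_exactly q C)" using C(2) qC by blast
      also have "recip_sum (divisible_exactly q C) = recip_sum V + recip_sum U" unfolding recip_sum_def V_def
        using fin by (intro sum.subset_diff) auto
      also have "recip_sum U \<le> t * (1 / M)"
      proof -
        have "recip_sum U \<le> (\<Sum>n\<in>U. 1 / M)" unfolding recip_sum_def
        proof (rule sum_mono)
          fix n assume "n \<in> U"
          hence "M \<le> real n" using CA A(2) fin by (auto simp: divisible_exactly_def)
          thus "1 / real n \<le> 1 / M" using M by (intro divide_left_mono) auto
        qed
        also have "\<dots> = real (card U) * (1 / M)" by simp
        also have "\<dots> \<le> t * (1 / M)" using few M unfolding U_def by (intro mult_right_mono) auto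
        finally show ?thesis .
      qed
      finally have "\<tau> \<le> real q * (recip_sum V + t * (1 / M))" using q0 by simp
      also have "\<dots> = real q * recip_sum V + real q * (t / M)" by (simp add: algebra_simps)
      also have "real q * (t / M) \<le> \<tau> / 2"
      proof -
        \<comment> \<open>The value of t is chosen for this cancellation.\<close>
        have "real q * (t / M) = (real q * E0) * (\<tau> / (2 * W * M))" by (simp add: t_def)
        also have "\<dots> \<le> (M * W) * (\<tau> / (2 * W * M))" using qE pos M by (intro mult_right_mono) auto
        also have "\<dots> = \<tau> / 2" using pos M by simp
        finally show ?thesis .
      qed
      finally have V1: "real q * recip_sum V \<ge> \<tau> / 2" by linarith
      define H where "H = nat \<lfloor>L\<rfloor> + 1"
      have H: "L < real H" "real H \<le> L + 1" "H > 0" using L10 by (auto simp: H_def of_nat_floor)  linarith+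
      have Mq: "M / real q \<ge> E0 / W" using qE q0 pos by (simp add: field_simps)
      have lnEW: "ln (E0 / W) = L powr (4/5) - L powr (1/5)" by (simp add: E0_def W_def ln_div)
      have EW1: "E0 / W > 1" using W2 pos by (simp add: field_simps)
      have lnMq: "L powr (4/5) - L powr (1/5) \<le> ln (M / real q)"
        using Mq EW1 unfolding lnEW [symmetric] by (subst ln_le_cancel_iff) auto
      have lnEW0: "L powr (4/5) - L powr (1/5) > 0" using EW1 unfolding lnEW [symmetric] by simp
      have "(\<Sum>n\<in>V. real q / real n)
        \<le> (ln W + 6) * exp (prime_weight (primes_upto z)) / ln (M / real q)
         + 4 * (ln W + 6) / ln z * (2 * (ln z + 4) * exp (prime_weight (primes_upto z)) / ln E)
         + (2 * ln W + 1) * (4 * (2 * ln W + 6) / ln z)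
         + (ln W + 6) * exp w0 * (28 / ln z * (\<Sum>i=1..H. 1 / real i))"
      proof (rule aligned_sum_le[where M = M and K = K and h = h])
        show "W * W \<le> z" using C8 by (simp add: W_def z_def exp_add [symmetric])
        show "M / E > 2 * K" using M pos by (simp add: K_def field_simps)
        show "M / real q > 1" using Mq EW1 by linarith
        have "ln (M / real q) \<le> ln (exp L)"
        proof (subst ln_le_cancel_iff)
          have "M / real q \<le> M / 1" using M q0 by (intro divide_left_mono) auto
          thus "M / real q \<le> exp L" using MexpL by simp
        qed (use M q0 in auto)
        thus "ln (M / real q) < real H" using H by simp
        show "finite V" using fin by (simp add: V_def)
        fix n assume n: "n \<in> V"
        hence n': "n \<in> C" "q \<in> exact_primepows n" "n \<notin> unaligned C K h" by (auto simp: V_def U_def divisible_exactly_def)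
        show "q dvd n \<and> M \<le> real n \<and> real n \<le> M * W" using n' exact_primepow_dvd CA A(2) by auto
        show "\<exists>x. int n dvd x \<and> \<bar>real_of_int (x - h)\<bar> \<le> K" using n' by (auto simp: unaligned_def not_less)
      next
        fix x :: int assume "\<bar>real_of_int (x - h)\<bar> \<le> K" "int q dvd x"
        thus "prime_weight {p \<in> primes_upto z. int p dvd x} \<le> w0" using no by (auto simp: not_less)
      qed (use L15 M pos E1 q0 in \<open>auto simp: W_def z_def\<close>)
      also have "\<dots> \<le> (ln W + 6) * (exp 11 * L powr (1/2)) / (L powr (4/5) - L powr (1/5))
      + 4 * (ln W + 6) / ln z * (2 * (ln z + 4) * (exp 11 * L powr (1/2)) / ln E)
      + (2 * ln W + 1) * (4 * (2 * ln W + 6) / ln z)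
      + (ln W + 6) * exp w0 * (28 / ln z * (ln (L + 2) + 1))"
      proof -
        have lnW: "ln W + 6 \<ge> 0" "ln z \<ge> 0" "ln E \<ge> 0" using L15 by (auto simp: W_def z_def E_def)
        have z2: "z \<ge> 2" using exp_ge_add_one_self[of "L powr (1/2)"] L15 unfolding z_def by linarith
        have "prime_weight (primes_upto z) \<le> ln (ln z) + 11" using z2 by (rule prime_weight_primes_upto_le)
        also have "ln (ln z) = ln (L powr (1/2))" by (simp add: z_def)
        finally have "exp (prime_weight (primes_upto z)) \<le> exp (ln (L powr (1/2)) + 11)" by simp
        also have "\<dots> = exp 11 * L powr (1/2)"
        proof -
          have "exp (ln (L powr (1/2))) = L powr (1/2)" using L15 by (intro exp_ln) linarith
          thus ?thesis by (simp only: exp_add mult.commute)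
        qed
        finally have e1: "exp (prime_weight (primes_upto z)) \<le> exp 11 * L powr (1/2)" .
        have e2: "(\<Sum>i=1..H. 1 / real i) \<le> ln (L + 2) + 1"
        proof -
          have "(\<Sum>i=1..H. 1 / real i) \<le> ln (real H) + 1" using H by (intro harmonic_upper)
          also have "ln (real H) \<le> ln (L + 2)" using H L10 by (subst ln_le_cancel_iff) auto
          finally show ?thesis by simp
        qed
        show ?thesis
        proof (intro add_mono order.refl)
          show "(ln W + 6) * exp (prime_weight (primes_upto z)) / ln (M / real q)
              \<le> (ln W + 6) * (exp 11 * L powr (1/2)) / (L powr (4/5) - L powr (1/5))"
            using e1 lnW lnMq lnEW0 by (intro frac_le mult_left_mono mult_nonneg_nonneg) auto
          show "4 * (ln W + 6) / ln z * (2 * (ln z + 4) * exp (prime_weight (primes_upto z)) / ln E)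
             \<le> 4 * (ln W + 6) / ln z * (2 * (ln z + 4) * (exp 11 * L powr (1/2)) / ln E)"
            using e1 lnW by (intro mult_left_mono divide_right_mono) auto
          show "(ln W + 6) * exp w0 * (28 / ln z * (\<Sum>i=1..H. 1 / real i))
             \<le> (ln W + 6) * exp w0 * (28 / ln z * (ln (L + 2) + 1))"
            using e2 lnW by (intro mult_left_mono) auto
        qed
      qed
      also have "\<dots> < \<tau> / 2" by (rule C6)
      finally have "(\<Sum>n\<in>V. real q / real n) < \<tau> / 2" .
      moreover have "(\<Sum>n\<in>V. real q / real n) = real q * recip_sum V"
        by (simp add: recip_sum_def sum_distrib_left)
      ultimately show False using V1 by linarith
    qed
    show ?thesis
    proof (cases "D = {}")
      case True
      thus ?thesis using pos by (intro exI[of _ h]) (auto simp: D_def)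
    next
      case False
      then obtain r where r: "r \<in> D" by blast
      from one[OF r] obtain x where x: "\<bar>real_of_int (x - h)\<bar> \<le> K" "prime_weight {p \<in> primes_upto z. int p dvd x} > w0" by blast
      have "int q dvd x" if q: "q \<in> D" for q
      proof -
        from one[OF q] obtain x' where x': "\<bar>real_of_int (x' - h)\<bar> \<le> K" "int q dvd x'"
          "prime_weight {p \<in> primes_upto z. int p dvd x'} > w0" by blast
        have "x = x'"
        proof (rule aligned_points_eq[where N = "exp L" and z = z and T = L and w = w0])
          have "M * 1 \<le> M * E" using E1 M by (intro mult_left_mono) auto
          hence "K \<le> M / 4" unfolding K_def using M E1 by (intro divide_left_mono) auto
          hence "2 * K \<le> exp L" using MexpL M by linarith
          moreover have "\<bar>real_of_int (x - x')\<bar> \<le> 2 * K" using x(1) x'(1) by (auto simp: abs_le_iff)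
          ultimately show "\<bar>real_of_int (x - x')\<bar> \<le> exp L" by linarith
          show "z \<ge> 2" using exp_ge_add_one_self[of "L powr (1/2)"] L15 unfolding z_def by linarith
          have "ln (ln z) = 1/2 * ln L" using L10 by (simp add: z_def ln_powr)
          thus "2 * w0 \<ge> ln (ln z) + 11 + (ln (ln L) + 11 + (ln (exp L) / ln 2) / (L - 1))" using C7 by simp
        qed (use L10 x x' in auto)
        thus ?thesis using x' by simp
      qed
      thus ?thesis using x by (intro exI[of _ x]) (auto simp: D_def)
    qed
  qed
  have "\<exists>S\<subseteq>C. recip_sum S = 1"
  proof (rule minor_arcs_imp_unit_sum[where M = M and N = "M * W" and K = K and w = "L / ln 2" and P = "exp L" and t = t])
    show "0 \<notin> C" using CA A0 by auto
    show "\<And>n. n \<in> C \<Longrightarrow> M \<le> real n \<and> real n \<le> M * W" using CA A by auto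
    have "2 * K = M / (2 * E)" by (simp add: K_def)
    also have "\<dots> \<le> M / 1" using M E1 by (intro divide_left_mono) auto
    finally show "2 * K \<le> M" by simp
    fix n assume n: "n \<in> C"
    hence n': "n > 0" "real n \<le> exp L" using CA A(2) by force+
    have "real (2 ^ card (exact_primepows n)) \<le> real n" using two_power_card_exact_primepows_le[OF n'(1)] by (rule of_nat_mono)
    hence "2 ^ card (exact_primepows n) \<le> real n" by (simp only: of_nat_power of_nat_numeral)
    hence "2 ^ card (exact_primepows n) \<le> exp L" using n'(2) by (rule order.trans)
    hence "ln (2 ^ card (exact_primepows n)) \<le> ln (exp L)" by (subst ln_le_cancel_iff) auto
    thus "real (card (exact_primepows n)) \<le> L / ln 2" by (simp add: ln_realpow field_simps)
  next
    fix q assume "q \<in> all_exact_primepows C"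
    thus "real q \<le> exp L" using eC pp by auto
  next
    show "\<exists>x. \<bar>real_of_int (x - h)\<bar> \<le> K \<and>
       (\<forall>q\<in>all_exact_primepows C. real (card (divisible_exactly q (unaligned C K h))) < t \<longrightarrow> int q dvd x)" for h
      by (rule key)
  next
    define e where "e = exp (- ((K / (M * W))\<^sup>2 * t / (L / ln 2)))"
    define m where "m = card (all_exact_primepows C)"
    have m: "real m \<le> exp L" unfolding m_def using cardEC cardL by linarith
    have "K / (M * W) = 1 / (4 * E * W)" using M by (simp add: K_def)
    hence "(K / (M * W))\<^sup>2 * t / (L / ln 2) \<ge> 4 * L" using C4 by (simp add: mult_ac)
    hence e: "e \<le> exp (- (4 * L))" unfolding e_def by simp
    \<comment> \<open>The saving exp (-4 L) pays for P = exp L and for the number m of prime powers, with exp (-2 L) to spare.\<close>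
    have "exp L * e * real m \<le> exp L * exp (- (4 * L)) * exp L"
      using e m by (intro mult_mono) (auto simp: e_def)
    also have "\<dots> = exp (- (2 * L))" by (simp add: exp_add [symmetric])
    finally have sm: "exp L * e * real m \<le> exp (- (2 * L))" .
    have "exp (- (2 * L)) \<le> 1" using L10 by simp
    hence pw: "(1 + exp L * e) ^ m - 1 \<le> 2 * (exp L * e * real m)"
    proof (intro power_minus_one_le)
      show "exp L * e * real m \<le> 1" using sm \<open>exp (- (2 * L)) \<le> 1\<close> by linarith
    qed (simp add: e_def)
    have K2: "2 * K + 1 \<le> 2 * exp L"
    proof -
      have "2 * K = M / (2 * E)" by (simp add: K_def)
      also have "\<dots> \<le> M / 1" using M E1 by (intro divide_left_mono) auto
      finally show ?thesis using MexpL M2 by linarith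
    qed
    have "(2 * K + 1) * ((1 + exp L * e) ^ m - 1) \<le> (2 * exp L) * (2 * exp (- (2 * L)))"
    proof (intro mult_mono)
      show "(1 + exp L * e) ^ m - 1 \<le> 2 * exp (- (2 * L))" using pw sm by linarith
    qed (use K2 pos in \<open>auto simp: e_def\<close>)
    also have "\<dots> = 4 * exp (- L)" by (simp add: exp_add [symmetric])
    also have "\<dots> \<le> 1 / 2"
    proof -
      have "8 \<le> exp L" using exp_ge_add_one_self[of L] L10 by linarith
      thus ?thesis by (simp add: exp_minus field_simps)
    qed
    finally show "(2 * K + 1) * ((1 + exp L * exp (- ((K / (M * W))\<^sup>2 * t / (L / ln 2)))) ^ card (all_exact_primepows C) - 1) \<le> 1 / 2"
      unfolding e_def m_def .
  next
    have C0: "0 \<notin> C" using CA A0 by auto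
    have "recip_sum C \<le> (\<Sum>n\<in>C. 1 / M)" unfolding recip_sum_def
    proof (rule sum_mono)
      fix n assume "n \<in> C"
      hence "M \<le> real n" using CA A(2) by blast
      thus "1 / real n \<le> 1 / M" using M by (intro divide_left_mono) auto
    qed
    hence "recip_sum C * M \<le> real (card C)" using M by (simp add: field_simps)
    moreover have "(2 - 1 / M) * M \<le> recip_sum C * M" using C M by (intro mult_right_mono) auto
    ultimately have cC: "real (card C) \<ge> 2 * M - 1" using M by (simp add: algebra_simps)
    \<comment> \<open>Prime powers up to M W / E0 are too few for the lcm to compete with 2 ^ |C|, as |C| is at least 2 M - 1.\<close>
    have "real (Lcm C) \<le> exp L ^ card (all_exact_primepows C)"
      using finC C0 eC pp by (intro Lcm_le_power_card) auto
    also have "\<dots> = exp (L * real (card (all_exact_primepows C)))" by (simp add: exp_of_nat_mult [symmetric] mult.commute)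
    also have "\<dots> < exp (M / 2)"
    proof -
      have "L * real (card (all_exact_primepows C)) \<le> L * (M * W / E0)"
        using cardEC cardA L10 by (intro mult_left_mono) linarith+
      also have "\<dots> = M * (L * W / E0)" by simp
      also have "\<dots> < M * (1 / 2)" using C5 M by (intro mult_strict_left_mono) auto
      finally show ?thesis by simp
    qed
    finally have l: "real (Lcm C) < exp (M / 2)" .
    have "2 * exp (M / 2) = exp (ln 2 + M / 2)" by (simp add: exp_add)
    also have "\<dots> \<le> exp ((2 * M - 1) * ln 2)"
    proof -
      have l2: "ln 2 \<ge> (1/2::real)" using ln_le_minus_one[of "1/2::real"] by (simp add: ln_div)
      have "(2 * M - 2) * (1 / 2) \<le> (2 * M - 2) * ln 2" using M2 l2 by (intro mult_left_mono) auto
      moreover have "M / 2 \<le> (2 * M - 2) * (1 / 2)" using M2 by simp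
      ultimately show ?thesis by (simp add: algebra_simps)
    qed
    also have "\<dots> \<le> exp (real (card C) * ln 2)" using cC by (simp add: mult_right_mono)
    also have "\<dots> = 2 ^ card C" by (simp add: exp_of_nat_mult)
    finally show "2 * real (Lcm C) < 2 ^ card C" using l by linarith
  qed (use finC \<open>C \<noteq> {}\<close> M pos C L10 in auto)
  thus ?thesis using CA by blast
qed

text \<open>
  Each such \<open>n\<close> is the product of a prime power \<open>q\<close> and a cofactor below \<open>y\<close>.
\<close>

lemma recip_sum_dominant_primepow_le:
  assumes A: "A \<subseteq> {1..N}" and y: "y \<ge> 1" and N: "N \<ge> 3"
    and bad: "\<And>n. n \<in> A \<Longrightarrow> \<exists>q\<in>exact_primepows n. real q * y > real n"
  shows "recip_sum A \<le> (ln (ln (real N)) + 11) * (ln y + 1)"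
proof -
  have finA: "finite A" using A finite_subset by auto
  obtain f where f: "\<And>n. n \<in> A \<Longrightarrow> f n \<in> exact_primepows n \<and> real (f n) * y > real n" using bad by metis
  define m where "m = nat \<lfloor>y\<rfloor>"
  have m: "m \<ge> 1" "real m \<le> y" using y by (auto simp: m_def le_nat_floor of_nat_floor)
  have "recip_sum A \<le> (\<Sum>q\<in>f ` A. (\<Sum>k=1..m. 1 / real k) / real q)"
    unfolding recip_sum_def
  proof (rule sum_inverse_fibre_le)
    fix n assume n: "n \<in> A"
    thus "n = f n * (n div f n)" using f[OF n] exact_primepow_dvd by (metis dvd_mult_div_cancel)
  next
    fix q assume "q \<in> f ` A"
    show "(\<Sum>b\<in>(\<lambda>n. n div f n) ` {n\<in>A. f n = q}. 1 / real b) \<le> (\<Sum>k=1..m. 1 / real k)"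
    proof (rule sum_mono2)
      show "(\<lambda>n. n div f n) ` {n\<in>A. f n = q} \<subseteq> {1..m}"
      proof clarify
        fix n assume n: "n \<in> A"
        have d: "f n dvd n" "f n > 0" "n > 0" using f[OF n] exact_primepow_dvd exact_primepow_pos A n by auto
        hence "f n \<le> n" by (intro dvd_imp_le)
        hence "n div f n \<ge> 1" using d(2) by (simp add: Suc_le_eq div_greater_zero_iff)
        moreover have "real (n div f n) \<le> y"
          using f[OF n] d by (simp add: real_of_nat_div field_simps)
        hence "n div f n \<le> m" unfolding m_def by (rule le_nat_floor)
        ultimately show "n div f n \<in> {1..m}" by simp
      qed
    qed auto
  qed (use finA in auto)
  also have "\<dots> = (\<Sum>k=1..m. 1 / real k) * recip_sum (f ` A)"
    by (simp add: recip_sum_def sum_distrib_left)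
  also have "\<dots> \<le> (ln y + 1) * (ln (ln (real N)) + 11)"
  proof (rule mult_mono)
    have "(\<Sum>k=1..m. 1 / real k) \<le> ln (real m) + 1" using m by (intro harmonic_upper) auto
    also have "ln (real m) \<le> ln y" using m y by (subst ln_le_cancel_iff) auto
    finally show "(\<Sum>k=1..m. 1 / real k) \<le> ln y + 1" by simp
    have "recip_sum (f ` A) \<le> recip_sum {q. q \<le> N \<and> primepow q}"
    proof (rule recip_sum_mono)
      show "f ` A \<subseteq> {q. q \<le> N \<and> primepow q}"
      proof clarify
        fix n assume n: "n \<in> A"
        have "f n \<le> n" using f[OF n] exact_primepow_dvd A n by (intro dvd_imp_le) auto
        thus "f n \<le> N \<and> primepow (f n)" using f[OF n] exact_primepow_primepow A n by auto
      qed
    qed auto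
    also have "\<dots> \<le> ln (ln (real N)) + 11"
      unfolding recip_sum_def using N by (intro sum_inverse_primepow_le) auto
    finally show "recip_sum (f ` A) \<le> ln (ln (real N)) + 11" .
  qed (use y in \<open>auto simp: recip_sum_def intro!: sum_nonneg\<close>)
  finally show ?thesis by (simp add: mult.commute)
qed

text \<open>
  Three parts of \<open>A\<close> are considered: the number 1, the numbers with a dominant prime power, and the
  rest, which is divided into windows of ratio \<open>exp (L powr (1/5))\<close>.  The lower bound on the
  reciprocal sum is what remains in the rest if every window has sum below 4.
\<close>

lemma unit_sum_if_recip_sum_large:
  fixes A :: "nat set" and N :: nat
  defines "L \<equiv> ln (real N)"
  assumes L: "admissible L" and A: "A \<subseteq> {1..N}"
    and big: "recip_sum A \<ge> 1 + (ln L + 11) * (L powr (4/5) + 1) + 4 * (L powr (4/5) + 1)"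
  shows "\<exists>S\<subseteq>A. recip_sum S = 1"
proof -
  have L10: "L \<ge> 10" using L by (simp add: admissible_def)
  have N0: "N > 0" using L10 unfolding L_def by (cases N) auto
  have expL: "exp L = real N" using N0 by (simp add: L_def)
  have N3: "N \<ge> 3" using exp_ge_add_one_self[of L] L10 expL by linarith
  have finA: "finite A" using A finite_subset by auto
  define E0 where "E0 = exp (L powr (4/5))"
  define W where "W = exp (L powr (1/5))"
  define A1 where "A1 = {n\<in>A. n > 1 \<and> (\<exists>q\<in>exact_primepows n. real q * E0 > real n)}"
  define A2 where "A2 = {n\<in>A. n > 1 \<and> (\<forall>q\<in>exact_primepows n. real q * E0 \<le> real n)}"
  have fin: "finite A1" "finite A2" using finA by (auto simp: A1_def A2_def)
  have "recip_sum A \<le> recip_sum ({1} \<union> A1 \<union> A2)"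
    using fin A by (intro recip_sum_mono) (auto simp: A1_def A2_def not_le)
  also have "\<dots> = 1 + recip_sum A1 + recip_sum A2" unfolding recip_sum_def
  proof -
    have "({1} \<inter> A1) = {}" "({1} \<union> A1) \<inter> A2 = {}" by (auto simp: A1_def A2_def not_le)
    thus "(\<Sum>n\<in>{1} \<union> A1 \<union> A2. 1 / real n) = 1 + (\<Sum>n\<in>A1. 1 / real n) + (\<Sum>n\<in>A2. 1 / real n)"
      using fin by (subst sum.union_disjoint, simp, simp, simp, subst sum.union_disjoint) auto
  qed
  also have "recip_sum A1 \<le> (ln (ln (real N)) + 11) * (ln E0 + 1)"
  proof (rule recip_sum_dominant_primepow_le)
    show "A1 \<subseteq> {1..N}" using A by (auto simp: A1_def)
    show "E0 \<ge> 1" by (simp add: E0_def)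
  qed (use N3 in \<open>auto simp: A1_def\<close>)
  hence "1 + recip_sum A1 + recip_sum A2 \<le> 1 + (ln L + 11) * (L powr (4/5) + 1) + recip_sum A2"
    by (simp add: E0_def L_def)
  finally have big2: "recip_sum A2 \<ge> 4 * (L powr (4/5) + 1)" using big by linarith
  define i where "i n = nat \<lfloor>ln (real n) / L powr (1/5)\<rfloor>" for n :: nat
  have Lp: "L powr (1/5) > 0" using L10 by simp
  \<comment> \<open>The number of windows up to N.\<close>
  have Lq: "L / L powr (1/5) = L powr (4/5)"
  proof -
    have "L powr 1 / L powr (1/5) = L powr (1 - 1/5)" by (rule powr_diff [symmetric])
    thus ?thesis using L10 by simp
  qed
  have ir: "real (i n) * L powr (1/5) \<le> ln (real n)" "ln (real n) \<le> (real (i n) + 1) * L powr (1/5)"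
    "real (i n) \<le> L powr (4/5)" if n: "n \<in> A2" for n
  proof -
    have n1: "n \<ge> 1" "n \<le> N" using n A by (auto simp: A2_def)
    have l0: "0 \<le> ln (real n) / L powr (1/5)" using n1 by simp
    have a: "real (i n) \<le> ln (real n) / L powr (1/5)" using l0 by (simp add: i_def of_nat_floor)
    have b: "ln (real n) / L powr (1/5) \<le> real (i n) + 1" using l0 unfolding i_def by linarith
    show "real (i n) * L powr (1/5) \<le> ln (real n)" using a Lp by (simp add: pos_le_divide_eq)
    show "ln (real n) \<le> (real (i n) + 1) * L powr (1/5)" using b Lp by (simp add: pos_divide_le_eq)
    have "ln (real n) \<le> L" using n1 unfolding L_def by (subst ln_le_cancel_iff) auto
    hence "ln (real n) / L powr (1/5) \<le> L / L powr (1/5)" using Lp by (intro divide_right_mono) auto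
    thus "real (i n) \<le> L powr (4/5)" using a Lq by linarith
  qed
  define J where "J = nat \<lfloor>L powr (4/5)\<rfloor>"
  have J: "real J \<le> L powr (4/5)" by (simp add: J_def of_nat_floor)
  have "\<exists>j\<in>{0..J}. recip_sum {n\<in>A2. i n = j} \<ge> 4"
  proof (rule ccontr)
    assume no: "\<not> ?thesis"
    have "recip_sum A2 = (\<Sum>j\<in>i ` A2. \<Sum>n\<in>{n\<in>A2. i n = j}. 1 / real n)"
      unfolding recip_sum_def using fin(2) by (rule sum.image_gen)
    also have "\<dots> \<le> (\<Sum>j\<in>{0..J}. \<Sum>n\<in>{n\<in>A2. i n = j}. 1 / real n)"
    proof (rule sum_mono2)
      show "i ` A2 \<subseteq> {0..J}" using ir(3) by (auto simp: J_def le_nat_floor)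
    qed (auto intro!: sum_nonneg)
    also have "\<dots> < (\<Sum>j\<in>{0..J}. 4)"
    proof (rule sum_strict_mono)
      fix j assume "j \<in> {0..J}"
      hence "\<not> 4 \<le> recip_sum {n\<in>A2. i n = j}" using no by blast
      thus "(\<Sum>n\<in>{n\<in>A2. i n = j}. 1 / real n) < 4" by (simp add: recip_sum_def)
    qed auto
    also have "\<dots> = 4 * (real J + 1)" by simp
    also have "\<dots> \<le> 4 * (L powr (4/5) + 1)" using J by simp
    finally show False using big2 by linarith
  qed
  then obtain j where j: "recip_sum {n\<in>A2. i n = j} \<ge> 4" by blast
  have "\<exists>S\<subseteq>{n\<in>A2. i n = j}. recip_sum S = 1"
  proof (rule window_unit_sum[OF L, of "exp (real j * L powr (1/5))"])
    fix n assume "n \<in> {n\<in>A2. i n = j}"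
    hence n: "n \<in> A2" "i n = j" by auto
    have n1: "n > 1" "n \<le> N" using n A by (auto simp: A2_def)
    have "exp (real j * L powr (1/5)) \<le> exp (ln (real n))" using ir(1)[OF n(1)] n(2) by simp
    moreover have "exp (ln (real n)) \<le> exp ((real j + 1) * L powr (1/5))" using ir(2)[OF n(1)] n(2) by simp
    moreover have "exp ((real j + 1) * L powr (1/5)) = exp (real j * L powr (1/5)) * exp (L powr (1/5))"
      by (simp add: exp_add [symmetric] algebra_simps)
    ultimately show "1 < n \<and> exp (real j * L powr (1/5)) \<le> real n \<and>
        real n \<le> exp (real j * L powr (1/5)) * exp (L powr (1/5)) \<and> real n \<le> exp L"
      using n1 expL by simp
  next
    fix n q assume "n \<in> {n\<in>A2. i n = j}" "q \<in> exact_primepows n"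
    thus "real q * exp (L powr (4/5)) \<le> real n" by (auto simp: A2_def E0_def)
  qed (use fin j in auto)
  moreover have "{n\<in>A2. i n = j} \<subseteq> A" by (auto simp: A2_def)
  ultimately show ?thesis by blast
qed

theorem theorem1p1:
  fixes \<epsilon> :: real
  assumes "\<epsilon> > 0"
  shows "\<exists>N\<^sub>0::nat. \<forall>N\<ge>N\<^sub>0. \<forall>A::nat set.
           A \<subseteq> {1..N} \<longrightarrow>
           (\<Sum>n\<in>A. 1 / real n) \<ge> ln (real N) powr (4/5 + \<epsilon>) \<longrightarrow>
           (\<exists>B. B \<subseteq> A \<and> (\<Sum>n\<in>B. 1 / real n) = 1)"
proof -
  have "eventually (\<lambda>L. 1 + (ln L + 11) * (L powr (4/5) + 1) + 4 * (L powr (4/5) + 1) \<le> L powr (4/5 + \<epsilon>)) at_top"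
    using assms by real_asymp
  hence "eventually (\<lambda>L. admissible L \<and>
      1 + (ln L + 11) * (L powr (4/5) + 1) + 4 * (L powr (4/5) + 1) \<le> L powr (4/5 + \<epsilon>)) at_top"
    using eventually_admissible by (rule eventually_conj[rotated])
  moreover have "filterlim (\<lambda>N. ln (real N)) at_top sequentially" by real_asymp
  ultimately have "eventually (\<lambda>N. admissible (ln (real N)) \<and>
      1 + (ln (ln (real N)) + 11) * (ln (real N) powr (4/5) + 1) + 4 * (ln (real N) powr (4/5) + 1)
        \<le> ln (real N) powr (4/5 + \<epsilon>)) sequentially"
    by (rule eventually_compose_filterlim)
  then obtain N0 where N0: "\<And>N. N \<ge> N0 \<Longrightarrow> admissible (ln (real N)) \<and>
      1 + (ln (ln (real N)) + 11) * (ln (real N) powr (4/5) + 1) + 4 * (ln (real N) powr (4/5) + 1)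
        \<le> ln (real N) powr (4/5 + \<epsilon>)"
    unfolding eventually_sequentially by blast
  show ?thesis
  proof (intro exI[of _ N0] allI impI)
    fix N :: nat and A :: "nat set"
    assume N: "N0 \<le> N" and A: "A \<subseteq> {1..N}"
      and big: "ln (real N) powr (4/5 + \<epsilon>) \<le> (\<Sum>n\<in>A. 1 / real n)"
    have "\<exists>S\<subseteq>A. recip_sum S = 1"
      using N0[OF N] big by (intro unit_sum_if_recip_sum_large[OF _ A]) (auto simp: recip_sum_def)
    thus "\<exists>B. B \<subseteq> A \<and> (\<Sum>n\<in>B. 1 / real n) = 1" by (simp add: recip_sum_def)
  qed
qed

end
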